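(* Let $n\ge1$, let $B_n\subseteq\mathbb{C}^{n\times n}$ be the finite set of $n\times n$ matrices with exactly one nonzero entry in each row and each column, every nonzero entry being $\pm1$, and let $\mathbf{I}(B_n)\subseteq\mathbb{C}[\mathbf{x}_{n\times n}]$ be its vanishing ideal. Let $J$ be the ideal generated by $x_{i,j}^3-x_{i,j}$ ($1\le i,j\le n$), $x_{i,j}x_{i,j'}$ ($j<j'$), $x_{i,j}x_{i',j}$ ($i<i'$), $\sum_{j=1}^n x_{i,j}^2-1$ ($1\le i\le n$), and $\sum_{i=1}^n x_{i,j}^2-1$ ($1\le j\le n$). Then $I_{B_n}=\mathrm{gr}\,\mathbf{I}(B_n)$ and $J=\mathbf{I}(B_n)$. Moreover, the monomials $\{\mathfrak{s}(w):w\in B_n\}$ descend to a basis of $\mathbb{C}[\mathbf{x}_{n\times n}]/I_{B_n}$, and this is the standard monomial basis of $I_{B_n}$ with respect to the Toeplitz order (i.e. $\{\mathfrak{s}(w):w\in B_n\}$ is exactly the set of monomials not lying in the initial ideal $\mathrm{in}_{<_{\mathrm{Top}}} I_{B_n}$).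
   Context: $\mathbb{C}[\mathbf{x}_{n\times n}]$ is the polynomial ring in variables $x_{i,j}$, $1\le i,j\le n$ (coordinates on $\mathbb{C}^{n\times n}$). $I_{B_n}$ is generated by: $x_{i,j}^3$; $x_{i,j}x_{i,j'}$ for $j<j'$; $x_{i,j}x_{i',j}$ for $i<i'$; $\sum_{j} x_{i,j}^2$ for each $i$; $\sum_{i} x_{i,j}^2$ for each $j$. For an ideal $I$, $\mathrm{gr}\,I$ is the ideal generated by the top-degree homogeneous components $\tau(f)$ of all nonzero $f\in I$. Toeplitz order $<_{\mathrm{Top}}$: the lexicographic monomial order for the variable order $x_{1,1}>x_{2,1}>x_{1,2}>x_{3,1}>x_{2,2}>x_{1,3}>\dots>x_{n,n-1}>x_{n-1,n}>x_{n,n}$ (variables ordered by increasing $i+j$, and within fixed $i+j$ by decreasing $i$). For $S\subseteq[n]\times[n]$, $m(S)=\prod_{(i,j)\in S}x_{i,j}$. A rook placement is a subset of $[n]\times[n]$ with no two points sharing a first or a second coordinate. Shadow set $\mathcal{S}(P)$ of a rook placement $P$: let $P_1$ be the points $(i,j)\in P$ with no other $(i',j')\in P$ having $i'<i$ and $j'<j$; list them as $(i_1,j_1),\dots,(i_m,j_m)$ with $i_1<\dots<i_m$; the corners are $(i_{t+1},j_t)$, $1\le t\le m-1$; remove $P_1$ and repeat; $\mathcal{S}(P)$ is the set of all corners from all rounds. Combinatorially, signed permutations are pairs $w=(\sigma,\kappa)$, $\sigma\in\mathfrak{S}_n$, $\kappa:[n]\to\{0,1\}$; $\mathrm{neg}(w)=\{(i,\sigma(i)):\kappa(\sigma(i))=1\}$,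 $\mathrm{pos}(w)=\{(i,\sigma(i)):\kappa(\sigma(i))=0\}$, and $\mathfrak{s}(w)=m(\mathrm{neg}(w))\,m(\mathcal{S}(\mathrm{pos}(w)))^2$; $w$ ranges over all $2^n n!$ such pairs. *)

theory Defs
  imports
    Complex_Main
    "HOL-Library.Poly_Mapping"
    "HOL-Library.FuncSet"
    "HOL-Combinatorics.Permutations"
    "HOL-Algebra.QuotRing"
    "HOL-Algebra.Embedded_Algebras"
begin

section \<open>The polynomial ring in the variables $x_{i,j}$, $1 \le i, j \le n$\<close>

type_synonym cell = "nat \<times> nat"
type_synonym mon = "cell \<Rightarrow>\<^sub>0 nat"
type_synonym cpoly = "mon \<Rightarrow>\<^sub>0 complex"

definition grid :: "nat \<Rightarrow> cell set" where
  "grid n = {1..n} \<times> {1..n}"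

text \<open>The type \<^typ>\<open>cpoly\<close> has a variable for every pair of natural numbers; the polynomial ring
  for a given \<open>n\<close> is the subring of the polynomials that involve only variables in \<open>grid n\<close>.
  Ideals and quotients are taken in this ring, not in the whole type.\<close>

definition poly_ring :: "nat \<Rightarrow> cpoly ring" where
  "poly_ring n = \<lparr>carrier = {f. \<forall>m\<in>Poly_Mapping.keys f. Poly_Mapping.keys m \<subseteq> grid n},
     mult = (*), one = 1, zero = 0, add = (+)\<rparr>"

definition pconst :: "complex \<Rightarrow> cpoly" where
  "pconst c = Poly_Mapping.single 0 c"

definition pmono :: "mon \<Rightarrow> cpoly" where
  "pmono m = Poly_Mapping.single m 1"

definition var :: "nat \<Rightarrow> nat \<Rightarrow> cpoly" where
  "var i j = pmono (Poly_Mapping.single (i, j) 1)"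

definition peval :: "(cell \<Rightarrow> complex) \<Rightarrow> cpoly \<Rightarrow> complex" where
  "peval A f =
     (\<Sum>m\<in>Poly_Mapping.keys f. Poly_Mapping.lookup f m *
       (\<Prod>v\<in>Poly_Mapping.keys m. A v ^ Poly_Mapping.lookup m v))"

lemma poly_ring_carrier_closed:
  assumes "f \<in> carrier (poly_ring n)" "g \<in> carrier (poly_ring n)"
  shows "f + g \<in> carrier (poly_ring n)" "f * g \<in> carrier (poly_ring n)"
proof -
  have f: "\<And>m. m \<in> Poly_Mapping.keys f \<Longrightarrow> Poly_Mapping.keys m \<subseteq> grid n"
    and g: "\<And>m. m \<in> Poly_Mapping.keys g \<Longrightarrow> Poly_Mapping.keys m \<subseteq> grid n"
    using assms by (simp_all add: poly_ring_def)
  have "Poly_Mapping.keys m \<subseteq> grid n" if "m \<in> Poly_Mapping.keys (f + g)" for m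
    using that Poly_Mapping.keys_add[of f g] f g by blast
  then show "f + g \<in> carrier (poly_ring n)"
    by (simp add: poly_ring_def)
  have "Poly_Mapping.keys m \<subseteq> grid n" if m: "m \<in> Poly_Mapping.keys (f * g)" for m
  proof -
    obtain a b where ab: "a \<in> Poly_Mapping.keys f" "b \<in> Poly_Mapping.keys g" and m: "m = a + b"
      using m Poly_Mapping.keys_mult[of f g] by blast
    show ?thesis
      unfolding m using f[OF ab(1)] g[OF ab(2)] Poly_Mapping.keys_add[of a b] by blast
  qed
  then show "f * g \<in> carrier (poly_ring n)"
    by (simp add: poly_ring_def)
qed

lemma poly_ring_sel [simp]:
  "mult (poly_ring n) = (*)" "one (poly_ring n) = 1"
  "zero (poly_ring n) = 0" "add (poly_ring n) = (+)"
  by (simp_all add: poly_ring_def)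

lemma cring_poly_ring: "cring (poly_ring n)"
proof (rule cringI)
  show "abelian_group (poly_ring n)"
  proof (rule abelian_groupI)
    fix x assume x: "x \<in> carrier (poly_ring n)"
    have "- x \<in> carrier (poly_ring n)"
      using x by (simp add: poly_ring_def)
    moreover have "- x + x = 0"
      by simp
    ultimately show "\<exists>y\<in>carrier (poly_ring n). y \<oplus>\<^bsub>poly_ring n\<^esub> x = \<zero>\<^bsub>poly_ring n\<^esub>"
      unfolding poly_ring_sel by (rule rev_bexI)
  next
    show "\<zero>\<^bsub>poly_ring n\<^esub> \<in> carrier (poly_ring n)"
      by (simp add: poly_ring_def)
  qed (simp_all only: poly_ring_sel poly_ring_carrier_closed add_ac add_0_left
      add_0_right)
  show "Group.comm_monoid (poly_ring n)"
  proof (rule comm_monoidI)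
    show "\<one>\<^bsub>poly_ring n\<^esub> \<in> carrier (poly_ring n)"
      by (simp add: poly_ring_def)
  qed (simp_all only: poly_ring_sel poly_ring_carrier_closed mult_ac mult_1_left
      mult_1_right)
qed (simp only: poly_ring_sel distrib_right)

section \<open>The point set and its ideals\<close>

text \<open>An \<open>n \<times> n\<close> matrix is a function on \<open>grid n\<close>, \<^const>\<open>undefined\<close> elsewhere.\<close>

definition signed_perm_matrices :: "nat \<Rightarrow> (cell \<Rightarrow> complex) set" where
  "signed_perm_matrices n = {A \<in> grid n \<rightarrow>\<^sub>E UNIV.
     (\<forall>i\<in>{1..n}. \<exists>!j. j \<in> {1..n} \<and> A (i, j) \<noteq> 0) \<and>
     (\<forall>j\<in>{1..n}. \<exists>!i. i \<in> {1..n} \<and> A (i, j) \<noteq> 0) \<and>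
     (\<forall>v\<in>grid n. A v \<noteq> 0 \<longrightarrow> A v = 1 \<or> A v = -1)}"

definition vanishing_ideal :: "nat \<Rightarrow> (cell \<Rightarrow> complex) set \<Rightarrow> cpoly set" where
  "vanishing_ideal n Z = {f \<in> carrier (poly_ring n). \<forall>A\<in>Z. peval A f = 0}"

definition rook_products :: "nat \<Rightarrow> cpoly set" where
  "rook_products n =
     {var i j * var i j' | i j j'. i \<in> {1..n} \<and> j \<in> {1..n} \<and> j' \<in> {1..n} \<and> j < j'} \<union>
     {var i j * var i' j | i i' j. i \<in> {1..n} \<and> i' \<in> {1..n} \<and> j \<in> {1..n} \<and> i < i'}"

definition I_B :: "nat \<Rightarrow> cpoly set" where
  "I_B n = Idl\<^bsub>poly_ring n\<^esub>
     ({var i j ^ 3 | i j. i \<in> {1..n} \<and> j \<in> {1..n}} \<union>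
      rook_products n \<union>
      {(\<Sum>j=1..n. var i j ^ 2) | i. i \<in> {1..n}} \<union>
      {(\<Sum>i=1..n. var i j ^ 2) | j. j \<in> {1..n}})"

definition J_B :: "nat \<Rightarrow> cpoly set" where
  "J_B n = Idl\<^bsub>poly_ring n\<^esub>
     ({var i j ^ 3 - var i j | i j. i \<in> {1..n} \<and> j \<in> {1..n}} \<union>
      rook_products n \<union>
      {(\<Sum>j=1..n. var i j ^ 2) - 1 | i. i \<in> {1..n}} \<union>
      {(\<Sum>i=1..n. var i j ^ 2) - 1 | j. j \<in> {1..n}})"

definition mon_degree :: "mon \<Rightarrow> nat" where
  "mon_degree m = (\<Sum>v\<in>Poly_Mapping.keys m. Poly_Mapping.lookup m v)"

definition poly_degree :: "cpoly \<Rightarrow> nat" where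
  "poly_degree f = Max (mon_degree ` Poly_Mapping.keys f)"

definition top_component :: "cpoly \<Rightarrow> cpoly" where
  "top_component f =
     (\<Sum>m\<in>{m \<in> Poly_Mapping.keys f. mon_degree m = poly_degree f}.
       Poly_Mapping.single m (Poly_Mapping.lookup f m))"

definition gr_ideal :: "nat \<Rightarrow> cpoly set \<Rightarrow> cpoly set" where
  "gr_ideal n I = Idl\<^bsub>poly_ring n\<^esub> {top_component f | f. f \<in> I \<and> f \<noteq> 0}"

section \<open>The Toeplitz order and initial ideals\<close>

text \<open>\<open>var_greater (i, j) (i', j')\<close> means $x_{i,j} > x_{i',j'}$.\<close>

fun var_greater :: "cell \<Rightarrow> cell \<Rightarrow> bool" where
  "var_greater (i, j) (i', j') \<longleftrightarrow> i + j < i' + j' \<or> (i + j = i' + j' \<and> i > i')"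

definition toeplitz_less :: "mon \<Rightarrow> mon \<Rightarrow> bool" where
  "toeplitz_less m m' \<longleftrightarrow>
     (\<exists>v. Poly_Mapping.lookup m v < Poly_Mapping.lookup m' v \<and>
       (\<forall>u. var_greater u v \<longrightarrow>
         Poly_Mapping.lookup m u = Poly_Mapping.lookup m' u))"

definition is_leading_mon :: "mon \<Rightarrow> cpoly \<Rightarrow> bool" where
  "is_leading_mon m f \<longleftrightarrow>
     m \<in> Poly_Mapping.keys f \<and> (\<forall>m'\<in>Poly_Mapping.keys f. m' \<noteq> m \<longrightarrow> toeplitz_less m' m)"

definition initial_ideal :: "nat \<Rightarrow> cpoly set \<Rightarrow> cpoly set" where
  "initial_ideal n I =
     Idl\<^bsub>poly_ring n\<^esub> {pmono m | m f. f \<in> I \<and> f \<noteq> 0 \<and> is_leading_mon m f}"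

definition standard_monomials :: "nat \<Rightarrow> cpoly set \<Rightarrow> cpoly set" where
  "standard_monomials n I =
     {pmono m | m. Poly_Mapping.keys m \<subseteq> grid n \<and> pmono m \<notin> initial_ideal n I}"

section \<open>Shadow sets and the monomials of signed permutations\<close>

definition minimal_points :: "cell set \<Rightarrow> cell set" where
  "minimal_points P = {(i, j) \<in> P. \<not> (\<exists>(i', j')\<in>P. i' < i \<and> j' < j)}"

definition corners :: "cell set \<Rightarrow> cell set" where
  "corners L = (let ps = sorted_key_list_of_set fst L
     in {(fst (ps ! Suc t), snd (ps ! t)) | t. Suc t < length ps})"

definition remove_minimal :: "cell set \<Rightarrow> cell set" where
  "remove_minimal P = P - minimal_points P"

text \<open>For finite \<open>P\<close> the iterates of \<^const>\<open>remove_minimal\<close> become empty, so only finitely many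
  rounds contribute to the union.\<close>

definition shadow_set :: "cell set \<Rightarrow> cell set" where
  "shadow_set P = (\<Union>k. corners (minimal_points ((remove_minimal ^^ k) P)))"

definition set_mon :: "cell set \<Rightarrow> cpoly" where
  "set_mon S = (\<Prod>(i, j)\<in>S. var i j)"

type_synonym signed_perm = "(nat \<Rightarrow> nat) \<times> (nat \<Rightarrow> nat)"

definition signed_perms :: "nat \<Rightarrow> signed_perm set" where
  "signed_perms n = {\<sigma>. \<sigma> permutes {1..n}} \<times> ({1..n} \<rightarrow>\<^sub>E {0, 1})"

fun neg_part :: "nat \<Rightarrow> signed_perm \<Rightarrow> cell set" where
  "neg_part n (\<sigma>, \<kappa>) = {(i, \<sigma> i) | i. i \<in> {1..n} \<and> \<kappa> (\<sigma> i) = 1}"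

fun pos_part :: "nat \<Rightarrow> signed_perm \<Rightarrow> cell set" where
  "pos_part n (\<sigma>, \<kappa>) = {(i, \<sigma> i) | i. i \<in> {1..n} \<and> \<kappa> (\<sigma> i) = 0}"

definition signed_mon :: "nat \<Rightarrow> signed_perm \<Rightarrow> cpoly" where
  "signed_mon n w = set_mon (neg_part n w) * set_mon (shadow_set (pos_part n w)) ^ 2"

section \<open>Bases of quotients\<close>

text \<open>The family \<open>(f w)\<close>, \<open>w \<in> W\<close>, descends to a basis of the quotient by \<open>I\<close>. The complex vector
  space structure of the quotient ring is multiplication by the classes of the constants.
  \<^const>\<open>ring.independent\<close> speaks about lists, so the finite index set is enumerated without
  repetition; independence of the list makes \<open>w \<mapsto> f w + I\<close> injective on \<open>W\<close>.\<close>

definition descends_to_basis :: "nat \<Rightarrow> cpoly set \<Rightarrow> 'w set \<Rightarrow> ('w \<Rightarrow> cpoly) \<Rightarrow> bool" where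
  "descends_to_basis n I W f \<longleftrightarrow>
     (let R = poly_ring n; Q = R Quot I;
          cls = (\<lambda>g. I +>\<^bsub>R\<^esub> g);
          K = cls ` range pconst
      in \<exists>ws. distinct ws \<and> set ws = W \<and>
           ring.independent Q K (map (\<lambda>w. cls (f w)) ws) \<and>
           ring.Span Q K (map (\<lambda>w. cls (f w)) ws) = carrier Q)"

end

theory Submission
  imports Defs "HOL-Library.Function_Algebras"
begin

text \<open>A monomial outside \<open>I_B n\<close> has the form \<open>m(N) m(R)\<^sup>2\<close> with \<open>N\<close> and \<open>R\<close> disjoint and \<open>N \<union> R\<close> a rook
  placement. Running row insertion backwards on \<open>R\<close>, in the rows and columns not met by \<open>N\<close>, either
  rebuilds a permutation with shadow set \<open>R\<close> or gets stuck. In the latter case \<open>R\<close> contains an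
  increasing chain that is longer than the number of free rows (those met by neither \<open>N\<close> nor \<open>R\<close>)
  below its last point, or the same holds with columns for rows. Let \<open>S\<close> be the column set of the
  chain, and let \<open>T\<close> consist of its rows and the free rows above its last point. Modulo \<open>I_B n\<close>, and in
  the presence of the remaining factors of the monomial, the product over \<open>s \<in> S\<close> of the sums of
  \<open>x\<^sub>t\<^sub>s\<^sup>2\<close> over \<open>t \<in> T\<close> equals up to sign the product of the sums over the other free rows, of which there
  are fewer than \<open>card S\<close>, so it vanishes by the pigeonhole principle. Its terms indexed by injections
  \<open>S \<rightarrow> T\<close> therefore give an element of \<open>I_B n\<close> whose leading monomial is the given one. Hence the
  monomials of signed permutations span modulo \<open>I_B n\<close> and, by induction on the degree, modulo \<open>J_B n\<close>.
  As there are no more of them than matrices, they are linearly independent as functions on the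
  matrices, and all remaining claims follow by comparing top degree parts.\<close>

section \<open>Viennot shadows\<close>

text \<open>The reductions are homogeneous, and this carries the passage from \<open>I_B n\<close>
  to \<open>J_B n\<close>: each generator of \<open>I_B n\<close> is the top part of an element of
  \<open>J_B n\<close>, so a reduction of degree d modulo \<open>I_B n\<close> can be repeated
  modulo \<open>J_B n\<close> with an error of degree below d. Independence is then tested on actual
  points. That distinct signed permutations have distinct monomials comes out of the dimension count
  and not out of the combinatorics: coefficients are indexed by signed permutations, so independence
  of the family contains it. Of the Toeplitz order, the chain reduction exploits that the variables
  decrease along every row and every column. This is symmetric in the two coordinates, so one
  argument treats chains that are too long for the rows and chains that are too long for the
  columns. Terms of the product that belong to maps S \<rightarrow> T that are not injective may
  exceed the given monomial, but they lie in \<open>I_B n\<close> because they put two squares into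
  one line.\<close>

lemma remove_minimal_pow_eq:
  assumes mono: "\<And>i j i' j'. (i, j) \<in> P \<Longrightarrow> (i', j') \<in> P \<Longrightarrow> i < i' \<Longrightarrow> j < j' \<Longrightarrow>
      lev (i, j) < (lev (i', j') :: nat)"
    and pred: "\<And>i j. (i, j) \<in> P \<Longrightarrow> lev (i, j) > 1 \<Longrightarrow>
      \<exists>i' j'. (i', j') \<in> P \<and> i' < i \<and> j' < j \<and> lev (i', j') = lev (i, j) - 1"
    and pos: "\<And>p. p \<in> P \<Longrightarrow> lev p > 0"
  shows "(remove_minimal ^^ k) P = {p \<in> P. lev p > k}"
    and "minimal_points ((remove_minimal ^^ k) P) = {p \<in> P. lev p = Suc k}"
proof -
  \<comment> \<open>The hypotheses force \<open>lev p\<close> to be the number of points in a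
    longest increasing chain of \<open>P\<close> ending at \<open>p\<close>: \<open>mono\<close> and
    \<open>pos\<close> bound chains from above, \<open>pred\<close> builds one of this length.
    Removing minimal points therefore peels off one level per round.\<close>
  have min: "minimal_points {p \<in> P. lev p > k} = {p \<in> P. lev p = Suc k}" for k
  proof (intro equalityI subsetI)
    fix p assume "p \<in> minimal_points {p \<in> P. lev p > k}"
    then obtain i j where p: "p = (i, j)" "(i, j) \<in> P" "lev (i, j) > k"
      and no: "\<not> (\<exists>(i', j')\<in>{p \<in> P. lev p > k}. i' < i \<and> j' < j)"
      by (auto simp: minimal_points_def)
    have "lev (i, j) = Suc k"
    proof (rule ccontr)
      assume "lev (i, j) \<noteq> Suc k"
      then have "lev (i, j) > Suc k" using p by simp
      with pred[of i j] p obtain i' j' where "(i', j') \<in> P" "i' < i" "j' < j"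
        "lev (i', j') = lev (i, j) - 1" by fastforce
      with no \<open>lev (i, j) > Suc k\<close> show False by fastforce
    qed
    with p show "p \<in> {p \<in> P. lev p = Suc k}" by simp
  next
    fix p assume "p \<in> {p \<in> P. lev p = Suc k}"
    moreover obtain i j where "p = (i, j)" by (cases p)
    ultimately show "p \<in> minimal_points {p \<in> P. lev p > k}"
      using mono by (fastforce simp: minimal_points_def)
  qed
  show *: "(remove_minimal ^^ k) P = {p \<in> P. lev p > k}" for k
  proof (induction k)
    case 0
    then show ?case using pos by auto
  next
    case (Suc k)
    have "(remove_minimal ^^ Suc k) P = {p \<in> P. lev p > k} - {p \<in> P. lev p = Suc k}"
      by (simp add: Suc remove_minimal_def min)
    also have "\<dots> = {p \<in> P. lev p > Suc k}" by auto
    finally show ?case .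
  qed
  show "minimal_points ((remove_minimal ^^ k) P) = {p \<in> P. lev p = Suc k}"
    unfolding * by (rule min)
qed

text \<open>Interpreting the locale of \<^const>\<open>sorted_key_list_of_set\<close> yields facts about the locale constant
  \<open>linorder.sorted_key_list_of_set (\<le>)\<close> rather than about the class constant.\<close>

lemma linorder_class_insort_key: "linorder.insort_key (\<le>) f x xs = insort_key f x (xs :: 'a list)"
  for f :: "'a \<Rightarrow> 'b :: linorder"
  by (induction xs) (simp_all add: linorder.insort_key.simps[OF linorder_class.linorder_axioms])

lemma linorder_class_sorted_key_list_of_set:
  "linorder.sorted_key_list_of_set (\<le>) f = sorted_key_list_of_set (f :: 'a \<Rightarrow> 'b :: linorder)"
  by (intro ext) (simp add: linorder.sorted_key_list_of_set_def[OF linorder_class.linorder_axioms]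
    sorted_key_list_of_set_def linorder_class_insort_key[abs_def])

text \<open>Injectivity of \<open>fst\<close> makes the sorted list strictly increasing in the row,
  so adjacency in the list becomes the absence of a point in a row strictly between.\<close>

lemma corners_eq:
  assumes "finite L" "inj_on fst L"
  shows "corners L = {(i, c) | i c i0 j. (i, j) \<in> L \<and> (i0, c) \<in> L \<and> i0 < i \<and>
    (\<forall>i' j'. (i', j') \<in> L \<longrightarrow> \<not> (i0 < i' \<and> i' < i))}"
proof -
  interpret folding_insort_key "(\<le>)" "(<)" L "fst :: cell \<Rightarrow> nat"
    by unfold_locales (use assms in auto)
  note list = set_sorted_key_list_of_set strict_sorted_key_list_of_set
  define ps where "ps = sorted_key_list_of_set fst L"
  have set: "set ps = L"
    using assms list(1)[of L] by (simp add: ps_def linorder_class_sorted_key_list_of_set)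
  have index: "\<exists>s<length ps. ps ! s = q" if "q \<in> L" for q
    using that unfolding set[symmetric] in_set_conv_nth by blast
  have "sorted_wrt (<) (map fst ps)"
    using list(2)[of L] by (simp add: ps_def linorder_class_sorted_key_list_of_set)
  then have less: "fst (ps ! s) < fst (ps ! t)" if "s < t" "t < length ps" for s t
    using that by (simp add: sorted_wrt_iff_nth_less)
  have less_iff: "fst (ps ! s) < fst (ps ! t) \<longleftrightarrow> s < t" if "s < length ps" "t < length ps" for s t
    using that less[of s t] less[of t s] by (metis linorder_neqE_nat order_less_asym order_less_irrefl)
  show ?thesis
  proof (intro equalityI subsetI)
    fix p assume "p \<in> corners L"
    then obtain t where t: "Suc t < length ps" "p = (fst (ps ! Suc t), snd (ps ! t))"
      by (auto simp: corners_def ps_def[symmetric])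
    have "(fst (ps ! Suc t), snd (ps ! Suc t)) \<in> L" "(fst (ps ! t), snd (ps ! t)) \<in> L"
      using t set by (auto simp: nth_mem)
    moreover have "fst (ps ! t) < fst (ps ! Suc t)" using less t by simp
    moreover have "\<not> (fst (ps ! t) < i' \<and> i' < fst (ps ! Suc t))" if mem: "(i', j') \<in> L" for i' j'
    proof -
      obtain s where s: "s < length ps" "ps ! s = (i', j')"
        using index[OF mem] by blast
      have "\<not> (t < s \<and> s < Suc t)" by simp
      then show ?thesis using less_iff[of t s] less_iff[of s "Suc t"] t s
        by (metis Suc_lessD fst_conv)
    qed
    ultimately show "p \<in> {(i, c) | i c i0 j. (i, j) \<in> L \<and> (i0, c) \<in> L \<and> i0 < i \<and>
      (\<forall>i' j'. (i', j') \<in> L \<longrightarrow> \<not> (i0 < i' \<and> i' < i))}" unfolding t(2) by blast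
  next
    fix p assume "p \<in> {(i, c) | i c i0 j. (i, j) \<in> L \<and> (i0, c) \<in> L \<and> i0 < i \<and>
      (\<forall>i' j'. (i', j') \<in> L \<longrightarrow> \<not> (i0 < i' \<and> i' < i))}"
    then obtain i c i0 j where p: "p = (i, c)" "(i, j) \<in> L" "(i0, c) \<in> L" "i0 < i"
      and no: "\<And>i' j'. (i', j') \<in> L \<Longrightarrow> \<not> (i0 < i' \<and> i' < i)" by blast
    obtain s t where st: "s < length ps" "ps ! s = (i0, c)" "t < length ps" "ps ! t = (i, j)"
      using index[OF p(2)] index[OF p(3)] by blast
    have "s < t" using less_iff[of s t] st p by simp
    have "t = Suc s"
    proof (rule ccontr)
      assume "t \<noteq> Suc s"
      then have "Suc s < t" using \<open>s < t\<close> by simp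
      then have "i0 < fst (ps ! Suc s)" "fst (ps ! Suc s) < i"
        using less[of s "Suc s"] less[of "Suc s" t] st by auto
      moreover have "ps ! Suc s \<in> L" using set \<open>Suc s < t\<close> st nth_mem by fastforce
      ultimately show False using no[of "fst (ps ! Suc s)" "snd (ps ! Suc s)"] by simp
    qed
    with st have "Suc s < length ps" "(i, c) = (fst (ps ! Suc s), snd (ps ! s))" by auto
    then show "p \<in> corners L" unfolding corners_def Let_def ps_def[symmetric] p(1) by blast
  qed
qed

text \<open>Trades the iteration over rounds for a level function, so that a description of the
  shadow lines by ranks can be plugged in below.\<close>

lemma shadow_set_eq:
  assumes mono: "\<And>i j i' j'. (i, j) \<in> P \<Longrightarrow> (i', j') \<in> P \<Longrightarrow> i < i' \<Longrightarrow> j < j' \<Longrightarrow>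
      lev (i, j) < (lev (i', j') :: nat)"
    and pred: "\<And>i j. (i, j) \<in> P \<Longrightarrow> lev (i, j) > 1 \<Longrightarrow>
      \<exists>i' j'. (i', j') \<in> P \<and> i' < i \<and> j' < j \<and> lev (i', j') = lev (i, j) - 1"
    and pos: "\<And>p. p \<in> P \<Longrightarrow> lev p > 0"
    and P: "finite P" "inj_on fst P"
  shows "shadow_set P = {(i, c) | i c i0 j. (i, j) \<in> P \<and> (i0, c) \<in> P \<and> i0 < i \<and>
    lev (i0, c) = lev (i, j) \<and>
    (\<forall>i' j'. (i', j') \<in> P \<longrightarrow> lev (i', j') = lev (i, j) \<longrightarrow> \<not> (i0 < i' \<and> i' < i))}"
proof -
  have c: "corners (minimal_points ((remove_minimal ^^ k) P)) =
    {(i, c) | i c i0 j. (i, j) \<in> {p \<in> P. lev p = Suc k} \<and> (i0, c) \<in> {p \<in> P. lev p = Suc k} \<and> i0 < i \<and>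
    (\<forall>i' j'. (i', j') \<in> {p \<in> P. lev p = Suc k} \<longrightarrow> \<not> (i0 < i' \<and> i' < i))}" for k
  proof -
    have *: "minimal_points ((remove_minimal ^^ k) P) = {p \<in> P. lev p = Suc k}"
      by (rule remove_minimal_pow_eq(2)) (use mono pred pos in blast)+
    show ?thesis unfolding *
      by (rule corners_eq) (use P in \<open>auto intro: inj_on_subset\<close>)
  qed
  show ?thesis
  proof (intro equalityI subsetI)
    fix p assume "p \<in> shadow_set P"
    then obtain k where "p \<in> corners (minimal_points ((remove_minimal ^^ k) P))"
      unfolding shadow_set_def by blast
    then obtain i c i0 j where "p = (i, c)" "(i, j) \<in> {p \<in> P. lev p = Suc k}"
      "(i0, c) \<in> {p \<in> P. lev p = Suc k}" "i0 < i"
      "\<forall>i' j'. (i', j') \<in> {p \<in> P. lev p = Suc k} \<longrightarrow> \<not> (i0 < i' \<and> i' < i)"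
      unfolding c by blast
    then show "p \<in> {(i, c) | i c i0 j. (i, j) \<in> P \<and> (i0, c) \<in> P \<and> i0 < i \<and>
      lev (i0, c) = lev (i, j) \<and>
      (\<forall>i' j'. (i', j') \<in> P \<longrightarrow> lev (i', j') = lev (i, j) \<longrightarrow> \<not> (i0 < i' \<and> i' < i))}"
      by (intro CollectI exI[of _ i] exI[of _ c] exI[of _ i0] exI[of _ j]) auto
  next
    fix p assume "p \<in> {(i, c) | i c i0 j. (i, j) \<in> P \<and> (i0, c) \<in> P \<and> i0 < i \<and>
      lev (i0, c) = lev (i, j) \<and>
      (\<forall>i' j'. (i', j') \<in> P \<longrightarrow> lev (i', j') = lev (i, j) \<longrightarrow> \<not> (i0 < i' \<and> i' < i))}"
    then obtain i c i0 j where p: "p = (i, c)" "(i, j) \<in> P" "(i0, c) \<in> P" "i0 < i"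
      "lev (i0, c) = lev (i, j)"
      and no: "\<And>i' j'. (i', j') \<in> P \<Longrightarrow> lev (i', j') = lev (i, j) \<Longrightarrow> \<not> (i0 < i' \<and> i' < i)" by blast
    obtain k where "lev (i, j) = Suc k" using pos[OF p(2)] gr0_implies_Suc by blast
    then have "p \<in> corners (minimal_points ((remove_minimal ^^ k) P))"
      unfolding c using p no by (intro CollectI exI[of _ i] exI[of _ c] exI[of _ i0] exI[of _ j]) auto
    then show "p \<in> shadow_set P" unfolding shadow_set_def by blast
  qed
qed

text \<open>Serves arbitrary signed permutations, for which no level function has been
  constructed.\<close>

lemma shadow_set_subset:
  assumes "finite P" "inj_on fst P"
  shows "shadow_set P \<subseteq> fst ` P \<times> snd ` P"
proof -
  have *: "minimal_points ((remove_minimal ^^ k) P) \<subseteq> P" for k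
  proof -
    have "(remove_minimal ^^ k) P \<subseteq> P"
      by (induction k) (auto simp: remove_minimal_def)
    then show ?thesis by (auto simp: minimal_points_def)
  qed
  have "corners L \<subseteq> fst ` P \<times> snd ` P" if sub: "L \<subseteq> P" for L
  proof
    have eq: "corners L = {(i, c) | i c i0 j. (i, j) \<in> L \<and> (i0, c) \<in> L \<and> i0 < i \<and>
        (\<forall>i' j'. (i', j') \<in> L \<longrightarrow> \<not> (i0 < i' \<and> i' < i))}"
      by (rule corners_eq) (use sub assms in \<open>auto intro: finite_subset inj_on_subset\<close>)
    fix p assume "p \<in> corners L"
    then obtain i c i0 j where "p = (i, c)" "(i, j) \<in> L" "(i0, c) \<in> L"
      unfolding eq by blast
    then have "p = (i, c)" "(i, j) \<in> P" "(i0, c) \<in> P" using sub by blast+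
    then show "p \<in> fst ` P \<times> snd ` P" by (auto intro: rev_image_eqI)
  qed
  with * have "corners (minimal_points ((remove_minimal ^^ k) P)) \<subseteq> fst ` P \<times> snd ` P" for k
    by blast
  then show ?thesis unfolding shadow_set_def by blast
qed

text \<open>\<open>C i\<close> consists of the heights of the shadow lines just after row \<open>i\<close>. The step from \<open>i\<close> to \<open>i + 1\<close>
  is row insertion: either a new line starts on top, or the line at height \<open>c\<close> drops to \<open>jj (i + 1)\<close>
  and leaves the corner \<open>(i + 1, c)\<close>.\<close>

lemma shadow_set_growth:
  fixes C :: "nat \<Rightarrow> nat set" and jj :: "nat \<Rightarrow> nat"
  assumes fin: "\<And>i. finite (C i)" and C0: "C 0 = {}"
    and skip: "\<And>i. Suc i \<notin> A \<Longrightarrow> C (Suc i) = C i"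
    and new: "\<And>i. Suc i \<in> A \<Longrightarrow> Suc i \<notin> fst ` R \<Longrightarrow>
      C (Suc i) = insert (jj (Suc i)) (C i) \<and> (\<forall>y\<in>C i. y < jj (Suc i))"
    and bump: "\<And>i c. (Suc i, c) \<in> R \<Longrightarrow>
      c \<in> C i \<and> jj (Suc i) \<notin> C i \<and> jj (Suc i) < c \<and> (\<forall>y\<in>C i. y < c \<longrightarrow> y < jj (Suc i)) \<and>
      C (Suc i) = insert (jj (Suc i)) (C i - {c})"
    and A: "finite A" "0 \<notin> A" "inj_on jj A" and R: "fst ` R \<subseteq> A"
  shows "shadow_set ((\<lambda>i. (i, jj i)) ` A) = R"
proof -
  \<comment> \<open>The rank of a height in \<open>C i\<close>, counted from below, numbers its
    shadow line. It will turn out to be the round in which Viennot's construction meets the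
    line.\<close>
  define rk where "rk i x = card {y \<in> C i. y \<le> x}" for i x
  have rk_less: "rk i x < rk i y" if "y \<in> C i" "x < y" for i x y
  proof -
    have "y \<in> {z \<in> C i. z \<le> y}" "y \<notin> {z \<in> C i. z \<le> x}" "{z \<in> C i. z \<le> x} \<subseteq> {z \<in> C i. z \<le> y}"
      using that by auto
    then show ?thesis
      unfolding rk_def by (intro psubset_card_mono) (use fin in auto)
  qed
  have rk_inj: "x = y" if "x \<in> C i" "y \<in> C i" "rk i x = rk i y" for i x y
    using rk_less[of x i y] rk_less[of y i x] that by (metis less_irrefl linorder_neqE_nat)
  have rk_pos: "rk i x > 0" if "x \<in> C i" for i x
    unfolding rk_def card_gt_0_iff using that fin by auto
  have row_cases: "Suc i \<notin> A \<or> (Suc i \<in> A \<and> Suc i \<notin> fst ` R) \<or> (\<exists>c. (Suc i, c) \<in> R)" for i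
    by force
  \<comment> \<open>A new line starts above all others, and a drop moves a height within the gap
    below it, so the ranks of the other heights do not change.\<close>
  have rk_step: "rk (Suc i) x = rk i x" if x: "x \<in> C i" "x \<in> C (Suc i)" for i x
    using row_cases[of i]
  proof (elim disjE exE conjE)
    assume "Suc i \<notin> A"
    then show ?thesis by (simp add: rk_def skip)
  next
    assume "Suc i \<in> A" "Suc i \<notin> fst ` R"
    note n = new[OF this]
    then have "jj (Suc i) > x" using x by blast
    then have "{y \<in> C (Suc i). y \<le> x} = {y \<in> C i. y \<le> x}" using n by auto
    then show ?thesis by (simp add: rk_def)
  next
    fix c assume "(Suc i, c) \<in> R"
    note b = bump[OF this]
    then have "x \<noteq> c" "x \<noteq> jj (Suc i)" using x by auto
    show ?thesis
    proof (cases "x < c")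
      case True
      then have "x < jj (Suc i)" using b x by blast
      then have "{y \<in> C (Suc i). y \<le> x} = {y \<in> C i. y \<le> x}" using b True by auto
      then show ?thesis by (simp add: rk_def)
    next
      case False
      define X where "X = {y \<in> C i. y \<le> x}"
      have "{y \<in> C (Suc i). y \<le> x} = insert (jj (Suc i)) (X - {c})"
        using b False by (auto simp: X_def)
      moreover have "c \<in> X" "finite X" "jj (Suc i) \<notin> X - {c}"
        using b False fin[of i] by (auto simp: X_def)
      ultimately have "card {y \<in> C (Suc i). y \<le> x} = card X" 
        by (metis card_Suc_Diff1 card_insert_disjoint finite_Diff)
      then show ?thesis unfolding rk_def X_def .
    qed
  qed
  have rk_bump: "rk (Suc i) (jj (Suc i)) = rk i c" if "(Suc i, c) \<in> R" for i c
  proof -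
    note b = bump[OF that]
    have 1: "{y \<in> C i. y \<le> c} = insert c {y \<in> C i. y < c}" using b by auto
    have 2: "{y \<in> C (Suc i). y \<le> jj (Suc i)} = insert (jj (Suc i)) {y \<in> C i. y < c}"
      using b by (auto simp: less_imp_le)
    show ?thesis unfolding rk_def 1 2 using fin[of i] b by simp
  qed
  have rk_const: "rk i x = rk i0 x" if "i0 \<le> i" "\<And>k. i0 \<le> k \<Longrightarrow> k \<le> i \<Longrightarrow> x \<in> C k" for i0 i x
    using that
  proof (induction i rule: dec_induct)
    case (step i)
    then show ?case using rk_step[of x i] by simp
  qed simp
  have origin: "\<exists>i0\<in>A. i0 \<le> i \<and> jj i0 = x \<and> (\<forall>k. i0 \<le> k \<longrightarrow> k \<le> i \<longrightarrow> x \<in> C k)"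
    if "x \<in> C i" for i x
    using that
  proof (induction i)
    case 0
    then show ?case using C0 by simp
  next
    case (Suc i)
    show ?case
    proof (cases "x \<in> C i")
      case True
      then obtain i0 where "i0 \<in> A" "i0 \<le> i" "jj i0 = x" "\<forall>k. i0 \<le> k \<longrightarrow> k \<le> i \<longrightarrow> x \<in> C k"
        using Suc by blast
      with Suc.prems show ?thesis by (intro bexI[of _ i0]) (auto simp: le_Suc_eq)
    next
      case False
      then have "Suc i \<in> A \<and> x = jj (Suc i)"
        using row_cases[of i] skip[of i] new[of i] bump[of i] Suc.prems R by auto
      with Suc.prems show ?thesis by (intro bexI[of _ "Suc i"]) (auto simp: le_Suc_eq)
    qed
  qed
  have jj_mem: "jj i \<in> C i" if mem: "i \<in> A" for i
  proof -
    obtain i' where "i = Suc i'" using mem A(2) by (cases i) auto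
    then show ?thesis using row_cases[of i'] new[of i'] bump[of i'] mem by auto
  qed
  have future: "(\<forall>k. i0 \<le> k \<longrightarrow> k \<le> i \<longrightarrow> x \<in> C k) \<or>
      (\<exists>i1. i0 < i1 \<and> i1 \<le> i \<and> (i1, x) \<in> R \<and> (\<forall>k. i0 \<le> k \<longrightarrow> k < i1 \<longrightarrow> x \<in> C k))"
    if "x \<in> C i0" "i0 \<le> i" for i0 i x
    using that(2,1)
  proof (induction i rule: dec_induct)
    case base
    then show ?case by (simp add: le_antisym)
  next
    case (step i)
    from step.IH[OF step.prems] show ?case
    proof (elim disjE)
      assume a: "\<forall>k. i0 \<le> k \<longrightarrow> k \<le> i \<longrightarrow> x \<in> C k"
      show ?thesis
      proof (cases "x \<in> C (Suc i)")
        case True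
        with a show ?thesis by (auto simp: le_Suc_eq)
      next
        case False
        have "x \<in> C i" using a step by simp
        with False have "(Suc i, x) \<in> R"
          using row_cases[of i] skip[of i] new[of i] bump[of i] by auto
        with a step show ?thesis by (intro disjI2 exI[of _ "Suc i"]) (auto simp: less_Suc_eq_le)
      qed
    qed (meson le_SucI)
  qed
  \<comment> \<open>A line keeps its rank and never rises. Hence a later point to the right of an
    earlier one lies strictly above the line of the earlier one, which gives the monotonicity of the
    level.\<close>
  have drop: "\<exists>y\<in>C i. y \<le> x \<and> rk i y = rk i0 x" if "x \<in> C i0" "i0 \<le> i" for i0 i x
    using that(2,1)
  proof (induction i rule: dec_induct)
    case base
    then show ?case by auto
  next
    case (step i)
    then obtain y where y: "y \<in> C i" "y \<le> x" "rk i y = rk i0 x" by blast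
    show ?case
    proof (cases "y \<in> C (Suc i)")
      case True
      then show ?thesis using y rk_step[of y i] by auto
    next
      case False
      then have r: "(Suc i, y) \<in> R"
        using row_cases[of i] skip[of i] new[of i] bump[of i] y by auto
      then show ?thesis using y rk_bump[OF r] bump[OF r] by (intro bexI[of _ "jj (Suc i)"]) auto
    qed
  qed
  define P where "P = (\<lambda>i. (i, jj i)) ` A"
  have P: "(i, j) \<in> P \<longleftrightarrow> i \<in> A \<and> j = jj i" for i j by (auto simp: P_def)
  \<comment> \<open>Each point lies on a line, since \<open>jj i\<close> is a height in
    \<open>C i\<close>; its rank there is taken as its level.\<close>
  define lev where "lev = (\<lambda>(i, x). rk i x)"
  have "shadow_set P = {(i, c) | i c i0 j. (i, j) \<in> P \<and> (i0, c) \<in> P \<and> i0 < i \<and>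
    lev (i0, c) = lev (i, j) \<and>
    (\<forall>i' j'. (i', j') \<in> P \<longrightarrow> lev (i', j') = lev (i, j) \<longrightarrow> \<not> (i0 < i' \<and> i' < i))}"
  proof (rule shadow_set_eq)
    fix i j i' j' assume a: "(i, j) \<in> P" "(i', j') \<in> P" "i < i'" "j < j'"
    then obtain y where "y \<in> C i'" "y \<le> j" "rk i' y = rk i j"
      using drop[of j i i'] jj_mem by (auto simp: P)
    then show "lev (i, j) < lev (i', j')"
      using rk_less[of j' i' y] a jj_mem by (auto simp: P lev_def)
  next
    fix i j assume a: "(i, j) \<in> P" "lev (i, j) > 1"
    then have j: "i \<in> A" "j = jj i" "j \<in> C i" using jj_mem by (auto simp: P)
    have "{y \<in> C i. y \<le> j} = insert j {y \<in> C i. y < j}" using j by auto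
    then have c: "rk i j = Suc (card {y \<in> C i. y < j})" using fin[of i] by (simp add: rk_def)
    have ne: "{y \<in> C i. y < j} \<noteq> {}"
    proof
      assume "{y \<in> C i. y < j} = {}"
      then have "rk i j = 1" using c by (simp only: card.empty One_nat_def)
      then show False using a by (simp add: lev_def)
    qed
    \<comment> \<open>The next lower line at time \<open>i\<close>. The point that put this line at
      height \<open>y\<close> has an earlier row, so it is the predecessor of \<open>(i, j)\<close>
      one level down.\<close>
    define y where "y = Max {y \<in> C i. y < j}"
    have y: "y \<in> C i" "y < j" using Max_in[OF _ ne] fin[of i] by (auto simp: y_def)
    have "{z \<in> C i. z \<le> y} = {y \<in> C i. y < j}"
      using y fin[of i] by (auto simp: y_def)
    then have ry: "rk i y = rk i j - 1" using c by (simp add: rk_def)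
    obtain i0 where i0: "i0 \<in> A" "i0 \<le> i" "jj i0 = y" "\<forall>k. i0 \<le> k \<longrightarrow> k \<le> i \<longrightarrow> y \<in> C k"
      using origin[OF y(1)] by blast
    then have "rk i y = rk i0 y" by (intro rk_const) auto
    moreover have "i0 \<noteq> i" using i0 y j by auto
    ultimately show "\<exists>i' j'. (i', j') \<in> P \<and> i' < i \<and> j' < j \<and> lev (i', j') = lev (i, j) - 1"
      using i0 y ry by (intro exI[of _ i0] exI[of _ y]) (auto simp: P lev_def)
  next
    fix p assume "p \<in> P" then show "lev p > 0" using jj_mem rk_pos by (auto simp: P_def lev_def)
  qed (auto simp: P_def A inj_on_def)
  also have "\<dots> = R"
  proof (intro equalityI subsetI)
    fix p assume "p \<in> {(i, c) | i c i0 j. (i, j) \<in> P \<and> (i0, c) \<in> P \<and> i0 < i \<and>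
      lev (i0, c) = lev (i, j) \<and>
      (\<forall>i' j'. (i', j') \<in> P \<longrightarrow> lev (i', j') = lev (i, j) \<longrightarrow> \<not> (i0 < i' \<and> i' < i))}"
    then obtain i c i0 j where p: "p = (i, c)" and ij: "(i, j) \<in> P" and ic: "(i0, c) \<in> P"
      and less: "i0 < i" and l: "lev (i0, c) = lev (i, j)"
      and no: "\<And>i' j'. (i', j') \<in> P \<Longrightarrow> lev (i', j') = lev (i, j) \<Longrightarrow> \<not> (i0 < i' \<and> i' < i)" by blast
    have "c \<in> C i0" "i0 \<in> A" "c = jj i0" "i \<in> A" "j = jj i" "j \<in> C i"
      using ic ij jj_mem by (auto simp: P)
    \<comment> \<open>If height \<open>c\<close> survived through row \<open>i\<close>, it would
      have the same rank there as \<open>j\<close>, so the two points would coincide. Hence the line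
      leaves \<open>c\<close> at some row \<open>i1\<close>, where it passes to a point of the same
      level; adjacency of the rows \<open>i0\<close> and \<open>i\<close> forces
      \<open>i1 = i\<close>.\<close>
    from future[OF \<open>c \<in> C i0\<close> less_imp_le[OF less]] have "(i, c) \<in> R"
    proof (elim disjE exE conjE)
      assume a: "\<forall>k. i0 \<le> k \<longrightarrow> k \<le> i \<longrightarrow> c \<in> C k"
      then have "rk i c = rk i0 c" using less by (intro rk_const) auto
      then have "rk i c = rk i j" using l by (simp add: lev_def)
      then have "c = j" using rk_inj[of c i j] a less \<open>j \<in> C i\<close> by simp
      then have "i = i0" using A(3) \<open>c = jj i0\<close> \<open>j = jj i\<close> \<open>i0 \<in> A\<close> \<open>i \<in> A\<close> by (auto dest: inj_onD)
      with less show ?thesis by simp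
    next
      fix i1 assume a: "i0 < i1" "i1 \<le> i" "(i1, c) \<in> R" "\<forall>k. i0 \<le> k \<longrightarrow> k < i1 \<longrightarrow> c \<in> C k"
      then obtain i' where i1: "i1 = Suc i'" by (cases i1) auto
      have "rk i1 (jj i1) = rk i' c" using rk_bump a i1 by simp
      also have "\<dots> = rk i0 c" using a i1 by (intro rk_const) auto
      finally have "lev (i1, jj i1) = lev (i, j)" using l by (simp add: lev_def)
      moreover have "i1 \<in> A" using a R by force
      ultimately have "\<not> i1 < i" using no[of i1 "jj i1"] a by (simp add: P)
      with a show ?thesis by simp
    qed
    then show "p \<in> R" by (simp add: p)
  next
    fix p assume p: "p \<in> R"
    moreover obtain i c where ic: "p = (i, c)" by (cases p)
    ultimately have "i \<in> A" using R by force
    then obtain i' where i': "i = Suc i'" using A(2) by (cases i) auto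
    have r: "(Suc i', c) \<in> R" using p ic i' by simp
    note b = bump[OF r]
    obtain i0 where i0: "i0 \<in> A" "i0 \<le> i'" "jj i0 = c" "\<forall>k. i0 \<le> k \<longrightarrow> k \<le> i' \<longrightarrow> c \<in> C k"
      using origin[of c i'] b by blast
    have rk0: "rk k c = rk i0 c" if "i0 \<le> k" "k \<le> i'" for k
      by (rule rk_const) (use that i0 in auto)
    have l: "lev (i, jj i) = rk i0 c" using rk_bump[OF r] rk0[of i'] i0 i' by (simp add: lev_def)
    \<comment> \<open>While \<open>c\<close> is still a height, it is the only one of its rank, so
      no point of the same level can occur between the arrival of the line at \<open>c\<close> and
      its drop in row \<open>i\<close>.\<close>
    have no: "\<not> (i0 < k \<and> k < i)" if k: "(k, j') \<in> P" "lev (k, j') = lev (i, jj i)" for k j'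
    proof
      assume "i0 < k \<and> k < i"
      then have "i0 < k" "k \<le> i'" by (auto simp: i')
      then have "c \<in> C k" "rk k c = rk i0 c" using i0 rk0[of k] by auto
      moreover have "rk k j' = rk i0 c" "j' \<in> C k" using k l jj_mem by (auto simp: lev_def P)
      ultimately have "c = j'" by (intro rk_inj[of c k j']) auto
      then have "jj k = jj i0" "k \<in> A" using k i0 by (auto simp: P)
      then have "k = i0" using A(3) i0 by (auto dest: inj_onD)
      with \<open>i0 < k\<close> show False by simp
    qed
    have "(i, jj i) \<in> P" "(i0, c) \<in> P" "i0 < i" "lev (i0, c) = lev (i, jj i)"
      using \<open>i \<in> A\<close> i0 i' l by (auto simp: P lev_def)
    then show "p \<in> {(i, c) | i c i0 j. (i, j) \<in> P \<and> (i0, c) \<in> P \<and> i0 < i \<and>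
      lev (i0, c) = lev (i, j) \<and>
      (\<forall>i' j'. (i', j') \<in> P \<longrightarrow> lev (i', j') = lev (i, j) \<longrightarrow> \<not> (i0 < i' \<and> i' < i))}"
      unfolding ic using no by blast
  qed
  finally show ?thesis by (simp add: P_def)
qed

text \<open>The equivalence is symmetric in the two coordinates, so one notion serves rows and
  columns alike. It also forces points that agree in one coordinate to be equal.\<close>

definition increasing :: "cell set \<Rightarrow> bool" where
  "increasing Q \<longleftrightarrow> (\<forall>p\<in>Q. \<forall>q\<in>Q. fst p < fst q \<longleftrightarrow> snd p < snd q)"

text \<open>After the last row of a forward insertion, the surviving heights are the columns without
  a corner, because a line leaves a column exactly through the corner in it. The process is
  therefore run backwards from the free columns. It can fail only in a row with a corner
  \<open>(i, c)\<close> when every current line lies above \<open>c\<close>; following the lines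
  above \<open>c\<close> to their later corners then produces an increasing chain that
  \<open>rows\<close> or \<open>cols\<close> forbids.\<close>

lemma viennot_inversion:
  assumes fin: "finite A" "finite B" and A0: "0 \<notin> A" and card: "card A = card B"
    and R: "R \<subseteq> A \<times> B" "inj_on fst R" "inj_on snd R"
    and rows: "\<And>Q e. Q \<subseteq> R \<Longrightarrow> increasing Q \<Longrightarrow> e \<in> Q \<Longrightarrow> (\<And>q. q \<in> Q \<Longrightarrow> fst q \<le> fst e) \<Longrightarrow>
      card Q + card {i \<in> A - fst ` R. fst e < i} \<le> card (A - fst ` R)"
    and cols: "\<And>Q e. Q \<subseteq> R \<Longrightarrow> increasing Q \<Longrightarrow> e \<in> Q \<Longrightarrow> (\<And>q. q \<in> Q \<Longrightarrow> snd q \<le> snd e) \<Longrightarrow>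
      card Q + card {j \<in> B - snd ` R. snd e < j} \<le> card (B - snd ` R)"
  shows "\<exists>jj. bij_betw jj A B \<and> shadow_set ((\<lambda>i. (i, jj i)) ` A) = R"
proof -
  have finR: "finite R" using R(1) fin by (meson finite_SigmaI finite_subset)
  have R_row: "c = c'" if "(i, c) \<in> R" "(i, c') \<in> R" for i c c'
    using inj_onD[OF R(2) _ that] by simp
  have R_col: "i = i'" if "(i, c) \<in> R" "(i', c) \<in> R" for i i' c
    using inj_onD[OF R(3) _ that] by simp
  define NR where "NR = A - fst ` R"
  define NC where "NC = B - snd ` R"
  have finN: "finite NR" "finite NC" using fin by (auto simp: NR_def NC_def)
  have "card (fst ` R) = card (snd ` R)" using R by (simp add: card_image)
  then have cardN: "card NR = card NC"
    unfolding NR_def NC_def using R(1) fin finR card by (subst (1 2) card_Diff_subset) auto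

  \<comment> \<open>The hypotheses exclude \<open>climb N p\<close> for \<open>N\<close> above the number of free rows. The invariant \<open>good\<close>
    below says that a line with \<open>d\<close> lines above it, now or at a later start, has its next corner at a
    point with \<open>climb (d + 1)\<close>. So reverse insertion never meets a corner below all lines.\<close>
  define climb where "climb N p \<longleftrightarrow> (\<exists>Q e. Q \<subseteq> R \<and> p \<in> Q \<and> e \<in> Q \<and> increasing Q \<and>
      (\<forall>q\<in>Q. fst p \<le> fst q \<and> fst q \<le> fst e) \<and>
      (N \<le> card Q + card {i \<in> NR. fst e < i} \<or> N \<le> card Q + card {j \<in> NC. snd e < j}))" for N p
  have climb_single: "climb N p" if "p \<in> R"
    "N \<le> 1 + card {i \<in> NR. fst p < i} \<or> N \<le> 1 + card {j \<in> NC. snd p < j}" for N p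
    unfolding climb_def using that by (intro exI[of _ "{p}"] exI[of _ p]) (auto simp: increasing_def)
  have climb_step: "climb (Suc N) p" if p: "p \<in> R" "fst p < fst q" "snd p < snd q" and "climb N q" for N p q
  proof -
    obtain Q e where Q: "Q \<subseteq> R" "q \<in> Q" "e \<in> Q" "increasing Q"
      "\<forall>x\<in>Q. fst q \<le> fst x \<and> fst x \<le> fst e"
      "N \<le> card Q + card {i \<in> NR. fst e < i} \<or> N \<le> card Q + card {j \<in> NC. snd e < j}"
      using \<open>climb N q\<close> unfolding climb_def by blast
    have above: "fst p < fst x" "snd p < snd x" if "x \<in> Q" for x
    proof -
      have "\<not> snd x < snd q" using Q(2,4,5) that unfolding increasing_def by (metis linorder_not_less)
      then show "fst p < fst x" "snd p < snd x" using p Q(5) that by auto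
    qed
    have "p \<notin> Q" using above by blast
    moreover have "finite Q" using Q(1) finR finite_subset by blast
    ultimately have "card (insert p Q) = Suc (card Q)" by simp
    moreover have "increasing (insert p Q)"
      using Q(4) above unfolding increasing_def by (auto dest: less_asym')
    moreover have "fst p \<le> fst x \<and> fst x \<le> fst e" if "x \<in> insert p Q" for x
      using that above(1)[OF Q(3)] above(1)[of x] Q(5) by (metis insertE less_imp_le order_refl)
    ultimately show ?thesis
      unfolding climb_def using Q(1,3,6) p(1)
      by (intro exI[of _ "insert p Q"] exI[of _ e]) simp
  qed
  have no_climb: "\<not> climb (Suc (card NR)) p" for p
  proof
    assume "climb (Suc (card NR)) p"
    then obtain Q e where Q: "Q \<subseteq> R" "e \<in> Q" "increasing Q" "\<forall>q\<in>Q. fst q \<le> fst e"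
      "card NR < card Q + card {i \<in> NR. fst e < i} \<or> card NR < card Q + card {j \<in> NC. snd e < j}"
      unfolding climb_def Suc_le_eq by blast
    have "\<forall>q\<in>Q. snd q \<le> snd e"
      using Q(2-4) unfolding increasing_def by (meson linorder_not_less)
    then show False
      using rows[of Q e] cols[of Q e] Q cardN by (auto simp: NR_def[symmetric] NC_def[symmetric])
  qed

  obtain n where n: "A \<subseteq> {..n}" using fin finite_nat_iff_bounded_le by blast
  define col where "col i = (THE c. (i, c) \<in> R)" for i
  have col: "col i = c" if "(i, c) \<in> R" for i c
    unfolding col_def using that R_row by blast
  \<comment> \<open>The height that row \<open>i\<close> inserted: in a row with a corner, the line
    that now lies highest below the corner's column is the one that dropped from it; in a free row
    the inserted line is the top one.\<close>
  define rem where "rem i X = (if i \<in> fst ` R then Max {y \<in> X. y < col i} else Max X)" for i X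
  define step where "step i X = (if i \<in> fst ` R then insert (col i) (X - {rem i X})
    else if i \<in> A then X - {rem i X} else X)" for i and X :: "nat set"
  \<comment> \<open>A recursion on \<open>n - i\<close>, downwards in \<open>i\<close>: step number
    \<open>s\<close> undoes row \<open>n - s\<close>, and no step is taken for
    \<open>i \<ge> n\<close>.\<close>
  define C where "C i = rec_nat NC (\<lambda>s. step (n - s)) (n - i)" for i
  have C_top: "C i = NC" if "i \<ge> n" for i using that by (simp add: C_def)
  have C_rec: "C i = step (Suc i) (C (Suc i))" if "i < n" for i
  proof -
    have "n - i = Suc (n - Suc i)" "n - (n - Suc i) = Suc i" using that by auto
    then show ?thesis unfolding C_def by simp
  qed
  define jj where "jj i = rem i (C i)" for i

  define good where "good i \<longleftrightarrow> C i \<subseteq> B \<and> card (C i) = card {k \<in> NR. k \<le> i} \<and>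
      (\<forall>x\<in>C i. x \<in> snd ` R \<longrightarrow> (\<exists>k>i. (k, x) \<in> R)) \<and>
      (\<forall>x\<in>C i. x \<in> NC \<and> card {y \<in> C i. x < y} + card {k \<in> NR. i < k} \<le> card {y \<in> NC. x < y} \<or>
        (\<exists>k>i. (k, x) \<in> R \<and> climb (Suc (card {y \<in> C i. x < y} + card {k \<in> NR. i < k})) (k, x)))" for i
  have split_NR: "card {k \<in> NR. k \<le> i} + card {k \<in> NR. i < k} = card NR" for i
  proof -
    have "NR = {k \<in> NR. k \<le> i} \<union> {k \<in> NR. i < k}" by auto
    then show ?thesis using finN card_Un_disjoint[of "{k \<in> NR. k \<le> i}" "{k \<in> NR. i < k}"] by fastforce
  qed

  have good_top: "good n"
  proof -
    have "{k \<in> NR. k \<le> n} = NR" "{k \<in> NR. n < k} = {}" using n by (auto simp: NR_def)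
    moreover have "NC \<subseteq> B" "NC \<inter> snd ` R = {}" by (auto simp: NC_def)
    ultimately show ?thesis
      unfolding good_def C_top[OF order_refl] using cardN by (simp only: card.empty) auto
  qed
  have skip: "C i = C (Suc i) \<and> good i" if "good (Suc i)" "i < n" "Suc i \<notin> A" for i
  proof -
    have "Suc i \<notin> fst ` R" using that R(1) by auto
    then have C: "C i = C (Suc i)" using C_rec[OF \<open>i < n\<close>] that by (simp add: step_def)
    have "Suc i \<notin> NR" using that by (simp add: NR_def)
    then have same: "{k \<in> NR. k \<le> Suc i} = {k \<in> NR. k \<le> i}" "{k \<in> NR. Suc i < k} = {k \<in> NR. i < k}"
      by (auto simp: le_Suc_eq) (metis Suc_lessI)
    have "good i" using that(1) unfolding good_def C same by (meson Suc_lessD)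
    with C show ?thesis by simp
  qed
  have new: "C (Suc i) = insert (jj (Suc i)) (C i) \<and> (\<forall>y\<in>C i. y < jj (Suc i)) \<and> good i"
    if i: "good (Suc i)" "i < n" "Suc i \<in> A" "Suc i \<notin> fst ` R" for i
  proof -
    define D where "D = C (Suc i)"
    have iN: "Suc i \<in> NR" using i by (simp add: NR_def)
    have less: "{k \<in> NR. k \<le> Suc i} = insert (Suc i) {k \<in> NR. k \<le> i}"
      "{k \<in> NR. i < k} = insert (Suc i) {k \<in> NR. Suc i < k}" using iN by auto
    have D: "D \<subseteq> B" "card D = Suc (card {k \<in> NR. k \<le> i})"
      using i(1) finN unfolding good_def D_def less by auto
    have finD: "finite D" using D(1) fin finite_subset by blast
    have "D \<noteq> {}" using D(2) by auto
    have j: "jj (Suc i) = Max D" using i by (simp add: jj_def rem_def D_def)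
    have jD: "Max D \<in> D" using finD \<open>D \<noteq> {}\<close> by (rule Max_in)
    have C: "C i = D - {Max D}" using C_rec[OF i(2)] i by (simp add: step_def D_def rem_def)
    have lt: "y < Max D" if "y \<in> C i" for y
      using that finD unfolding C by (simp add: le_neq_implies_less)
    \<comment> \<open>The removed top line turns from a line above \<open>x\<close> into a later
      start, so the count in the invariant stays the same.\<close>
    have m: "card {y \<in> D. x < y} + card {k \<in> NR. Suc i < k} = card {y \<in> C i. x < y} + card {k \<in> NR. i < k}"
      if "x \<in> C i" for x
    proof -
      have "{y \<in> D. x < y} = insert (Max D) {y \<in> C i. x < y}" using lt[OF that] jD unfolding C by auto
      moreover have "Max D \<notin> {y \<in> C i. x < y}" "finite {y \<in> C i. x < y}" using finD unfolding C by auto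
      ultimately show ?thesis unfolding less using finN by simp
    qed
    have good: "good i"
      unfolding good_def
    proof (intro conjI ballI impI)
      show "C i \<subseteq> B" using D C by blast
      show "card (C i) = card {k \<in> NR. k \<le> i}" using C D jD finD by simp
    next
      fix x assume "x \<in> C i" "x \<in> snd ` R"
      then obtain k where "k > Suc i" "(k, x) \<in> R" using i(1) C unfolding good_def D_def by blast
      then show "\<exists>k>i. (k, x) \<in> R" using Suc_lessD by blast
    next
      fix x assume x: "x \<in> C i"
      then have "x \<in> D" using C by blast
      then have "x \<in> NC \<and> card {y \<in> D. x < y} + card {k \<in> NR. Suc i < k} \<le> card {y \<in> NC. x < y} \<or>
        (\<exists>k>Suc i. (k, x) \<in> R \<and> climb (Suc (card {y \<in> D. x < y} + card {k \<in> NR. Suc i < k})) (k, x))"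
        using i(1) unfolding good_def D_def by blast
      then show "x \<in> NC \<and> card {y \<in> C i. x < y} + card {k \<in> NR. i < k} \<le> card {y \<in> NC. x < y} \<or>
        (\<exists>k>i. (k, x) \<in> R \<and> climb (Suc (card {y \<in> C i. x < y} + card {k \<in> NR. i < k})) (k, x))"
        unfolding m[OF x] by (meson Suc_lessD)
    qed
    then show ?thesis unfolding j using C jD lt D_def by auto
  qed
  have bump: "c \<in> C i \<and> jj (Suc i) \<notin> C i \<and> jj (Suc i) < c \<and> (\<forall>y\<in>C i. y < c \<longrightarrow> y < jj (Suc i)) \<and>
      C (Suc i) = insert (jj (Suc i)) (C i - {c}) \<and> jj (Suc i) \<in> C (Suc i) \<and> good i"
    if i: "good (Suc i)" "i < n" "(Suc i, c) \<in> R" for i c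
  proof -
    define D where "D = C (Suc i)"
    have iR: "Suc i \<in> fst ` R" "col (Suc i) = c" using i(3) col by force+
    then have iN: "Suc i \<notin> NR" by (simp add: NR_def)
    have same: "{k \<in> NR. k \<le> Suc i} = {k \<in> NR. k \<le> i}" "{k \<in> NR. Suc i < k} = {k \<in> NR. i < k}"
      using iN by (auto simp: le_Suc_eq) (metis Suc_lessI)
    have D: "D \<subseteq> B" "card D = card {k \<in> NR. k \<le> i}"
      using i(1) unfolding good_def D_def same by auto
    have later: "\<exists>k>Suc i. (k, x) \<in> R" if "x \<in> D" "x \<in> snd ` R" for x
      using i(1) that unfolding good_def D_def by blast
    have dom: "x \<in> NC \<and> card {y \<in> D. x < y} + card {k \<in> NR. i < k} \<le> card {y \<in> NC. x < y} \<or>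
        (\<exists>k>Suc i. (k, x) \<in> R \<and> climb (Suc (card {y \<in> D. x < y} + card {k \<in> NR. i < k})) (k, x))"
      if "x \<in> D" for x
      using i(1) that unfolding good_def D_def same by blast
    have finD: "finite D" using D(1) fin finite_subset by blast
    have cD: "c \<notin> D"
    proof
      assume "c \<in> D"
      with later[of c] i(3) obtain k where "k > Suc i" "(k, c) \<in> R" by force
      with R_col[OF i(3)] show False by auto
    qed
    \<comment> \<open>The nearest line \<open>x\<close> above \<open>c\<close> decides. If there is
      none, the single point is a chain whose count comes from the later free rows. If
      \<open>x\<close> satisfies the first alternative of \<open>dom\<close>, the count comes from
      the free columns to the right of \<open>c\<close>. Otherwise the next corner of that line lies
      in a later row and to the right of \<open>c\<close>, and its chain is extended by
      \<open>(Suc i, c)\<close>.\<close>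
    have climb: "climb (Suc (card {y \<in> D. c < y} + card {k \<in> NR. i < k})) (Suc i, c)"
    proof (cases "{y \<in> D. c < y} = {}")
      case True
      show ?thesis unfolding True using i(3) same by (intro climb_single) simp_all
    next
      case False
      define x where "x = Min {y \<in> D. c < y}"
      have "x \<in> {y \<in> D. c < y}" unfolding x_def using False finD by (intro Min_in) auto
      then have x: "x \<in> D" "c < x" by auto
      have "x \<le> y" if "y \<in> D" "c < y" for y
        unfolding x_def by (rule Min_le) (use that finD in auto)
      then have "{y \<in> D. c < y} = insert x {y \<in> D. x < y}"
        using x by (force simp: le_less)
      then have m: "card {y \<in> D. c < y} = Suc (card {y \<in> D. x < y})" using finD by simp
      from dom[OF x(1)] show ?thesis
      proof (elim disjE exE conjE)
        assume a: "x \<in> NC" "card {y \<in> D. x < y} + card {k \<in> NR. i < k} \<le> card {y \<in> NC. x < y}"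
        have "card (insert x {y \<in> NC. x < y}) \<le> card {y \<in> NC. c < y}"
          using a x finN by (intro card_mono) auto
        then show ?thesis unfolding m using a(2) i(3) finN by (intro climb_single) auto
      next
        fix k assume "k > Suc i" "(k, x) \<in> R"
          "climb (Suc (card {y \<in> D. x < y} + card {k \<in> NR. i < k})) (k, x)"
        then show ?thesis unfolding m using x i(3) by (intro climb_step[of _ "(k, x)"]) auto
      qed
    qed
    \<comment> \<open>With all lines above \<open>c\<close>, the count would be
      \<open>card D\<close> plus the later free rows, which is \<open>card NR\<close>, one step
      beyond what \<open>no_climb\<close> permits.\<close>
    have ne: "{y \<in> D. y < c} \<noteq> {}"
    proof
      assume "{y \<in> D. y < c} = {}"
      then have "y > c" if "y \<in> D" for y using cD that by (metis (mono_tags) empty_Collect_eq linorder_neqE_nat)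
      then have "{y \<in> D. c < y} = D" by auto
      then show False using climb no_climb split_NR[of i] D(2) by simp
    qed
    define j where "j = Max {y \<in> D. y < c}"
    have "j \<in> {y \<in> D. y < c}" unfolding j_def using ne finD by (intro Max_in) auto
    then have jD: "j \<in> D" "j < c" by auto
    have jmax: "y < j" if "y \<in> D" "y < c" "y \<noteq> j" for y
    proof -
      have "y \<le> j" unfolding j_def by (rule Max_ge) (use that finD in auto)
      then show ?thesis using that by simp
    qed
    have j: "jj (Suc i) = j" using iR by (simp add: jj_def rem_def D_def j_def)
    have C: "C i = insert c (D - {j})"
      using C_rec[OF i(2)] iR by (simp add: step_def D_def rem_def j_def)
    \<comment> \<open>No current height separates \<open>j\<close> from \<open>c\<close>, so trading
      one for the other does not change the number of heights above a height of
      \<open>C i\<close>.\<close>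
    have m: "card {y \<in> C i. x < y} = card {y \<in> D. x < y}" if x: "x \<in> C i" for x
    proof (cases "x < c")
      case True
      then have "x < j" using x jmax[of x] C by auto
      then have "{y \<in> C i. x < y} = insert c ({y \<in> D. x < y} - {j})" using C True by auto
      moreover have "j \<in> {y \<in> D. x < y}" "finite {y \<in> D. x < y}" "c \<notin> {y \<in> D. x < y} - {j}"
        using jD \<open>x < j\<close> finD cD by auto
      ultimately show ?thesis using card_Suc_Diff1[of "{y \<in> D. x < y}" j] by simp
    next
      case False
      then have "{y \<in> C i. x < y} = {y \<in> D. x < y}" unfolding C using jD by auto
      then show ?thesis by (rule arg_cong)
    qed
    have "good i"
      unfolding good_def
    proof (intro conjI ballI impI)
      show "C i \<subseteq> B" using D C i(3) R(1) by auto
      have "card (C i) = card D"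
        using C cD jD finD by (metis Diff_iff card_Suc_Diff1 card_insert_disjoint finite_Diff)
      then show "card (C i) = card {k \<in> NR. k \<le> i}" using D by simp
    next
      fix x assume x: "x \<in> C i" "x \<in> snd ` R"
      show "\<exists>k>i. (k, x) \<in> R"
      proof (cases "x = c")
        case True
        then show ?thesis using i(3) by blast
      next
        case False
        then have "x \<in> D" using x C by simp
        then show ?thesis using later[of x] x Suc_lessD by blast
      qed
    next
      fix x assume x: "x \<in> C i"
      show "x \<in> NC \<and> card {y \<in> C i. x < y} + card {k \<in> NR. i < k} \<le> card {y \<in> NC. x < y} \<or>
        (\<exists>k>i. (k, x) \<in> R \<and> climb (Suc (card {y \<in> C i. x < y} + card {k \<in> NR. i < k})) (k, x))"
      proof (cases "x = c")
        case True
        then show ?thesis unfolding m[OF x] using climb i(3) by blast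
      next
        case False
        then have "x \<in> D" using x C by simp
        then show ?thesis unfolding m[OF x] using dom[of x] by (meson Suc_lessD)
      qed
    qed
    moreover have "insert j (insert c (D - {j}) - {c}) = D" using jD cD by auto
    moreover have "\<forall>y\<in>C i. y < c \<longrightarrow> y < j" unfolding C using jmax by auto
    ultimately show ?thesis unfolding j using jD D_def by (simp add: C)
  qed
  have row_cases: "i \<notin> A \<or> (i \<in> A \<and> i \<notin> fst ` R) \<or> (\<exists>c. (i, c) \<in> R)" for i
    by force
  have good: "good i" if "i \<le> n" for i
    using that
  proof (induction i rule: inc_induct)
    case base
    then show ?case by (rule good_top)
  next
    case (step i)
    then show ?case using row_cases[of "Suc i"] skip[of i] new[of i] bump[of i] by blast
  qed
  have bounded: "i < n" if "Suc i \<in> A" for i using that n by auto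
  have C_sub: "C i \<subseteq> B" for i
    using good[of i] C_top[of i] by (cases "i \<le> n") (auto simp: good_def NC_def)
  have jj_mem: "jj i \<in> C i \<and> (i > 0 \<longrightarrow> jj i \<notin> C (i - 1))" if mem: "i \<in> A" for i
  proof -
    obtain i' where "i = Suc i'" using mem A0 by (cases i) auto
    then show ?thesis
      using row_cases[of i] new[of i'] bump[of i'] good[of i] bounded[of i'] mem by auto
  qed
  \<comment> \<open>A height removed at row \<open>i\<close> could only come back through a corner
    in its column; but a height of \<open>C i\<close> that lies in a corner's column has that corner
    in a later row, and no column contains two corners.\<close>
  have gone: "jj i \<notin> C k" if mem: "i \<in> A" and "k < i" for i k
  proof -
    have "k \<le> i - 1" using \<open>k < i\<close> by simp
    then show ?thesis
    proof (induction k rule: inc_induct)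
      case base
      then show ?case using jj_mem[OF mem] \<open>k < i\<close> by auto
    next
      case (step k)
      have kn: "Suc k \<le> i" "i \<le> n" using step n mem by auto
      show ?case
      proof
        assume "jj i \<in> C k"
        then have r: "(Suc k, jj i) \<in> R"
          using step.IH row_cases[of "Suc k"] skip[of k] new[of k] bump[of k] good[of "Suc k"] kn
          by auto
        then have "jj i \<in> snd ` R" by force
        then obtain k' where "k' > i" "(k', jj i) \<in> R"
          using good[OF kn(2)] jj_mem[OF mem] unfolding good_def by blast
        with R_col[OF r] kn show False by auto
      qed
    qed
  qed
  have inj: "inj_on jj A"
  proof (rule inj_onI)
    fix i i' assume "i \<in> A" "i' \<in> A" "jj i = jj i'"
    then show "i = i'"
      using gone[of i i'] gone[of i' i] jj_mem by (metis linorder_neqE_nat)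
  qed
  moreover have "jj ` A = B"
    using jj_mem C_sub inj card fin by (intro card_subset_eq) (auto simp: card_image)
  moreover have "shadow_set ((\<lambda>i. (i, jj i)) ` A) = R"
  proof (rule shadow_set_growth[of C])
    show "finite (C i)" for i using C_sub fin finite_subset by blast
    have "card (C 0) = card {k \<in> NR. k \<le> 0}" using good[of 0] by (simp add: good_def)
    also have "{k \<in> NR. k \<le> 0} = {}" using A0 by (auto simp: NR_def)
    finally show "C 0 = {}" using finite_subset[OF C_sub fin(2), of 0] by simp
    show "C (Suc i) = C i" if "Suc i \<notin> A" for i
      using that skip[of i] good[of "Suc i"] C_top[of i] C_top[of "Suc i"] by (cases "i < n") auto
    show "C (Suc i) = insert (jj (Suc i)) (C i) \<and> (\<forall>y\<in>C i. y < jj (Suc i))"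
      if "Suc i \<in> A" "Suc i \<notin> fst ` R" for i
      using that new[of i] good[of "Suc i"] bounded[of i] by auto
    show "c \<in> C i \<and> jj (Suc i) \<notin> C i \<and> jj (Suc i) < c \<and> (\<forall>y\<in>C i. y < c \<longrightarrow> y < jj (Suc i)) \<and>
      C (Suc i) = insert (jj (Suc i)) (C i - {c})" if r: "(Suc i, c) \<in> R" for i c
    proof -
      have "Suc i \<in> A" using r R(1) by auto
      then show ?thesis using r bump[of i c] good[of "Suc i"] bounded[of i] by auto
    qed
  qed (use fin A0 inj R(1) in auto)
  ultimately show ?thesis by (auto simp: bij_betw_def)
qed

section \<open>Polynomials, ideals and degrees\<close>

lemma keys_uminus_cpoly [simp]: "Poly_Mapping.keys (- f) = Poly_Mapping.keys (f :: cpoly)"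
  by (auto simp: in_keys_iff)

lemma keys_diff_cpoly: "Poly_Mapping.keys (f - g) \<subseteq> Poly_Mapping.keys f \<union> Poly_Mapping.keys (g :: cpoly)"
  by (auto simp: in_keys_iff lookup_minus)

lemma mem_poly_ring_iff: "f \<in> carrier (poly_ring n) \<longleftrightarrow> (\<forall>m\<in>Poly_Mapping.keys f. Poly_Mapping.keys m \<subseteq> grid n)"
  by (simp add: poly_ring_def)

lemma keys_plus_mon: "Poly_Mapping.keys (a + b) = Poly_Mapping.keys a \<union> Poly_Mapping.keys (b :: mon)"
  by (auto simp: in_keys_iff lookup_add)

lemma pconst_mult_pmono: "pconst c * pmono m = Poly_Mapping.single m c"
  by (simp add: pconst_def pmono_def mult_single)

lemma pmono_mult: "pmono a * pmono b = pmono (a + b)"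
  by (simp add: pmono_def mult_single)

lemma pmono_zero: "pmono 0 = 1"
  by (simp add: pmono_def)

lemma pmono_prod: "(\<Prod>x\<in>X. pmono (f x)) = pmono (\<Sum>x\<in>X. f x)"
  by (induction X rule: infinite_finite_induct) (simp_all add: pmono_zero pmono_mult)

lemma cpoly_expand:
  assumes "finite X" "Poly_Mapping.keys f \<subseteq> X"
  shows "f = (\<Sum>m\<in>X. pconst (Poly_Mapping.lookup f m) * pmono m)"
proof (rule poly_mapping_eqI)
  fix k
  have "Poly_Mapping.lookup (\<Sum>m\<in>X. pconst (Poly_Mapping.lookup f m) * pmono m) k = (\<Sum>m\<in>X. if m = k then Poly_Mapping.lookup f m else 0)"
    by (simp add: pconst_mult_pmono lookup_sum lookup_single when_def)
  also have "\<dots> = Poly_Mapping.lookup f k" using assms by (auto simp: in_keys_iff)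
  finally show "Poly_Mapping.lookup f k = Poly_Mapping.lookup (\<Sum>m\<in>X. pconst (Poly_Mapping.lookup f m) * pmono m) k" by simp
qed

lemma lookup_pconst_mult [simp]: "Poly_Mapping.lookup (pconst c * f) m = c * Poly_Mapping.lookup f m"
proof -
  have "pconst c * f = (\<Sum>k\<in>Poly_Mapping.keys f. Poly_Mapping.single k (c * Poly_Mapping.lookup f k))"
    by (subst cpoly_expand[of "Poly_Mapping.keys f" f])
      (simp_all add: sum_distrib_left pconst_def pmono_def mult_single)
  then have "Poly_Mapping.lookup (pconst c * f) m = (\<Sum>k\<in>Poly_Mapping.keys f. if k = m then c * Poly_Mapping.lookup f k else 0)"
    by (simp add: lookup_sum lookup_single when_def)
  also have "\<dots> = c * Poly_Mapping.lookup f m" by (auto simp: in_keys_iff)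
  finally show ?thesis .
qed

lemma pconst_simps [simp]: "pconst 0 = 0" "pconst 1 = 1" "pconst (a + b) = pconst a + pconst b"
  "pconst (- a) = - pconst a" "pconst (a - b) = pconst a - pconst b"
  by (simp_all add: pconst_def single_add single_uminus single_diff)

lemma pconst_mult: "pconst a * pconst b = pconst (a * b)"
  by (simp add: pconst_def mult_single)

lemma keys_pmono [simp]: "Poly_Mapping.keys (pmono m) = {m}"
  by (simp add: pmono_def)

lemma lookup_pmono: "Poly_Mapping.lookup (pmono m) m' = (1 when m = m')"
  by (simp add: pmono_def lookup_single)

lemma inj_pmono: "pmono a = pmono b \<longleftrightarrow> a = b"
  by (metis keys_pmono singleton_inject)

lemma keys_pconst_mult: "Poly_Mapping.keys (pconst c * f) \<subseteq> Poly_Mapping.keys f"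
  by (auto simp: in_keys_iff)

lemma pmono_mult_monom: "pmono a * (pconst c * pmono m) = pconst c * pmono (a + m)"
  by (metis mult.left_commute pmono_mult)

lemma lookup_pmono_mult:
  "Poly_Mapping.lookup (pmono a * f) k = (\<Sum>m\<in>Poly_Mapping.keys f. Poly_Mapping.lookup f m when a + m = k)"
proof -
  have "pmono a * f = (\<Sum>m\<in>Poly_Mapping.keys f. pconst (Poly_Mapping.lookup f m) * pmono (a + m))"
    by (subst cpoly_expand[of "Poly_Mapping.keys f" f]) (simp_all add: sum_distrib_left pmono_mult_monom)
  then show ?thesis by (simp add: lookup_sum lookup_pmono when_def if_distrib cong: if_cong)
qed

lemma lookup_pmono_mult_plus [simp]: "Poly_Mapping.lookup (pmono a * f) (a + m) = Poly_Mapping.lookup f m"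
  by (auto simp: lookup_pmono_mult when_def in_keys_iff)

lemma keys_pmono_mult: "Poly_Mapping.keys (pmono a * f) = (+) a ` Poly_Mapping.keys f"
proof (intro equalityI subsetI)
  fix k assume "k \<in> Poly_Mapping.keys (pmono a * f)"
  then show "k \<in> (+) a ` Poly_Mapping.keys f"
    using keys_mult[of "pmono a" f] by auto
qed (auto simp: in_keys_iff)

lemma pmono_in_poly_ring [simp]: "pmono m \<in> carrier (poly_ring n) \<longleftrightarrow> Poly_Mapping.keys m \<subseteq> grid n"
  by (simp add: mem_poly_ring_iff)

lemma pconst_in_poly_ring [simp]: "pconst c \<in> carrier (poly_ring n)"
  by (auto simp: mem_poly_ring_iff pconst_def)

lemma zero_one_in_poly_ring [simp]: "0 \<in> carrier (poly_ring n)" "1 \<in> carrier (poly_ring n)"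
  by (auto simp: mem_poly_ring_iff)

lemma poly_ring_minus_closed: "f \<in> carrier (poly_ring n) \<Longrightarrow> - f \<in> carrier (poly_ring n)"
  "f \<in> carrier (poly_ring n) \<Longrightarrow> g \<in> carrier (poly_ring n) \<Longrightarrow> f - g \<in> carrier (poly_ring n)"
  using keys_diff_cpoly[of f g] by (auto simp: mem_poly_ring_iff)

lemma poly_ring_sum_closed: "(\<And>x. x \<in> X \<Longrightarrow> f x \<in> carrier (poly_ring n)) \<Longrightarrow> sum f X \<in> carrier (poly_ring n)"
  by (induction X rule: infinite_finite_induct) (auto intro: poly_ring_carrier_closed)

lemma poly_ring_prod_closed: "(\<And>x. x \<in> X \<Longrightarrow> f x \<in> carrier (poly_ring n)) \<Longrightarrow> prod f X \<in> carrier (poly_ring n)"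
  by (induction X rule: infinite_finite_induct) (auto intro: poly_ring_carrier_closed)

lemma poly_ring_power_closed: "f \<in> carrier (poly_ring n) \<Longrightarrow> f ^ k \<in> carrier (poly_ring n)"
  by (induction k) (auto intro: poly_ring_carrier_closed)

lemmas poly_ring_closed = poly_ring_carrier_closed poly_ring_minus_closed poly_ring_sum_closed
  poly_ring_prod_closed poly_ring_power_closed

lemma var_in_poly_ring [simp]: "var i j \<in> carrier (poly_ring n) \<longleftrightarrow> (i, j) \<in> grid n"
  by (simp add: var_def)

lemma poly_ring_induct [consumes 1, case_names zero add monom]:
  assumes f: "f \<in> carrier (poly_ring n)" and zero: "P 0" and add: "\<And>f g. P f \<Longrightarrow> P g \<Longrightarrow> P (f + g)"
    and monom: "\<And>c m. Poly_Mapping.keys m \<subseteq> grid n \<Longrightarrow> P (pconst c * pmono m)"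
  shows "P f"
proof -
  have "P (\<Sum>m\<in>X. pconst (Poly_Mapping.lookup f m) * pmono m)" if "finite X" "X \<subseteq> Poly_Mapping.keys f" for X
    using that f by (induction X rule: finite_induct) (auto simp: mem_poly_ring_iff intro!: zero add monom)
  from this[of "Poly_Mapping.keys f"] show ?thesis using cpoly_expand[of "Poly_Mapping.keys f" f] by simp
qed

section \<open>Ideals of \<open>poly_ring n\<close> in terms of the ordinary operations on
  \<open>cpoly\<close>\<close>

context
  fixes n :: nat and I :: "cpoly set"
  assumes I: "ideal I (poly_ring n)"
begin

interpretation ideal I "poly_ring n" by (rule I)

lemma ideal_subset: "f \<in> I \<Longrightarrow> f \<in> carrier (poly_ring n)"
  using a_subset by auto

lemma ideal_zero: "0 \<in> I"
  using additive_subgroup.zero_closed[OF is_additive_subgroup] by simp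

lemma ideal_add: "f \<in> I \<Longrightarrow> g \<in> I \<Longrightarrow> f + g \<in> I"
  using additive_subgroup.a_closed[OF is_additive_subgroup, of f g] by simp

lemma ideal_mult: "a \<in> carrier (poly_ring n) \<Longrightarrow> f \<in> I \<Longrightarrow> a * f \<in> I"
  using I_l_closed[of f a] by simp

lemma ideal_uminus: "f \<in> I \<Longrightarrow> - f \<in> I"
  using ideal_mult[of "- 1" f] by (simp add: poly_ring_minus_closed)

lemma ideal_diff: "f \<in> I \<Longrightarrow> g \<in> I \<Longrightarrow> f - g \<in> I"
  using ideal_add[of f "- g"] ideal_uminus by simp

lemma ideal_sum: "(\<And>x. x \<in> X \<Longrightarrow> f x \<in> I) \<Longrightarrow> sum f X \<in> I"
  by (induction X rule: infinite_finite_induct) (auto intro: ideal_zero ideal_add)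

end

lemma poly_idealI:
  assumes "I \<subseteq> carrier (poly_ring n)" "0 \<in> I" "\<And>f g. f \<in> I \<Longrightarrow> g \<in> I \<Longrightarrow> f + g \<in> I"
    and mult: "\<And>a f. a \<in> carrier (poly_ring n) \<Longrightarrow> f \<in> I \<Longrightarrow> a * f \<in> I"
  shows "ideal I (poly_ring n)"
proof -
  interpret cring "poly_ring n" by (rule cring_poly_ring)
  have uminus: "- f \<in> I" if "f \<in> I" for f
    using mult[of "- 1" f] that by (simp add: poly_ring_minus_closed)
  have "subgroup I (add_monoid (poly_ring n))"
  proof (rule add.subgroupI)
    fix f assume f: "f \<in> I"
    then have "f \<in> carrier (poly_ring n)" "- f \<in> carrier (poly_ring n)" using assms(1) uminus by auto
    then have "\<ominus>\<^bsub>poly_ring n\<^esub> f = - f"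
      by (intro minus_equality) auto
    then show "\<ominus>\<^bsub>poly_ring n\<^esub> f \<in> I" using uminus f by simp
  qed (use assms in auto)
  then show ?thesis
  proof (rule idealI[OF ring_axioms])
    fix f a assume "f \<in> I" "a \<in> carrier (poly_ring n)"
    then have "a * f \<in> I" by (rule mult[rotated])
    then show "a \<otimes>\<^bsub>poly_ring n\<^esub> f \<in> I" "f \<otimes>\<^bsub>poly_ring n\<^esub> a \<in> I"
      by (simp_all add: mult.commute)
  qed
qed

lemma genideal_poly_ideal: "S \<subseteq> carrier (poly_ring n) \<Longrightarrow> ideal (Idl\<^bsub>poly_ring n\<^esub> S) (poly_ring n)"
  by (rule ring.genideal_ideal) (use cring_poly_ring cring.axioms(1) in auto)

lemma genideal_poly_self: "S \<subseteq> carrier (poly_ring n) \<Longrightarrow> s \<in> S \<Longrightarrow> s \<in> Idl\<^bsub>poly_ring n\<^esub> S"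
  using ring.genideal_self[of "poly_ring n" S] cring_poly_ring cring.axioms(1) by blast

lemma genideal_poly_minimal: "ideal I (poly_ring n) \<Longrightarrow> S \<subseteq> I \<Longrightarrow> Idl\<^bsub>poly_ring n\<^esub> S \<subseteq> I"
  using ring.genideal_minimal[of "poly_ring n" I S] cring_poly_ring cring.axioms(1) by blast

text \<open>The elements with the property form an ideal. Multiplication need only be checked for
  single terms because ring elements are sums of terms; this suits properties on which a monomial
  acts by a shift, such as those about degrees or divisibility of monomials.\<close>

lemma genideal_poly_induct [consumes 2, case_names gen zero add monom]:
  assumes S: "S \<subseteq> carrier (poly_ring n)" and f: "f \<in> Idl\<^bsub>poly_ring n\<^esub> S"
    and gen: "\<And>s. s \<in> S \<Longrightarrow> P s" and zero: "P 0"
    and add: "\<And>f g. f \<in> carrier (poly_ring n) \<Longrightarrow> g \<in> carrier (poly_ring n) \<Longrightarrow> P f \<Longrightarrow> P g \<Longrightarrow> P (f + g)"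
    and monom: "\<And>c m f. Poly_Mapping.keys m \<subseteq> grid n \<Longrightarrow> f \<in> carrier (poly_ring n) \<Longrightarrow> P f \<Longrightarrow> P (pconst c * pmono m * f)"
  shows "P f"
proof -
  have "ideal {f \<in> carrier (poly_ring n). P f} (poly_ring n)"
  proof (rule poly_idealI)
    fix a f assume a: "a \<in> carrier (poly_ring n)" and f: "f \<in> {f \<in> carrier (poly_ring n). P f}"
    have "a * f \<in> carrier (poly_ring n) \<and> P (a * f)"
      using a
    proof (induction a rule: poly_ring_induct)
      case (monom c m)
      then show ?case using f assms(6)[of m f c] by (auto intro!: poly_ring_closed)
    qed (use f in \<open>auto simp: zero distrib_right intro!: add poly_ring_closed\<close>)
    then show "a * f \<in> {f \<in> carrier (poly_ring n). P f}" by simp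
  qed (auto intro: zero add poly_ring_closed)
  from genideal_poly_minimal[OF this, of S] S gen f show ?thesis by blast
qed

section \<open>Evaluation at a matrix\<close>

definition mon_eval :: "(cell \<Rightarrow> complex) \<Rightarrow> mon \<Rightarrow> complex" where
  "mon_eval A m = (\<Prod>v\<in>Poly_Mapping.keys m. A v ^ Poly_Mapping.lookup m v)"

lemma mon_eval_superset:
  "finite V \<Longrightarrow> Poly_Mapping.keys m \<subseteq> V \<Longrightarrow> mon_eval A m = (\<Prod>v\<in>V. A v ^ Poly_Mapping.lookup m v)"
  unfolding mon_eval_def by (rule prod.mono_neutral_left) (auto simp: in_keys_iff)

lemma mon_eval_plus: "mon_eval A (a + b) = mon_eval A a * mon_eval A b"
  using mon_eval_superset[of "Poly_Mapping.keys a \<union> Poly_Mapping.keys b" "a + b" A]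
    mon_eval_superset[of "Poly_Mapping.keys a \<union> Poly_Mapping.keys b" a A] mon_eval_superset[of "Poly_Mapping.keys a \<union> Poly_Mapping.keys b" b A]
  by (simp add: keys_plus_mon lookup_add power_add prod.distrib)

lemma peval_superset:
  "finite X \<Longrightarrow> Poly_Mapping.keys f \<subseteq> X \<Longrightarrow> peval A f = (\<Sum>m\<in>X. Poly_Mapping.lookup f m * mon_eval A m)"
  unfolding peval_def mon_eval_def[symmetric]
  by (rule sum.mono_neutral_left) (auto simp: in_keys_iff)

lemma peval_add [simp]: "peval A (f + g) = peval A f + peval A g"
  using peval_superset[of "Poly_Mapping.keys f \<union> Poly_Mapping.keys g" "f + g" A] keys_add[of f g]
    peval_superset[of "Poly_Mapping.keys f \<union> Poly_Mapping.keys g" f A] peval_superset[of "Poly_Mapping.keys f \<union> Poly_Mapping.keys g" g A]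
  by (simp add: lookup_add distrib_right sum.distrib)

lemma peval_zero [simp]: "peval A 0 = 0"
  by (simp add: peval_def)

lemma peval_sum [simp]: "peval A (sum f X) = (\<Sum>x\<in>X. peval A (f x))"
  by (induction X rule: infinite_finite_induct) auto

lemma peval_pmono [simp]: "peval A (pmono m) = mon_eval A m"
  by (simp add: peval_def lookup_pmono mon_eval_def)

lemma peval_pconst_mult [simp]: "peval A (pconst c * f) = c * peval A f"
  using peval_superset[of "Poly_Mapping.keys f" "pconst c * f" A] keys_pconst_mult[of c f]
    peval_superset[of "Poly_Mapping.keys f" f A]
  by (simp add: sum_distrib_left mult.assoc)

lemma peval_mult [simp]: "peval A (f * g) = peval A f * peval A g"
proof -
  have mono: "peval A (pmono m * g) = mon_eval A m * peval A g" for m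
  proof -
    have "pmono m * g = (\<Sum>k\<in>Poly_Mapping.keys g. pconst (Poly_Mapping.lookup g k) * pmono (m + k))"
      by (subst cpoly_expand[of "Poly_Mapping.keys g" g]) (simp_all add: sum_distrib_left pmono_mult_monom)
    then have "peval A (pmono m * g) = (\<Sum>k\<in>Poly_Mapping.keys g. Poly_Mapping.lookup g k * mon_eval A (m + k))" by simp
    also have "\<dots> = mon_eval A m * peval A g"
      using peval_superset[of "Poly_Mapping.keys g" g A]
      by (simp add: mon_eval_plus sum_distrib_left algebra_simps)
    finally show ?thesis .
  qed
  have "f * g = (\<Sum>m\<in>Poly_Mapping.keys f. pconst (Poly_Mapping.lookup f m) * (pmono m * g))"
    by (subst cpoly_expand[of "Poly_Mapping.keys f" f]) (simp_all add: sum_distrib_right mult.assoc)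
  then have "peval A (f * g) = (\<Sum>m\<in>Poly_Mapping.keys f. Poly_Mapping.lookup f m * (mon_eval A m * peval A g))"
    by (simp add: mono)
  also have "\<dots> = peval A f * peval A g"
    using peval_superset[of "Poly_Mapping.keys f" f A] by (simp add: sum_distrib_right mult.assoc)
  finally show ?thesis .
qed

lemma peval_one [simp]: "peval A 1 = 1"
  using peval_pmono[of A 0] by (simp add: pmono_zero mon_eval_def)

lemma peval_pconst [simp]: "peval A (pconst c) = c"
  using peval_pconst_mult[of A c 1] by simp

lemma peval_uminus [simp]: "peval A (- f) = - peval A f"
  using peval_add[of A f "- f"] by (simp add: eq_neg_iff_add_eq_0 add.commute)

lemma peval_diff [simp]: "peval A (f - g) = peval A f - peval A g"
  using peval_add[of A f "- g"] by simp

lemma peval_prod [simp]: "peval A (prod f X) = (\<Prod>x\<in>X. peval A (f x))"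
  by (induction X rule: infinite_finite_induct) auto

lemma peval_power [simp]: "peval A (f ^ k) = peval A f ^ k"
  by (induction k) auto

lemma peval_var [simp]: "peval A (var i j) = A (i, j)"
  by (simp add: var_def mon_eval_def)

section \<open>Degrees and homogeneous parts\<close>

lemma mon_degree_superset:
  "finite V \<Longrightarrow> Poly_Mapping.keys m \<subseteq> V \<Longrightarrow> mon_degree m = (\<Sum>v\<in>V. Poly_Mapping.lookup m v)"
  unfolding mon_degree_def by (rule sum.mono_neutral_left) (auto simp: in_keys_iff)

lemma mon_degree_plus [simp]: "mon_degree (a + b) = mon_degree a + mon_degree b"
  using mon_degree_superset[of "Poly_Mapping.keys a \<union> Poly_Mapping.keys b" "a + b"]
    mon_degree_superset[of "Poly_Mapping.keys a \<union> Poly_Mapping.keys b" a] mon_degree_superset[of "Poly_Mapping.keys a \<union> Poly_Mapping.keys b" b]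
  by (simp add: keys_plus_mon lookup_add sum.distrib)

lemma mon_degree_single [simp]: "mon_degree (Poly_Mapping.single v k) = k"
  by (simp add: mon_degree_def)

lemma mon_degree_zero [simp]: "mon_degree 0 = 0"
  by (simp add: mon_degree_def)

definition homog_part :: "nat \<Rightarrow> cpoly \<Rightarrow> cpoly" where
  "homog_part d f = (\<Sum>m\<in>{m \<in> Poly_Mapping.keys f. mon_degree m = d}. Poly_Mapping.single m (Poly_Mapping.lookup f m))"

lemma lookup_homog_part [simp]: "Poly_Mapping.lookup (homog_part d f) m = (if mon_degree m = d then Poly_Mapping.lookup f m else 0)"
proof -
  have "Poly_Mapping.lookup (homog_part d f) m = (\<Sum>k\<in>{k \<in> Poly_Mapping.keys f. mon_degree k = d}. if k = m then Poly_Mapping.lookup f k else 0)"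
    by (simp add: homog_part_def lookup_sum lookup_single when_def)
  also have "\<dots> = (if m \<in> {k \<in> Poly_Mapping.keys f. mon_degree k = d} then Poly_Mapping.lookup f m else 0)"
    by (subst sum.delta) auto
  finally show ?thesis by (auto simp: in_keys_iff)
qed

lemma homog_part_add: "homog_part d (f + g) = homog_part d f + homog_part d g"
  by (rule poly_mapping_eqI) (simp add: lookup_add)

lemma homog_part_diff: "homog_part d (f - g) = homog_part d f - homog_part d g"
  by (rule poly_mapping_eqI) (simp add: lookup_minus)

lemma homog_part_zero [simp]: "homog_part d 0 = 0"
  by (rule poly_mapping_eqI) simp

lemma homog_part_sum: "homog_part d (sum f X) = (\<Sum>x\<in>X. homog_part d (f x))"
  by (induction X rule: infinite_finite_induct) (auto simp: homog_part_add)

lemma homog_part_pconst_mult: "homog_part d (pconst c * f) = pconst c * homog_part d f"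
  by (rule poly_mapping_eqI) simp

lemma homog_part_eq_self: "(\<And>m. m \<in> Poly_Mapping.keys f \<Longrightarrow> mon_degree m = d) \<Longrightarrow> homog_part d f = f"
  by (rule poly_mapping_eqI) (auto simp: in_keys_iff)

lemma homog_part_eq_zero: "(\<And>m. m \<in> Poly_Mapping.keys f \<Longrightarrow> mon_degree m \<noteq> d) \<Longrightarrow> homog_part d f = 0"
  by (rule poly_mapping_eqI) (auto simp: in_keys_iff)

lemma homog_part_pmono: "homog_part d (pmono m) = (if mon_degree m = d then pmono m else 0)"
  by (auto intro: homog_part_eq_self homog_part_eq_zero)

lemma homog_part_pmono_mult:
  "homog_part d (pmono m * f) =
    (if mon_degree m \<le> d then pmono m * homog_part (d - mon_degree m) f else 0)"
proof (rule poly_mapping_eqI)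
  fix k
  show "Poly_Mapping.lookup (homog_part d (pmono m * f)) k =
    Poly_Mapping.lookup (if mon_degree m \<le> d then pmono m * homog_part (d - mon_degree m) f else 0) k"
  proof (cases "\<exists>k'. k = m + k'")
    case True
    then obtain k' where "k = m + k'" by blast
    then show ?thesis by auto
  next
    case False
    then have "Poly_Mapping.lookup (pmono m * g) k = 0" for g
      using keys_pmono_mult[of m g] by (auto simp: in_keys_iff)
    then show ?thesis by simp
  qed
qed

lemma keys_homog_part: "Poly_Mapping.keys (homog_part d f) = {m \<in> Poly_Mapping.keys f. mon_degree m = d}"
  by (auto simp: in_keys_iff split: if_splits)

lemma homog_part_in_poly_ring: "f \<in> carrier (poly_ring n) \<Longrightarrow> homog_part d f \<in> carrier (poly_ring n)"
  by (simp add: mem_poly_ring_iff keys_homog_part)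

lemma top_component_eq: "top_component f = homog_part (poly_degree f) f"
  by (simp add: top_component_def homog_part_def)

text \<open>The bound is strict so that the zero polynomial satisfies it for every \<open>d\<close>,
  and for \<open>d = 0\<close> nothing else does; this is the base case of inductions on the
  degree.\<close>

definition degree_below :: "nat \<Rightarrow> nat \<Rightarrow> cpoly set" where
  "degree_below n d = {f \<in> carrier (poly_ring n). \<forall>m\<in>Poly_Mapping.keys f. mon_degree m < d}"

lemma degree_below_add: "f \<in> degree_below n d \<Longrightarrow> g \<in> degree_below n d \<Longrightarrow> f + g \<in> degree_below n d"
  using keys_add[of f g] by (auto simp: degree_below_def intro: poly_ring_closed)

lemma degree_below_mult:
  "Poly_Mapping.keys m \<subseteq> grid n \<Longrightarrow> f \<in> degree_below n d \<Longrightarrow>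
    pconst c * pmono m * f \<in> degree_below n (mon_degree m + d)"
  using keys_pconst_mult[of c "pmono m * f"] keys_pmono_mult[of m f]
  by (fastforce simp: degree_below_def mult.assoc intro!: poly_ring_closed)

section \<open>Reduction in the Toeplitz order\<close>

lemma var_greater_trans: "var_greater u v \<Longrightarrow> var_greater v w \<Longrightarrow> var_greater u w"
  by (cases u; cases v; cases w) auto

lemma var_greater_total: "u \<noteq> v \<Longrightarrow> var_greater u v \<or> var_greater v u"
  by (cases u; cases v) auto

lemma toeplitz_less_irrefl: "\<not> toeplitz_less m m"
  by (simp add: toeplitz_less_def)

lemma toeplitz_less_trans:
  assumes "toeplitz_less a b" "toeplitz_less b c"
  shows "toeplitz_less a c"
proof -
  obtain v where v: "Poly_Mapping.lookup a v < Poly_Mapping.lookup b v" "\<And>u. var_greater u v \<Longrightarrow> Poly_Mapping.lookup a u = Poly_Mapping.lookup b u"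
    using assms(1) unfolding toeplitz_less_def by blast
  obtain w where w: "Poly_Mapping.lookup b w < Poly_Mapping.lookup c w" "\<And>u. var_greater u w \<Longrightarrow> Poly_Mapping.lookup b u = Poly_Mapping.lookup c u"
    using assms(2) unfolding toeplitz_less_def by blast
  consider "v = w" | "var_greater v w" | "var_greater w v" using var_greater_total by blast
  then show ?thesis
  proof cases
    case 1
    then show ?thesis unfolding toeplitz_less_def using v w by (intro exI[of _ v]) auto
  next
    case 2
    then have "Poly_Mapping.lookup a u = Poly_Mapping.lookup c u" if "var_greater u v" for u
      using v(2)[OF that] w(2)[OF var_greater_trans[OF that]] by simp
    moreover have "Poly_Mapping.lookup a v < Poly_Mapping.lookup c v" using v(1) w(2)[OF 2] by simp
    ultimately show ?thesis unfolding toeplitz_less_def by blast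
  next
    case 3
    then have "Poly_Mapping.lookup a u = Poly_Mapping.lookup c u" if "var_greater u w" for u
      using w(2)[OF that] v(2)[OF var_greater_trans[OF that]] by simp
    moreover have "Poly_Mapping.lookup a w < Poly_Mapping.lookup c w" using w(1) v(2)[OF 3] by simp
    ultimately show ?thesis unfolding toeplitz_less_def by blast
  qed
qed

lemma toeplitz_less_plus: "toeplitz_less m m' \<Longrightarrow> toeplitz_less (a + m) (a + m')"
  unfolding toeplitz_less_def by (simp add: lookup_add)

text \<open>Two monomials differ in finitely many variables. At the greatest of these,
  \<open>dom\<close> rules out that \<open>m\<close> has the larger exponent, since it would supply
  a still greater variable where they differ.\<close>

lemma toeplitz_lessI:
  assumes "m \<noteq> m'"
    and dom: "\<And>u. Poly_Mapping.lookup m' u < Poly_Mapping.lookup m u \<Longrightarrow> \<exists>v. var_greater v u \<and> Poly_Mapping.lookup m v < Poly_Mapping.lookup m' v"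
  shows "toeplitz_less m m'"
proof -
  \<comment> \<open>A numbering of the cells along the order: as \<open>j \<le> i + j\<close>, the
    cells with coordinate sum s receive numbers from s * s to s * s + s, below the square of s + 1;
    within one sum, decreasing \<open>i\<close> means increasing \<open>j\<close>.\<close>
  define key where "key = (\<lambda>(i, j). (i + j) * (i + j) + j :: nat)"
  have key: "key u < key v" if greater: "var_greater u v" for u v
  proof -
    obtain i j i' j' where uv: "u = (i, j)" "v = (i', j')" by (cases u; cases v)
    consider "i + j < i' + j'" | "i + j = i' + j'" "j < j'" using greater uv by fastforce
    then show ?thesis
    proof cases
      case 1
      have "(i + j) * (i + j) + j < Suc (i + j) * Suc (i + j)" by simp
      also have "\<dots> \<le> (i' + j') * (i' + j')" using 1 by (intro mult_le_mono) auto
      finally show ?thesis by (simp add: key_def uv)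
    qed (simp add: key_def uv)
  qed
  define D where "D = {u. Poly_Mapping.lookup m u \<noteq> Poly_Mapping.lookup m' u}"
  have "D \<subseteq> Poly_Mapping.keys m \<union> Poly_Mapping.keys m'" by (auto simp: D_def in_keys_iff)
  then have "finite D" by (rule finite_subset) simp
  moreover have "D \<noteq> {}" using assms(1) by (auto simp: D_def intro: poly_mapping_eqI)
  ultimately obtain u where u: "u \<in> D" "\<And>w. w \<in> D \<Longrightarrow> key u \<le> key w"
    using arg_min_if_finite[of D key] by (metis linorder_not_less)
  have above: "w \<notin> D" if "var_greater w u" for w
    using u(2)[of w] key[OF that] by auto
  have "\<not> Poly_Mapping.lookup m' u < Poly_Mapping.lookup m u" using dom[of u] above by (force simp: D_def)
  with u(1) have "Poly_Mapping.lookup m u < Poly_Mapping.lookup m' u" by (auto simp: D_def)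
  moreover have "Poly_Mapping.lookup m w = Poly_Mapping.lookup m' w" if "var_greater w u" for w
    using above[OF that] by (simp add: D_def)
  ultimately show ?thesis unfolding toeplitz_less_def by blast
qed

section \<open>Monomials in \<open>I_B n\<close> and the reduction along a chain\<close>

lemma I_B_generators_subset:
  "{var i j ^ 3 | i j. i \<in> {1..n} \<and> j \<in> {1..n}} \<union> rook_products n \<union>
    {(\<Sum>j=1..n. var i j ^ 2) | i. i \<in> {1..n}} \<union> {(\<Sum>i=1..n. var i j ^ 2) | j. j \<in> {1..n}} \<subseteq> carrier (poly_ring n)"
  by (auto simp: rook_products_def grid_def intro!: poly_ring_closed)

lemma I_B_ideal: "ideal (I_B n) (poly_ring n)"
  unfolding I_B_def by (rule genideal_poly_ideal[OF I_B_generators_subset])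

lemmas I_B_subset = ideal_subset[OF I_B_ideal]
  and I_B_zero = ideal_zero[OF I_B_ideal]
  and I_B_add = ideal_add[OF I_B_ideal]
  and I_B_mult = ideal_mult[OF I_B_ideal]
  and I_B_diff = ideal_diff[OF I_B_ideal]
  and I_B_sum = ideal_sum[OF I_B_ideal]

lemma I_B_generators:
  assumes "i \<in> {1..n}" "j \<in> {1..n}"
  shows "var i j ^ 3 \<in> I_B n" "(\<Sum>j=1..n. var i j ^ 2) \<in> I_B n" "(\<Sum>i=1..n. var i j ^ 2) \<in> I_B n"
    "j' \<in> {1..n} \<Longrightarrow> j < j' \<Longrightarrow> var i j * var i j' \<in> I_B n"
    "i' \<in> {1..n} \<Longrightarrow> i < i' \<Longrightarrow> var i j * var i' j \<in> I_B n"
proof -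
  note mem = genideal_poly_self[OF I_B_generators_subset, folded I_B_def]
  show "var i j ^ 3 \<in> I_B n" using assms by (intro mem) blast
  show "(\<Sum>j=1..n. var i j ^ 2) \<in> I_B n" using assms by (intro mem) blast
  show "(\<Sum>i=1..n. var i j ^ 2) \<in> I_B n" using assms by (intro mem) blast
  show "var i j * var i j' \<in> I_B n" if "j' \<in> {1..n}" "j < j'"
    using assms that unfolding rook_products_def by (intro mem[unfolded rook_products_def]) blast
  show "var i j * var i' j \<in> I_B n" if "i' \<in> {1..n}" "i < i'"
    using assms that unfolding rook_products_def by (intro mem[unfolded rook_products_def]) blast
qed

lemma var_power: "var i j ^ k = pmono (Poly_Mapping.single (i, j) k)"
  by (induction k) (simp_all add: pmono_zero var_def pmono_mult flip: single_add)

lemma pmono_in_I_B_plus: "pmono a \<in> I_B n \<Longrightarrow> Poly_Mapping.keys b \<subseteq> grid n \<Longrightarrow> pmono (a + b) \<in> I_B n"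
  using I_B_mult[of "pmono b" n "pmono a"] by (simp add: pmono_mult add.commute)

lemma cube_in_I_B:
  assumes "Poly_Mapping.keys m \<subseteq> grid n" "Poly_Mapping.lookup m v \<ge> 3"
  shows "pmono m \<in> I_B n"
proof -
  obtain i j where v: "v = (i, j)" by (cases v)
  have m: "m = Poly_Mapping.single v 3 + (m - Poly_Mapping.single v 3)"
    using assms(2) by (intro poly_mapping_eqI) (auto simp: lookup_add lookup_minus lookup_single when_def)
  have "v \<in> Poly_Mapping.keys m" using assms(2) by (simp add: in_keys_iff)
  then have "pmono (Poly_Mapping.single v 3) \<in> I_B n"
    using assms(1) I_B_generators(1)[of i n j] by (auto simp: v var_power grid_def)
  moreover have "Poly_Mapping.keys (m - Poly_Mapping.single v 3) \<subseteq> grid n"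
    using assms(1) by (auto simp: in_keys_iff lookup_minus)
  ultimately show ?thesis by (subst m) (rule pmono_in_I_B_plus)
qed

lemma non_rook_in_I_B:
  assumes "Poly_Mapping.keys m \<subseteq> grid n" "u \<in> Poly_Mapping.keys m" "v \<in> Poly_Mapping.keys m" "u \<noteq> v" "fst u = fst v \<or> snd u = snd v"
  shows "pmono m \<in> I_B n"
proof -
  let ?p = "Poly_Mapping.single u 1 + Poly_Mapping.single v (1 :: nat)"
  have m: "m = ?p + (m - ?p)"
    using assms by (intro poly_mapping_eqI) (auto simp: lookup_add lookup_minus lookup_single when_def in_keys_iff)
  obtain i j i' j' where uv: "u = (i, j)" "v = (i', j')" by (cases u; cases v)
  have g: "i \<in> {1..n}" "j \<in> {1..n}" "i' \<in> {1..n}" "j' \<in> {1..n}"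
    using assms(1-3) by (auto simp: uv grid_def)
  have "var i j * var i' j' \<in> I_B n"
    using assms(4,5) g I_B_generators(4)[of i n j j'] I_B_generators(4)[of i n j' j]
      I_B_generators(5)[of i n j i'] I_B_generators(5)[of i' n j i]
    by (auto simp: uv linorder_neq_iff mult.commute)
  then have "pmono ?p \<in> I_B n" by (simp add: var_def pmono_mult uv)
  moreover have "Poly_Mapping.keys (m - ?p) \<subseteq> grid n"
    using assms(1) by (auto simp: in_keys_iff lookup_minus)
  ultimately show ?thesis by (subst m) (rule pmono_in_I_B_plus)
qed

text \<open>The function \<open>e\<close> lists the cells by row and column or by column and row, so that the lemma covers
  chains violating either of the two conditions of Viennot inversion.\<close>

lemma chain_reduction:
  fixes e :: "nat \<Rightarrow> nat \<Rightarrow> cell"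
  assumes e: "e = Pair \<or> e = (\<lambda>i j. (j, i))"
    and b: "Poly_Mapping.keys b \<subseteq> grid n" "\<And>t s. s \<in> S \<Longrightarrow> e t s \<notin> Poly_Mapping.keys b"
    and S: "S \<subseteq> {1..n}" and f: "strict_mono_on S f"
    and TU: "T \<subseteq> {1..n}" "U \<subseteq> {1..n}" "T \<inter> U = {}"
    and rest: "\<And>t. t \<in> {1..n} \<Longrightarrow> t \<notin> T \<Longrightarrow> t \<notin> U \<Longrightarrow> \<exists>j. e t j \<in> Poly_Mapping.keys b"
    and fT: "f ` S \<subseteq> T" "\<And>t s. t \<in> T \<Longrightarrow> t \<notin> f ` S \<Longrightarrow> s \<in> S \<Longrightarrow> f s < t"
    and U: "card U < card S"
    and m: "m = b + (\<Sum>s\<in>S. Poly_Mapping.single (e (f s) s) 2)"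
  shows "\<exists>F\<in>I_B n. Poly_Mapping.lookup F m = 1 \<and>
    (\<forall>m'\<in>Poly_Mapping.keys F. m' \<noteq> m \<longrightarrow> toeplitz_less m' m \<and> mon_degree m' = mon_degree m)"
proof -
  have e_inj: "e t s = e t' s' \<longleftrightarrow> t = t' \<and> s = s'" for t s t' s' using e by auto
  have e_surj: "\<exists>t s. u = e t s" for u using e by (cases u) auto
  have e_grid: "e t s \<in> grid n \<longleftrightarrow> t \<in> {1..n} \<and> s \<in> {1..n}" for t s using e by (auto simp: grid_def)
  have e_greater: "var_greater (e t s) (e t' s)" "var_greater (e s t) (e s t')" if "t < t'" for t t' s
    using that e by auto
  have finS: "finite S" using S finite_subset by blast
  have finT: "finite T" "finite U" using TU finite_subset by blast+
  \<comment> \<open>\<open>M g\<close> moves the square belonging to \<open>s\<close> to line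
    \<open>g s\<close>; the given monomial is the case of \<open>f\<close>.\<close>
  define M where "M g = b + (\<Sum>s\<in>S. Poly_Mapping.single (e (g s) s) (2 :: nat))" for g
  have M_lookup: "Poly_Mapping.lookup (M g) (e t s) = Poly_Mapping.lookup b (e t s) + (if s \<in> S \<and> g s = t then 2 else 0)" for g t s
  proof -
    have "(\<Sum>s'\<in>S. Poly_Mapping.lookup (Poly_Mapping.single (e (g s') s') (2 :: nat)) (e t s)) =
        (\<Sum>s'\<in>S. if s' = s then (if g s = t then 2 else 0) else 0)"
      by (intro sum.cong) (auto simp: lookup_single when_def e_inj)
    also have "\<dots> = (if s \<in> S \<and> g s = t then 2 else 0)" using finS by simp
    finally show ?thesis by (simp add: M_def lookup_add lookup_sum)
  qed
  have M_keys: "Poly_Mapping.keys (M g) \<subseteq> grid n" if "g ` S \<subseteq> {1..n}" for g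
  proof
    fix u assume u: "u \<in> Poly_Mapping.keys (M g)"
    obtain t s where ts: "u = e t s" using e_surj by blast
    have "e t s \<in> Poly_Mapping.keys b \<or> (s \<in> S \<and> g s = t)"
      using u M_lookup[of g t s] unfolding ts by (auto simp: in_keys_iff split: if_splits)
    then show "u \<in> grid n" unfolding ts using b(1) S that by (auto simp: e_grid)
  qed
  have M_degree: "mon_degree (M g) = mon_degree b + 2 * card S" for g
    unfolding M_def by (induction S rule: infinite_finite_induct) auto
  have M_noninj: "pmono (M g) \<in> I_B n" if g: "g ` S \<subseteq> {1..n}" "\<not> inj_on g S" for g
  proof -
    obtain s s' where "s \<in> S" "s' \<in> S" "s \<noteq> s'" "g s = g s'" using g(2) by (auto simp: inj_on_def)
    then show ?thesis
      using M_keys[OF g(1)] M_lookup[of g "g s" s] M_lookup[of g "g s'" s'] e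
      by (intro non_rook_in_I_B[of _ n "e (g s) s" "e (g s') s'"]) (auto simp: in_keys_iff e_inj)
  qed
  define y where "y t s = pmono (Poly_Mapping.single (e t s) 2)" for t s
  have y_sum: "pmono b * (\<Prod>s\<in>S. \<Sum>t\<in>X. y t s) = (\<Sum>g\<in>S \<rightarrow>\<^sub>E X. pmono (M g))" if "finite X" for X
  proof -
    have "(\<Prod>s\<in>S. \<Sum>t\<in>X. y t s) = (\<Sum>g\<in>S \<rightarrow>\<^sub>E X. \<Prod>s\<in>S. y (g s) s)"
      by (rule prod_sum_PiE) (use finS that in auto)
    then show ?thesis by (simp add: sum_distrib_left y_def pmono_prod pmono_mult M_def)
  qed
  have y_ring: "y t s \<in> carrier (poly_ring n)" if "t \<in> {1..n}" "s \<in> {1..n}" for t s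
    using that by (simp add: y_def e_grid)
  \<comment> \<open>Lines outside \<open>T\<close> and \<open>U\<close> contain a factor of
    \<open>b\<close> at an index different from \<open>s\<close>, so they contribute rook products.
    What remains of the full sum makes the sums over \<open>T\<close> and \<open>U\<close> opposite
    modulo \<open>I_B n\<close>, in the presence of \<open>b\<close>.\<close>
  have y_line: "pmono b * ((\<Sum>t\<in>T. y t s) + (\<Sum>t\<in>U. y t s)) \<in> I_B n" if s: "s \<in> S" for s
  proof -
    have "s \<in> {1..n}" using s S by blast
    have "(\<Sum>t=1..n. y t s) \<in> I_B n"
      using e I_B_generators(2,3)[of s n s] \<open>s \<in> {1..n}\<close> by (auto simp: y_def var_power)
    then have "pmono b * (\<Sum>t=1..n. y t s) \<in> I_B n" using b(1) by (intro I_B_mult) auto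
    moreover have "pmono b * (\<Sum>t\<in>{1..n} - T - U. y t s) \<in> I_B n"
      unfolding sum_distrib_left
    proof (rule I_B_sum)
      fix t assume t: "t \<in> {1..n} - T - U"
      then obtain j where j: "e t j \<in> Poly_Mapping.keys b" using rest by blast
      then have "j \<noteq> s" using b(2) s by blast
      have "pmono (b + Poly_Mapping.single (e t s) 2) \<in> I_B n"
        using j \<open>j \<noteq> s\<close> t \<open>s \<in> {1..n}\<close> b(1) e
        by (intro non_rook_in_I_B[of _ n "e t j" "e t s"])
          (auto simp: keys_plus_mon e_grid e_inj)
      then show "pmono b * y t s \<in> I_B n" by (simp add: y_def pmono_mult)
    qed
    moreover have "(\<Sum>t=1..n. y t s) = (\<Sum>t\<in>T. y t s) + (\<Sum>t\<in>U. y t s) + (\<Sum>t\<in>{1..n} - T - U. y t s)"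
    proof -
      have "{1..n} = (T \<union> U) \<union> ({1..n} - T - U)" using TU by auto
      then have "(\<Sum>t=1..n. y t s) = (\<Sum>t\<in>T \<union> U. y t s) + (\<Sum>t\<in>{1..n} - T - U. y t s)"
        using finT by (subst (1) \<open>{1..n} = _\<close>, intro sum.union_disjoint) auto
      then show ?thesis using finT TU by (simp add: sum.union_disjoint)
    qed
    ultimately show ?thesis
      using I_B_diff[of "pmono b * (\<Sum>t=1..n. y t s)" n "pmono b * (\<Sum>t\<in>{1..n} - T - U. y t s)"]
      by (simp add: algebra_simps)
  qed
  have ring: "(\<Prod>s\<in>X. \<Sum>t\<in>V. y t s) \<in> carrier (poly_ring n)" "(\<Sum>t\<in>V. y t s) \<in> carrier (poly_ring n)"
    if "X \<subseteq> S" "V \<subseteq> {1..n}" "s \<in> S" for X V s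
    by ((rule poly_ring_prod_closed)?, rule poly_ring_sum_closed, rule y_ring; use that S in blast)+
  have swap: "pmono b * ((\<Prod>s\<in>X. \<Sum>t\<in>T. y t s) - (\<Prod>s\<in>X. - (\<Sum>t\<in>U. y t s))) \<in> I_B n"
    if "finite X" "X \<subseteq> S" for X
    using that
  proof (induction X rule: finite_induct)
    case empty
    then show ?case by (simp add: I_B_zero)
  next
    case (insert x X)
    let ?tx = "\<Sum>t\<in>T. y t x" and ?ux = "\<Sum>t\<in>U. y t x"
    let ?t = "\<Prod>s\<in>X. \<Sum>t\<in>T. y t s" and ?u = "\<Prod>s\<in>X. - (\<Sum>t\<in>U. y t s)"
    have x: "x \<in> S" "X \<subseteq> S" using insert by auto
    have r: "?t \<in> carrier (poly_ring n)" "- ?ux \<in> carrier (poly_ring n)"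
      using ring(1)[OF x(2) TU(1) x(1)] ring(2)[OF x(2) TU(2) x(1)] poly_ring_minus_closed(1) by blast+
    \<comment> \<open>One factor is exchanged at a time: with sums a over \<open>T\<close> and u
      over \<open>U\<close> at \<open>x\<close>, and old products p and q, the new difference a p +
      u q equals p (a + u) - u (p - q).\<close>
    have "?t * (pmono b * (?tx + ?ux)) + (- ?ux) * (pmono b * (?t - ?u)) \<in> I_B n"
      by (intro I_B_add I_B_mult r y_line x insert.IH)
    then show ?case using insert by (simp add: algebra_simps)
  qed
  have "(\<Sum>g\<in>S \<rightarrow>\<^sub>E T. pmono (M g)) \<in> I_B n"
  proof -
    have "\<not> inj_on g S" if "g \<in> S \<rightarrow>\<^sub>E U" for g
      using that U finT card_inj_on_le[of g S U] by (auto simp: PiE_def Pi_def)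
    then have "pmono b * (\<Prod>s\<in>S. \<Sum>t\<in>U. y t s) \<in> I_B n"
      unfolding y_sum[OF finT(2)] using TU by (intro I_B_sum M_noninj) auto
    then have "(- 1) ^ card S * (pmono b * (\<Prod>s\<in>S. \<Sum>t\<in>U. y t s)) \<in> I_B n"
      by (rule I_B_mult[rotated]) (simp add: poly_ring_power_closed poly_ring_minus_closed)
    also have "(- 1) ^ card S * (pmono b * (\<Prod>s\<in>S. \<Sum>t\<in>U. y t s)) =
        pmono b * (\<Prod>s\<in>S. - (\<Sum>t\<in>U. y t s))"
      by (simp add: prod_uminus mult.left_commute)
    finally have "pmono b * (\<Prod>s\<in>S. - (\<Sum>t\<in>U. y t s)) \<in> I_B n" .
    from I_B_add[OF swap[OF finS order_refl] this] show ?thesis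
      by (simp add: y_sum[OF finT(1), symmetric] right_diff_distrib)
  qed
  \<comment> \<open>The other maps have to be removed before a leading monomial can be read off:
    sending all of \<open>S\<close> to the smallest line of the chain, for instance, would give a
    monomial above \<open>m\<close> whenever the chain has at least two points.\<close>
  moreover define G where "G = {g \<in> S \<rightarrow>\<^sub>E T. inj_on g S}"
  have "(\<Sum>g\<in>(S \<rightarrow>\<^sub>E T) - G. pmono (M g)) \<in> I_B n"
    using TU by (intro I_B_sum M_noninj) (auto simp: G_def)
  moreover have fin: "finite (S \<rightarrow>\<^sub>E T)" by (rule finite_PiE) (use finS finT in auto)
  then have "(\<Sum>g\<in>G. pmono (M g)) = (\<Sum>g\<in>S \<rightarrow>\<^sub>E T. pmono (M g)) - (\<Sum>g\<in>(S \<rightarrow>\<^sub>E T) - G. pmono (M g))"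
    by (subst sum_diff) (auto simp: G_def)
  ultimately have F: "(\<Sum>g\<in>G. pmono (M g)) \<in> I_B n" using I_B_diff by simp
  have finG: "finite G" using fin by (simp add: G_def)

  define f' where "f' = restrict f S"
  have Mf: "M f' = m" unfolding M_def m f'_def by simp
  have f'G: "f' \<in> G"
    using fT(1) strict_mono_on_imp_inj_on[OF f] by (auto simp: G_def f'_def inj_on_restrict_eq)
  have less: "toeplitz_less (M g) m" if g: "g \<in> G" "g \<noteq> f'" for g
  proof (rule toeplitz_lessI)
    have "\<exists>s\<in>S. g s \<noteq> f s"
    proof (rule ccontr)
      assume "\<not> ?thesis"
      then have "g = f'"
        using g(1) by (intro extensionalityI[of _ S]) (auto simp: G_def f'_def PiE_def)
      with g(2) show False by simp
    qed
    then obtain s where s: "s \<in> S" "g s \<noteq> f s" by blast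
    then have "Poly_Mapping.lookup (M g) (e (g s) s) \<noteq> Poly_Mapping.lookup m (e (g s) s)"
      unfolding Mf[symmetric] M_lookup by (simp add: f'_def)
    then show "M g \<noteq> m" by auto
  next
    fix u assume u: "Poly_Mapping.lookup m u < Poly_Mapping.lookup (M g) u"
    obtain t s where ts: "u = e t s" using e_surj by blast
    have s: "s \<in> S" "g s = t" "f s \<noteq> t"
      using u unfolding ts Mf[symmetric] M_lookup by (auto simp: f'_def split: if_splits)
    then have "t \<in> T" using g by (auto simp: G_def)
    \<comment> \<open>If \<open>t\<close> exceeds \<open>f s\<close>, the square of \<open>m\<close>
      at \<open>f s\<close> is in a greater variable. If \<open>t\<close> is smaller, it must be a
      line \<open>f s'\<close> of the chain with \<open>s' < s\<close>, since all other lines of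
      \<open>T\<close> exceed the chain; injectivity of \<open>g\<close> keeps the square of
      \<open>m\<close> at \<open>s'\<close> out of \<open>M g\<close>, and its variable is greater
      as well.\<close>
    show "\<exists>v. var_greater v u \<and> Poly_Mapping.lookup (M g) v < Poly_Mapping.lookup m v"
    proof (cases "f s < t")
      case True
      then have "var_greater (e (f s) s) u" unfolding ts by (rule e_greater)
      moreover have "Poly_Mapping.lookup (M g) (e (f s) s) < Poly_Mapping.lookup m (e (f s) s)"
        unfolding Mf[symmetric] M_lookup using s by (simp add: f'_def)
      ultimately show ?thesis by blast
    next
      case False
      then obtain s' where s': "s' \<in> S" "t = f s'" using fT(2)[OF \<open>t \<in> T\<close> _ s(1)] by blast
      then have "f s' < f s" using False s by simp
      then have "s' < s" using strict_mono_on_less[OF f s'(1) s(1)] by simp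
      moreover have "inj_on g S" using g by (simp add: G_def)
      ultimately have "g s' \<noteq> t" using s s' by (metis inj_onD less_irrefl)
      have "var_greater (e t s') u" unfolding ts using \<open>s' < s\<close> by (rule e_greater)
      moreover have "Poly_Mapping.lookup (M g) (e t s') < Poly_Mapping.lookup m (e t s')"
        unfolding Mf[symmetric] M_lookup using s' \<open>g s' \<noteq> t\<close> by (simp add: f'_def)
      ultimately show ?thesis by blast
    qed
  qed
  have M_iff: "M g = m \<longleftrightarrow> g = f'" if "g \<in> G" for g
    using less[OF that] Mf toeplitz_less_irrefl by metis
  have "Poly_Mapping.lookup (\<Sum>g\<in>G. pmono (M g)) m = (\<Sum>g\<in>G. if g = f' then 1 else 0)"
    unfolding lookup_sum lookup_pmono
    by (intro sum.cong) (simp_all add: when_def M_iff)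
  then have "Poly_Mapping.lookup (\<Sum>g\<in>G. pmono (M g)) m = 1" using finG f'G by simp
  moreover have "toeplitz_less m' m \<and> mon_degree m' = mon_degree m"
    if m': "m' \<in> Poly_Mapping.keys (\<Sum>g\<in>G. pmono (M g))" "m' \<noteq> m" for m'
  proof -
    have "m' \<in> (\<Union>g\<in>G. Poly_Mapping.keys (pmono (M g)))" using keys_sum m'(1) by (rule subsetD)
    then obtain g where g: "g \<in> G" "m' = M g" by auto
    then have "g \<noteq> f'" using Mf m'(2) by auto
    then show ?thesis using less g M_degree Mf by metis
  qed
  ultimately show ?thesis using F by blast
qed

text \<open>Here \<open>b\<close> is \<open>m\<close> without its squares on the chain and
  \<open>f\<close> sends the \<open>cl\<close> coordinate of a chain point to its \<open>rw\<close>
  coordinate. The free lines split at the last point \<open>q0\<close>: the later ones join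
  \<open>T\<close>, the earlier ones form \<open>U\<close>, and then \<open>viol\<close> says
  exactly that \<open>U\<close> is smaller than the chain.\<close>

lemma violating_chain_reduction:
  fixes rw cl :: "cell \<Rightarrow> nat" and e :: "nat \<Rightarrow> nat \<Rightarrow> cell"
  assumes ax: "rw = fst \<and> cl = snd \<and> e = Pair \<or> rw = snd \<and> cl = fst \<and> e = (\<lambda>i j. (j, i))"
    and m: "Poly_Mapping.keys m \<subseteq> grid n" "inj_on rw (Poly_Mapping.keys m)" "inj_on cl (Poly_Mapping.keys m)"
    and Q: "\<And>q. q \<in> Q \<Longrightarrow> Poly_Mapping.lookup m q = 2" "increasing Q" "q0 \<in> Q" "\<And>q. q \<in> Q \<Longrightarrow> rw q \<le> rw q0"
    and L: "L = {1..n} - rw ` Poly_Mapping.keys m"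
    and viol: "card L < card Q + card {i \<in> L. rw q0 < i}"
  shows "\<exists>F\<in>I_B n. Poly_Mapping.lookup F m = 1 \<and>
    (\<forall>m'\<in>Poly_Mapping.keys F. m' \<noteq> m \<longrightarrow> toeplitz_less m' m \<and> mon_degree m' = mon_degree m)"
proof -
  have e_rc: "e (rw v) (cl v) = v" "rw (e t s) = t" "cl (e t s) = s" for v t s
    using ax by auto
  have rc_grid: "v \<in> grid n \<Longrightarrow> rw v \<in> {1..n} \<and> cl v \<in> {1..n}" for v
    using ax by (auto simp: grid_def)
  have Qm: "Q \<subseteq> Poly_Mapping.keys m" using Q(1) by (auto simp: in_keys_iff)
  have finQ: "finite Q" using finite_subset[OF Qm] by simp
  have injQ: "inj_on cl Q" by (rule inj_on_subset[OF m(3) Qm])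
  define f where "f s = rw (the_inv_into Q cl s)" for s
  have f: "f (cl q) = rw q" if "q \<in> Q" for q
    using that injQ by (simp add: f_def the_inv_into_f_f)
  define b where "b = m - (\<Sum>q\<in>Q. Poly_Mapping.single q 2)"
  have lookup_Q: "Poly_Mapping.lookup (\<Sum>q\<in>Q. Poly_Mapping.single q (2 :: nat)) v = (if v \<in> Q then 2 else 0)" for v
    using finQ by (simp add: lookup_sum lookup_single when_def)
  have b: "Poly_Mapping.lookup b v = (if v \<in> Q then 0 else Poly_Mapping.lookup m v)" for v
    unfolding b_def lookup_minus lookup_Q using Q(1) by simp
  have keys_b: "Poly_Mapping.keys b = Poly_Mapping.keys m - Q" by (auto simp: in_keys_iff b split: if_splits)
  show ?thesis
  proof (rule chain_reduction[where e = e and b = b and S = "cl ` Q" and f = f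
        and T = "rw ` Q \<union> {i \<in> L. rw q0 < i}" and U = "{i \<in> L. i \<le> rw q0}"])
    show "e = Pair \<or> e = (\<lambda>i j. (j, i))" using ax by blast
    show "Poly_Mapping.keys b \<subseteq> grid n" using m(1) keys_b by blast
    show "e t s \<notin> Poly_Mapping.keys b" if "s \<in> cl ` Q" for t s
    proof
      assume a: "e t s \<in> Poly_Mapping.keys b"
      obtain q where q: "q \<in> Q" "s = cl q" using \<open>s \<in> cl ` Q\<close> by blast
      then have "cl (e t s) = cl q" by (simp add: e_rc)
      then have "e t s = q" using a q Qm keys_b by (intro inj_onD[OF m(3)]) auto
      with a q keys_b show False by simp
    qed
    show "cl ` Q \<subseteq> {1..n}" using Qm m(1) rc_grid by blast
    show "strict_mono_on (cl ` Q) f"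
    proof (rule strict_mono_onI)
      fix s s' assume "s \<in> cl ` Q" "s' \<in> cl ` Q" "s < s'"
      then obtain q q' where q: "q \<in> Q" "q' \<in> Q" "s = cl q" "s' = cl q'" "cl q < cl q'" by blast
      then have "rw q < rw q'" using Q(2) ax unfolding increasing_def by blast
      then show "f s < f s'" using q f by simp
    qed
    show "rw ` Q \<union> {i \<in> L. rw q0 < i} \<subseteq> {1..n}" using Qm m(1) rc_grid L by blast
    show "{i \<in> L. i \<le> rw q0} \<subseteq> {1..n}" using L by blast
    show "(rw ` Q \<union> {i \<in> L. rw q0 < i}) \<inter> {i \<in> L. i \<le> rw q0} = {}"
      using L Qm by auto
    show "\<exists>j. e t j \<in> Poly_Mapping.keys b" if "t \<in> {1..n}" "t \<notin> rw ` Q \<union> {i \<in> L. rw q0 < i}"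
      "t \<notin> {i \<in> L. i \<le> rw q0}" for t
    proof -
      have "t \<in> rw ` Poly_Mapping.keys m" "t \<notin> rw ` Q" using that L by auto
      then obtain v where v: "v \<in> Poly_Mapping.keys m" "t = rw v" "v \<notin> Q" by blast
      then have "e t (cl v) \<in> Poly_Mapping.keys b" by (simp add: e_rc keys_b)
      then show ?thesis by blast
    qed
    show "f ` cl ` Q \<subseteq> rw ` Q \<union> {i \<in> L. rw q0 < i}" using f by auto
    show "f s < t" if t: "t \<in> rw ` Q \<union> {i \<in> L. rw q0 < i}" "t \<notin> f ` cl ` Q" and s: "s \<in> cl ` Q" for t s
    proof -
      have "f ` cl ` Q = rw ` Q" using f by (force simp: image_image)
      then have "rw q0 < t" using t by auto
      moreover have "f s \<le> rw q0" using s f Q(4) by auto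
      ultimately show ?thesis by simp
    qed
    have "card L = card {i \<in> L. i \<le> rw q0} + card {i \<in> L. rw q0 < i}"
    proof -
      have "L = {i \<in> L. i \<le> rw q0} \<union> {i \<in> L. rw q0 < i}" by auto
      moreover have "finite L" using L by simp
      ultimately show ?thesis
        using card_Un_disjoint[of "{i \<in> L. i \<le> rw q0}" "{i \<in> L. rw q0 < i}"] by fastforce
    qed
    then show "card {i \<in> L. i \<le> rw q0} < card (cl ` Q)"
      using viol card_image[OF injQ] by simp
    have "(\<Sum>s\<in>cl ` Q. Poly_Mapping.single (e (f s) s) (2 :: nat)) = (\<Sum>q\<in>Q. Poly_Mapping.single q 2)"
      unfolding sum.reindex[OF injQ] by (intro sum.cong) (simp_all add: f e_rc)
    then show "m = b + (\<Sum>s\<in>cl ` Q. Poly_Mapping.single (e (f s) s) 2)"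
      by (intro poly_mapping_eqI) (simp add: lookup_add b lookup_Q Q(1))
  qed
qed

section \<open>Every monomial is reducible or comes from a signed permutation\<close>

lemma set_mon_eq: "set_mon S = pmono (\<Sum>v\<in>S. Poly_Mapping.single v 1)"
  unfolding set_mon_def var_def by (simp add: case_prod_beta pmono_prod)

lemma signed_mon_eq:
  "signed_mon n w = pmono ((\<Sum>v\<in>neg_part n w. Poly_Mapping.single v 1) + (\<Sum>v\<in>shadow_set (pos_part n w). Poly_Mapping.single v 2))"
proof -
  have "(\<Sum>v\<in>S. Poly_Mapping.single v (1 :: nat)) + (\<Sum>v\<in>S. Poly_Mapping.single v 1) = (\<Sum>v\<in>S. Poly_Mapping.single v 2)" for S :: "cell set"
    by (simp add: numeral_2_eq_2 flip: sum.distrib single_add)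
  then show ?thesis
    by (simp add: signed_mon_def set_mon_eq power2_eq_square pmono_mult)
qed

text \<open>A monomial in \<open>I_B n\<close> is its own reduction, so the others may be assumed to
  have exponents at most 2 on a rook placement. If no reduction exists, every chain obeys the two
  bounds that Viennot inversion asks for. Inversion takes place on the rows and columns avoided by
  the cells of exponent 1, which become the negative part.\<close>

lemma signed_mon_dichotomy:
  assumes m: "Poly_Mapping.keys m \<subseteq> grid n"
  shows "(\<exists>w\<in>signed_perms n. signed_mon n w = pmono m) \<or>
    (\<exists>F\<in>I_B n. Poly_Mapping.lookup F m = 1 \<and>
      (\<forall>m'\<in>Poly_Mapping.keys F. m' \<noteq> m \<longrightarrow> toeplitz_less m' m \<and> mon_degree m' = mon_degree m))"
    (is "_ \<or> ?red")
proof (cases "pmono m \<in> I_B n")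
  case True
  then have ?red by (intro bexI[of _ "pmono m"]) (auto simp: lookup_pmono)
  then show ?thesis ..
next
  case False
  have le2: "Poly_Mapping.lookup m v \<le> 2" for v
    using cube_in_I_B[OF m, of v] False by linarith
  have inj: "inj_on fst (Poly_Mapping.keys m)" "inj_on snd (Poly_Mapping.keys m)"
    using non_rook_in_I_B[OF m] False by (auto simp: inj_on_def)
  define N where "N = {v. Poly_Mapping.lookup m v = 1}"
  define R where "R = {v. Poly_Mapping.lookup m v = 2}"
  have keys: "Poly_Mapping.keys m = N \<union> R" "N \<inter> R = {}"
  proof -
    have "Poly_Mapping.lookup m v = 0 \<or> Poly_Mapping.lookup m v = 1 \<or> Poly_Mapping.lookup m v = 2" for v using le2[of v] by auto
    then show "Poly_Mapping.keys m = N \<union> R" "N \<inter> R = {}" by (auto simp: N_def R_def in_keys_iff)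
  qed
  have fin: "finite N" "finite R" using keys by (metis finite_Un finite_keys)+
  define A where "A = {1..n} - fst ` N"
  define B where "B = {1..n} - snd ` N"
  have NR_grid: "N \<subseteq> grid n" "R \<subseteq> grid n" using m keys by auto
  have injN: "inj_on fst N" "inj_on snd N" and injR: "inj_on fst R" "inj_on snd R"
    using inj keys by (auto intro: inj_on_subset)
  have N_sub: "fst ` N \<subseteq> {1..n}" "snd ` N \<subseteq> {1..n}" using NR_grid by (auto simp: grid_def)
  have cardAB: "card A = card B"
    unfolding A_def B_def using N_sub fin injN by (simp add: card_Diff_subset card_image)
  have disj: "fst ` N \<inter> fst ` R = {}" "snd ` N \<inter> snd ` R = {}"
    using inj keys by (auto simp: inj_on_def) (metis IntI Un_iff emptyE fst_conv snd_conv)+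
  have RAB: "R \<subseteq> A \<times> B"
  proof
    fix p assume p: "p \<in> R"
    obtain i j where ij: "p = (i, j)" by (cases p)
    have "i \<in> fst ` R" "j \<in> snd ` R" using p ij by force+
    then show "p \<in> A \<times> B" using p ij NR_grid disj by (auto simp: A_def B_def grid_def)
  qed
  have L: "A - fst ` R = {1..n} - fst ` Poly_Mapping.keys m" "B - snd ` R = {1..n} - snd ` Poly_Mapping.keys m"
    by (auto simp: A_def B_def keys)
  show ?thesis
  proof (cases ?red)
    case no_red: False
    have "\<exists>jj. bij_betw jj A B \<and> shadow_set ((\<lambda>i. (i, jj i)) ` A) = R"
    proof (rule viennot_inversion)
      fix Q e assume Q: "Q \<subseteq> R" "increasing Q" "e \<in> Q" "\<And>q. q \<in> Q \<Longrightarrow> fst q \<le> fst e"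
      show "card Q + card {i \<in> A - fst ` R. fst e < i} \<le> card (A - fst ` R)"
      proof (rule ccontr)
        assume viol: "\<not> ?thesis"
        have two: "Poly_Mapping.lookup m q = 2" if "q \<in> Q" for q using that Q(1) by (auto simp: R_def)
        have ?red
          by (rule violating_chain_reduction[of fst snd Pair, OF _ m inj two Q(2-4) L(1)
                viol[unfolded not_le]]) simp_all
        with no_red show False ..
      qed
    next
      fix Q e assume Q: "Q \<subseteq> R" "increasing Q" "e \<in> Q" "\<And>q. q \<in> Q \<Longrightarrow> snd q \<le> snd e"
      show "card Q + card {i \<in> B - snd ` R. snd e < i} \<le> card (B - snd ` R)"
      proof (rule ccontr)
        assume viol: "\<not> ?thesis"
        have two: "Poly_Mapping.lookup m q = 2" if "q \<in> Q" for q using that Q(1) by (auto simp: R_def)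
        have ?red
          by (rule violating_chain_reduction[of snd fst "\<lambda>i j. (j, i)", OF _ m inj(2) inj(1) two Q(2-4) L(2)
                viol[unfolded not_le]]) simp_all
        with no_red show False ..
      qed
    qed (use cardAB RAB injR in \<open>auto simp: A_def B_def\<close>)
    then obtain jj where jj: "bij_betw jj A B" "shadow_set ((\<lambda>i. (i, jj i)) ` A) = R" by blast
    define nn where "nn i = snd (the_inv_into N fst i)" for i
    have nn: "nn i = j" if "(i, j) \<in> N" for i j
      using the_inv_into_f_f[OF injN(1) that] by (simp add: nn_def)
    have nn_bij: "bij_betw nn (fst ` N) (snd ` N)"
      unfolding bij_betw_def
    proof
      have "i = i'" if "(i, j) \<in> N" "(i', j) \<in> N" for i i' j
        using inj_onD[OF injN(2) _ that] by simp
      then show "inj_on nn (fst ` N)" using nn by (fastforce simp: inj_on_def)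
      show "nn ` fst ` N = snd ` N" using nn by (force simp: image_image)
    qed
    \<comment> \<open>Outside \<open>{1..n}\<close> the map is the identity, as
      \<open>permutes\<close> demands. Signs are attached to columns, so a column receives 1 exactly
      when it is met by \<open>N\<close>.\<close>
    define \<sigma> where "\<sigma> i = (if i \<in> A then jj i else if i \<in> fst ` N then nn i else i)" for i
    define \<kappa> where "\<kappa> = restrict (\<lambda>j. if j \<in> B then 0 else 1 :: nat) {1..n}"
    have "bij_betw \<sigma> (A \<union> fst ` N) (B \<union> snd ` N)"
    proof (rule bij_betw_combine)
      show "bij_betw \<sigma> A B" using jj(1) by (rule bij_betw_cong[THEN iffD1, rotated]) (simp add: \<sigma>_def)
      show "bij_betw \<sigma> (fst ` N) (snd ` N)"
        using nn_bij by (rule bij_betw_cong[THEN iffD1, rotated]) (simp add: \<sigma>_def A_def)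
      show "B \<inter> snd ` N = {}" by (auto simp: B_def)
    qed
    moreover have "A \<union> fst ` N = {1..n}" "B \<union> snd ` N = {1..n}"
      using N_sub by (auto simp: A_def B_def)
    ultimately have "\<sigma> permutes {1..n}"
      using N_sub by (intro bij_imp_permutes) (auto simp: \<sigma>_def A_def)
    moreover have "\<kappa> \<in> {1..n} \<rightarrow>\<^sub>E {0, 1}" by (auto simp: \<kappa>_def)
    ultimately have w: "(\<sigma>, \<kappa>) \<in> signed_perms n" by (simp add: signed_perms_def)
    have \<sigma>A: "\<sigma> i \<in> B" "\<kappa> (\<sigma> i) = 0" "\<sigma> i = jj i" if "i \<in> A" for i
      using that jj(1) by (auto simp: \<sigma>_def \<kappa>_def bij_betw_def B_def)
    have \<sigma>N: "\<sigma> i = j" "\<kappa> (\<sigma> i) = 1" if "(i, j) \<in> N" for i j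
    proof -
      have "i \<in> fst ` N" "j \<in> snd ` N" using that by force+
      then show "\<sigma> i = j" "\<kappa> (\<sigma> i) = 1" using nn[OF that] N_sub by (auto simp: \<sigma>_def \<kappa>_def A_def B_def)
    qed
    have AN: "i \<in> {1..n} \<Longrightarrow> i \<in> A \<or> (\<exists>j. (i, j) \<in> N)" "(i, j) \<in> N \<Longrightarrow> i \<in> {1..n}"
      "i \<in> A \<Longrightarrow> i \<in> {1..n}" for i j
      using NR_grid by (force simp: A_def grid_def)+
    have neg: "neg_part n (\<sigma>, \<kappa>) = N"
    proof (intro equalityI subsetI)
      fix p assume "p \<in> neg_part n (\<sigma>, \<kappa>)"
      then obtain i where i: "p = (i, \<sigma> i)" "i \<in> {1..n}" "\<kappa> (\<sigma> i) = 1" by auto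
      then have "i \<notin> A" using \<sigma>A(2) by fastforce
      then obtain j where "(i, j) \<in> N" using AN(1) i(2) by blast
      then show "p \<in> N" using \<sigma>N(1) i(1) by simp
    next
      fix p assume "p \<in> N"
      moreover obtain i j where "p = (i, j)" by (cases p)
      ultimately show "p \<in> neg_part n (\<sigma>, \<kappa>)" using \<sigma>N[of i j] AN(2)[of i j] by simp
    qed
    have pos: "pos_part n (\<sigma>, \<kappa>) = (\<lambda>i. (i, jj i)) ` A"
    proof (intro equalityI subsetI)
      fix p assume "p \<in> pos_part n (\<sigma>, \<kappa>)"
      then obtain i where i: "p = (i, \<sigma> i)" "i \<in> {1..n}" "\<kappa> (\<sigma> i) = 0" by auto
      then have "i \<in> A" using AN(1)[OF i(2)] \<sigma>N(2) by fastforce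
      then show "p \<in> (\<lambda>i. (i, jj i)) ` A" using \<sigma>A(3) i(1) by simp
    next
      fix p assume "p \<in> (\<lambda>i. (i, jj i)) ` A"
      then obtain i where "i \<in> A" "p = (i, jj i)" by blast
      then show "p \<in> pos_part n (\<sigma>, \<kappa>)" using \<sigma>A[of i] AN(3)[of i] by auto
    qed
    have "(\<Sum>v\<in>N. Poly_Mapping.single v 1) + (\<Sum>v\<in>R. Poly_Mapping.single v 2) = m"
    proof (rule poly_mapping_eqI)
      fix v
      have "Poly_Mapping.lookup m v = 0 \<or> Poly_Mapping.lookup m v = 1 \<or> Poly_Mapping.lookup m v = 2" using le2[of v] by auto
      then show "Poly_Mapping.lookup ((\<Sum>v\<in>N. Poly_Mapping.single v 1) + (\<Sum>v\<in>R. Poly_Mapping.single v 2)) v = Poly_Mapping.lookup m v"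
        using fin by (auto simp: lookup_add lookup_sum lookup_single when_def N_def R_def)
    qed
    then have "signed_mon n (\<sigma>, \<kappa>) = pmono m"
      unfolding signed_mon_eq neg pos jj(2) by simp
    with w show ?thesis by blast
  qed auto
qed

section \<open>Normal forms\<close>

definition signed_exponent :: "nat \<Rightarrow> signed_perm \<Rightarrow> mon" where
  "signed_exponent n w =
    (\<Sum>v\<in>neg_part n w. Poly_Mapping.single v 1) + (\<Sum>v\<in>shadow_set (pos_part n w). Poly_Mapping.single v 2)"

lemma signed_mon_pmono: "signed_mon n w = pmono (signed_exponent n w)"
  unfolding signed_exponent_def by (rule signed_mon_eq)

lemma signed_exponent_keys:
  assumes "w \<in> signed_perms n"
  shows "Poly_Mapping.keys (signed_exponent n w) \<subseteq> grid n"
proof -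
  obtain \<sigma> \<kappa> where w: "w = (\<sigma>, \<kappa>)" by (cases w)
  have "\<sigma> permutes {1..n}" using assms by (simp add: w signed_perms_def)
  then have \<sigma>: "\<sigma> i \<in> {1..n}" if "i \<in> {1..n}" for i
    using permutes_in_image[of \<sigma> "{1..n}" i] that by blast
  have neg: "neg_part n w \<subseteq> grid n" and pos: "pos_part n w \<subseteq> grid n"
    using \<sigma> unfolding w grid_def neg_part.simps pos_part.simps by blast+
  have "finite (grid n)" by (simp add: grid_def)
  with pos have "finite (pos_part n w)" using finite_subset by blast
  moreover have "inj_on fst (pos_part n w)" by (auto simp: w inj_on_def)
  ultimately have "shadow_set (pos_part n w) \<subseteq> grid n"
    using shadow_set_subset[of "pos_part n w"] pos unfolding grid_def by fastforce
  with neg show ?thesis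
    unfolding signed_exponent_def keys_plus_mon
    using keys_sum[of "\<lambda>v. Poly_Mapping.single v (1 :: nat)" "neg_part n w"]
      keys_sum[of "\<lambda>v. Poly_Mapping.single v (2 :: nat)" "shadow_set (pos_part n w)"] by fastforce
qed

lemma signed_mon_in_poly_ring: "w \<in> signed_perms n \<Longrightarrow> signed_mon n w \<in> carrier (poly_ring n)"
  by (simp add: signed_mon_pmono signed_exponent_keys)

lemma finite_signed_perms: "finite (signed_perms n)"
  unfolding signed_perms_def
  by (intro finite_cartesian_product finite_permutations finite_PiE) auto

text \<open>Coefficients are indexed by signed permutations and not by monomials, so that uniqueness
  of the coefficients includes that the monomials are distinct.\<close>

definition signed_comb :: "nat \<Rightarrow> (signed_perm \<Rightarrow> complex) \<Rightarrow> cpoly" where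
  "signed_comb n c = (\<Sum>w\<in>signed_perms n. pconst (c w) * signed_mon n w)"

lemma signed_comb_add: "signed_comb n (\<lambda>w. c w + c' w) = signed_comb n c + signed_comb n c'"
  by (simp add: signed_comb_def distrib_right sum.distrib)

lemma signed_comb_diff: "signed_comb n (\<lambda>w. c w - c' w) = signed_comb n c - signed_comb n c'"
  by (simp add: signed_comb_def left_diff_distrib sum_subtractf)

lemma pconst_sum: "pconst (sum f X) = (\<Sum>x\<in>X. pconst (f x))"
  by (induction X rule: infinite_finite_induct) auto

lemma signed_comb_sum:
  "signed_comb n (\<lambda>w. \<Sum>x\<in>X. a x * c x w) = (\<Sum>x\<in>X. pconst (a x) * signed_comb n (c x))"
  unfolding signed_comb_def pconst_sum sum_distrib_right sum_distrib_left
  by (subst sum.swap) (simp flip: pconst_mult add: mult.assoc)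

lemma signed_comb_single:
  "w \<in> signed_perms n \<Longrightarrow> signed_comb n (\<lambda>w'. if w' = w then 1 else 0) = signed_mon n w"
proof -
  assume w: "w \<in> signed_perms n"
  have "signed_comb n (\<lambda>w'. if w' = w then 1 else 0) =
      (\<Sum>w'\<in>signed_perms n. if w' = w then signed_mon n w' else 0)"
    unfolding signed_comb_def by (intro sum.cong) auto
  then show ?thesis using w finite_signed_perms by simp
qed

lemma homog_part_signed_comb:
  "homog_part d (signed_comb n c) =
    signed_comb n (\<lambda>w. if mon_degree (signed_exponent n w) = d then c w else 0)"
  unfolding signed_comb_def homog_part_sum
  by (intro sum.cong) (auto simp: homog_part_pconst_mult signed_mon_pmono homog_part_pmono)

text \<open>Reductions preserve the degree, so this finiteness makes them terminate: the number of
  smaller monomials of the same degree can serve as the induction measure.\<close>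

lemma finite_monomials_of_degree: "finite {m. Poly_Mapping.keys m \<subseteq> grid n \<and> mon_degree m = d}"
proof (rule finite_imageD)
  have "Poly_Mapping.lookup m v \<le> mon_degree m" for m v
    by (cases "v \<in> Poly_Mapping.keys m") (auto simp: mon_degree_def in_keys_iff intro: member_le_sum)
  then have "Poly_Mapping.lookup ` {m. Poly_Mapping.keys m \<subseteq> grid n \<and> mon_degree m = d} \<subseteq>
      {f. \<forall>v. (v \<in> grid n \<longrightarrow> f v \<in> {..d}) \<and> (v \<notin> grid n \<longrightarrow> f v = 0)}"
    by (fastforce simp: in_keys_iff)
  moreover have "finite \<dots>"
    by (rule finite_set_of_finite_funs) (simp_all add: grid_def)
  ultimately show "finite (Poly_Mapping.lookup ` {m. Poly_Mapping.keys m \<subseteq> grid n \<and> mon_degree m = d})"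
    by (rule finite_subset)
qed (simp add: inj_on_def lookup_inject)

text \<open>The reduction polynomial expresses \<open>m\<close> through smaller monomials of the
  same degree, to which induction applies. The bound on the supported exponents is recorded because
  it later isolates the coefficient of a single signed permutation at a leading monomial.\<close>

lemma monomial_normal_form:
  assumes "Poly_Mapping.keys m \<subseteq> grid n"
  shows "\<exists>c. pmono m - signed_comb n c \<in> I_B n \<and>
    (\<forall>w. c w \<noteq> 0 \<longrightarrow> mon_degree (signed_exponent n w) = mon_degree m \<and>
      (signed_exponent n w = m \<or> toeplitz_less (signed_exponent n w) m))"
  using assms
proof (induction "card {m'. Poly_Mapping.keys m' \<subseteq> grid n \<and> mon_degree m' = mon_degree m \<and> toeplitz_less m' m}"
    arbitrary: m rule: less_induct)
  case less
  from signed_mon_dichotomy[OF less.prems] show ?case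
  proof (elim disjE bexE conjE)
    fix w assume w: "w \<in> signed_perms n" "signed_mon n w = pmono m"
    then have "signed_exponent n w = m" by (simp add: signed_mon_pmono inj_pmono)
    with w show ?thesis
      by (intro exI[of _ "\<lambda>w'. if w' = w then 1 else 0"]) (auto simp: signed_comb_single I_B_zero)
  next
    fix F assume F: "F \<in> I_B n" "Poly_Mapping.lookup F m = 1"
      and low: "\<forall>m'\<in>Poly_Mapping.keys F. m' \<noteq> m \<longrightarrow> toeplitz_less m' m \<and> mon_degree m' = mon_degree m"
    define K where "K = Poly_Mapping.keys F - {m}"
    have "\<exists>c. pmono m' - signed_comb n c \<in> I_B n \<and>
        (\<forall>w. c w \<noteq> 0 \<longrightarrow> mon_degree (signed_exponent n w) = mon_degree m' \<and>
          (signed_exponent n w = m' \<or> toeplitz_less (signed_exponent n w) m'))" if m': "m' \<in> K" for m'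
    proof (rule less.hyps)
      have l: "toeplitz_less m' m" "mon_degree m' = mon_degree m" using low m' by (auto simp: K_def)
      show k: "Poly_Mapping.keys m' \<subseteq> grid n"
        using I_B_subset[OF F(1)] m' by (auto simp: mem_poly_ring_iff K_def)
      let ?X = "\<lambda>m. {m'. Poly_Mapping.keys m' \<subseteq> grid n \<and> mon_degree m' = mon_degree m \<and> toeplitz_less m' m}"
      show "card (?X m') < card (?X m)"
      proof (rule psubset_card_mono)
        show "finite (?X m)"
          by (rule finite_subset[OF _ finite_monomials_of_degree[of n "mon_degree m"]]) auto
        have "m' \<in> ?X m" "m' \<notin> ?X m'" using l k toeplitz_less_irrefl by auto
        moreover have "?X m' \<subseteq> ?X m" using l toeplitz_less_trans by auto
        ultimately show "?X m' \<subset> ?X m" by blast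
      qed
    qed
    then obtain C where C: "\<And>m'. m' \<in> K \<Longrightarrow> pmono m' - signed_comb n (C m') \<in> I_B n"
      "\<And>m' w. m' \<in> K \<Longrightarrow> C m' w \<noteq> 0 \<Longrightarrow> mon_degree (signed_exponent n w) = mon_degree m' \<and>
          (signed_exponent n w = m' \<or> toeplitz_less (signed_exponent n w) m')" by metis
    define c where "c w = (\<Sum>m'\<in>K. (- Poly_Mapping.lookup F m') * C m' w)" for w
    have "F = (\<Sum>m'\<in>insert m K. pconst (Poly_Mapping.lookup F m') * pmono m')"
      by (rule cpoly_expand) (auto simp: K_def)
    also have "\<dots> = pmono m + (\<Sum>m'\<in>K. pconst (Poly_Mapping.lookup F m') * pmono m')"
      using F(2) by (subst sum.insert) (auto simp: K_def)
    finally have "F = pmono m + (\<Sum>m'\<in>K. pconst (Poly_Mapping.lookup F m') * pmono m')" .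
    from eq_diff_eq[THEN iffD2, OF this[symmetric]]
    have Fm: "pmono m = F - (\<Sum>m'\<in>K. pconst (Poly_Mapping.lookup F m') * pmono m')" .
    have cc: "signed_comb n c = - (\<Sum>m'\<in>K. pconst (Poly_Mapping.lookup F m') * signed_comb n (C m'))"
      unfolding c_def[abs_def] signed_comb_sum by (simp add: sum_negf)
    have "pmono m - signed_comb n c =
        F - (\<Sum>m'\<in>K. pconst (Poly_Mapping.lookup F m') * (pmono m' - signed_comb n (C m')))"
      unfolding cc by (subst Fm) (simp add: right_diff_distrib sum_subtractf)
    also have "\<dots> \<in> I_B n"
      by (intro I_B_diff F(1) I_B_sum I_B_mult C(1) pconst_in_poly_ring)
    finally have "pmono m - signed_comb n c \<in> I_B n" .
    moreover have "mon_degree (signed_exponent n w) = mon_degree m \<and>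
        (signed_exponent n w = m \<or> toeplitz_less (signed_exponent n w) m)" if "c w \<noteq> 0" for w
    proof -
      have "\<exists>m'\<in>K. C m' w \<noteq> 0"
      proof (rule ccontr)
        assume "\<not> ?thesis"
        then have "c w = 0" unfolding c_def by (intro sum.neutral) auto
        with that show False by simp
      qed
      then obtain m' where m': "m' \<in> K" "C m' w \<noteq> 0" by blast
      then have "toeplitz_less m' m" "mon_degree m' = mon_degree m" using low by (auto simp: K_def)
      with C(2)[OF m'] show ?thesis using toeplitz_less_trans by auto
    qed
    ultimately show ?thesis by blast
  qed
qed

lemma homogeneous_normal_form:
  assumes f: "f \<in> carrier (poly_ring n)" and deg: "\<And>m. m \<in> Poly_Mapping.keys f \<Longrightarrow> mon_degree m = d"
  shows "\<exists>c. f - signed_comb n c \<in> I_B n \<and>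
    (\<forall>w. c w \<noteq> 0 \<longrightarrow> mon_degree (signed_exponent n w) = d)"
proof -
  have "\<exists>c. pmono m - signed_comb n c \<in> I_B n \<and>
      (\<forall>w. c w \<noteq> 0 \<longrightarrow> mon_degree (signed_exponent n w) = d)" if "m \<in> Poly_Mapping.keys f" for m
    using monomial_normal_form[of m n] deg[OF that] f that by (auto simp: mem_poly_ring_iff)
  then obtain C where C: "\<And>m. m \<in> Poly_Mapping.keys f \<Longrightarrow> pmono m - signed_comb n (C m) \<in> I_B n"
    "\<And>m w. m \<in> Poly_Mapping.keys f \<Longrightarrow> C m w \<noteq> 0 \<Longrightarrow> mon_degree (signed_exponent n w) = d" by metis
  define c where "c w = (\<Sum>m\<in>Poly_Mapping.keys f. Poly_Mapping.lookup f m * C m w)" for w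
  have "signed_comb n c = (\<Sum>m\<in>Poly_Mapping.keys f. pconst (Poly_Mapping.lookup f m) * signed_comb n (C m))"
    unfolding c_def[abs_def] by (rule signed_comb_sum)
  then have "f - signed_comb n c = (\<Sum>m\<in>Poly_Mapping.keys f. pconst (Poly_Mapping.lookup f m) * (pmono m - signed_comb n (C m)))"
    by (subst cpoly_expand[of "Poly_Mapping.keys f" f]) (simp_all add: right_diff_distrib sum_subtractf)
  also have "\<dots> \<in> I_B n" by (intro I_B_sum I_B_mult C(1) pconst_in_poly_ring)
  finally have "f - signed_comb n c \<in> I_B n" .
  moreover have "mon_degree (signed_exponent n w) = d" if "c w \<noteq> 0" for w
  proof -
    have "\<exists>m\<in>Poly_Mapping.keys f. C m w \<noteq> 0"
    proof (rule ccontr)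
      assume "\<not> ?thesis"
      then have "c w = 0" unfolding c_def by (intro sum.neutral) auto
      with that show False by simp
    qed
    then show ?thesis using C(2) by blast
  qed
  ultimately show ?thesis by blast
qed

section \<open>Lifting reductions from \<open>I_B n\<close> to \<open>J_B n\<close>\<close>

lemma J_B_generators_subset:
  "{var i j ^ 3 - var i j | i j. i \<in> {1..n} \<and> j \<in> {1..n}} \<union> rook_products n \<union>
    {(\<Sum>j=1..n. var i j ^ 2) - 1 | i. i \<in> {1..n}} \<union>
    {(\<Sum>i=1..n. var i j ^ 2) - 1 | j. j \<in> {1..n}} \<subseteq> carrier (poly_ring n)"
  by (auto simp: rook_products_def grid_def intro!: poly_ring_closed)

lemma J_B_ideal: "ideal (J_B n) (poly_ring n)"
  unfolding J_B_def by (rule genideal_poly_ideal[OF J_B_generators_subset])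

lemmas J_B_subset = ideal_subset[OF J_B_ideal]
  and J_B_zero = ideal_zero[OF J_B_ideal]
  and J_B_add = ideal_add[OF J_B_ideal]
  and J_B_mult = ideal_mult[OF J_B_ideal]
  and J_B_diff = ideal_diff[OF J_B_ideal]

text \<open>The generators correspond: a cube and its deformation differ by a variable, a line sum
  and its deformation by 1, and the rook products are shared.\<close>

lemma I_B_generator_deform:
  assumes "s \<in> {var i j ^ 3 | i j. i \<in> {1..n} \<and> j \<in> {1..n}} \<union> rook_products n \<union>
    {(\<Sum>j=1..n. var i j ^ 2) | i. i \<in> {1..n}} \<union> {(\<Sum>i=1..n. var i j ^ 2) | j. j \<in> {1..n}}"
  shows "\<exists>h\<in>J_B n. \<exists>k. s \<noteq> 0 \<and> (\<forall>m\<in>Poly_Mapping.keys s. mon_degree m = k) \<and> s - h \<in> degree_below n k"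
proof -
  note mem = genideal_poly_self[OF J_B_generators_subset, folded J_B_def]
  \<comment> \<open>Nonvanishing is checked at the matrix with all entries 1, where the value of a
    line sum is \<open>n\<close>; the line itself shows that \<open>n\<close> is positive.\<close>
  have nz: "s \<noteq> 0" if "peval (\<lambda>_. 1) s \<noteq> 0" using that by auto
  have sum_keys: "mon_degree m = 2" if "m \<in> Poly_Mapping.keys (\<Sum>x\<in>X. var (f x) (g x) ^ 2)"
    for m f g and X :: "nat set"
    using that keys_sum[of "\<lambda>x. var (f x) (g x) ^ 2" X] by (auto simp: var_power)
  have one: "1 \<in> degree_below n 2"
    by (auto simp: degree_below_def simp flip: pmono_zero)
  have zero: "0 \<in> degree_below n 2" by (simp add: degree_below_def)
  from assms show ?thesis
  proof (elim UnE)
    assume "s \<in> {var i j ^ 3 | i j. i \<in> {1..n} \<and> j \<in> {1..n}}"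
    then obtain i j where s: "s = var i j ^ 3" and ij: "i \<in> {1..n}" "j \<in> {1..n}" by blast
    have "var i j ^ 3 - var i j \<in> J_B n" using ij by (intro mem) blast
    moreover have "s \<noteq> 0" by (rule nz) (simp add: s)
    moreover have "var i j \<in> degree_below n 3"
      using ij by (simp add: degree_below_def var_def grid_def)
    ultimately show ?thesis
      by (intro bexI[of _ "var i j ^ 3 - var i j"] exI[of _ 3]) (auto simp: s var_power)
  next
    assume s: "s \<in> rook_products n"
    then have "s \<in> J_B n" by (intro mem) blast
    moreover obtain i j i' j' where s': "s = var i j * var i' j'"
      using s unfolding rook_products_def by blast
    have "peval (\<lambda>_. 1) s \<noteq> 0" by (simp add: s')
    moreover have "\<forall>m\<in>Poly_Mapping.keys s. mon_degree m = 2" by (simp add: s' var_def pmono_mult)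
    ultimately show ?thesis using nz zero by (intro bexI[of _ s] exI[of _ 2]) auto
  next
    assume "s \<in> {(\<Sum>j=1..n. var i j ^ 2) | i. i \<in> {1..n}}"
    then obtain i where s: "s = (\<Sum>j=1..n. var i j ^ 2)" and i: "i \<in> {1..n}" by blast
    have "(\<Sum>j=1..n. var i j ^ 2) - 1 \<in> J_B n" using i by (intro mem) blast
    moreover have "s \<noteq> 0" using i by (intro nz) (simp add: s)
    ultimately show ?thesis
      using one sum_keys[of _ "\<lambda>_. i" "\<lambda>j. j" "{1..n}"]
      by (intro bexI[of _ "(\<Sum>j=1..n. var i j ^ 2) - 1"] exI[of _ 2]) (auto simp: s)
  next
    assume "s \<in> {(\<Sum>i=1..n. var i j ^ 2) | j. j \<in> {1..n}}"
    then obtain j where s: "s = (\<Sum>i=1..n. var i j ^ 2)" and j: "j \<in> {1..n}" by blast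
    have "(\<Sum>i=1..n. var i j ^ 2) - 1 \<in> J_B n" using j by (intro mem) blast
    moreover have "s \<noteq> 0" using j by (intro nz) (simp add: s)
    ultimately show ?thesis
      using one sum_keys[of _ "\<lambda>i. i" "\<lambda>_. j" "{1..n}"]
      by (intro bexI[of _ "(\<Sum>i=1..n. var i j ^ 2) - 1"] exI[of _ 2]) (auto simp: s)
  qed
qed

text \<open>The generators are homogeneous and have lifts to \<open>J_B n\<close>; both properties
  pass to sums and to multiples by terms. The induction has to treat all \<open>d\<close> at once,
  because a monomial factor shifts the degree.\<close>

lemma I_B_homog_part:
  assumes "g \<in> I_B n"
  shows "homog_part d g \<in> I_B n \<and> (\<exists>h\<in>J_B n. homog_part d g - h \<in> degree_below n d)"
proof -
  have zero: "0 \<in> degree_below n d" for d by (simp add: degree_below_def)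
  have "\<forall>d. homog_part d g \<in> I_B n \<and> (\<exists>h\<in>J_B n. homog_part d g - h \<in> degree_below n d)"
    using I_B_generators_subset assms[unfolded I_B_def]
  proof (induction g rule: genideal_poly_induct)
    case (gen s)
    obtain h k where h: "h \<in> J_B n" "\<And>m. m \<in> Poly_Mapping.keys s \<Longrightarrow> mon_degree m = k" "s - h \<in> degree_below n k"
      using I_B_generator_deform[OF gen] by blast
    have sI: "s \<in> I_B n" unfolding I_B_def by (rule genideal_poly_self[OF I_B_generators_subset gen])
    show ?case
    proof
      fix d
      show "homog_part d s \<in> I_B n \<and> (\<exists>h\<in>J_B n. homog_part d s - h \<in> degree_below n d)"
      proof (cases "d = k")
        case True
        then have "homog_part d s = s" using h(2) by (intro homog_part_eq_self) auto
        then show ?thesis using h sI True by auto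
      next
        case False
        then have "homog_part d s = 0" using h(2) by (intro homog_part_eq_zero) auto
        then show ?thesis using I_B_zero J_B_zero zero by (auto intro!: bexI[of _ 0])
      qed
    qed
  next
    case zero
    then show ?case using I_B_zero J_B_zero \<open>0 \<in> degree_below n _\<close> by (auto intro!: bexI[of _ 0])
  next
    case (add f g)
    show ?case
    proof
      fix d
      obtain h h' where h: "h \<in> J_B n" "h' \<in> J_B n"
        "homog_part d f - h \<in> degree_below n d" "homog_part d g - h' \<in> degree_below n d"
        using add by blast
      have "homog_part d (f + g) - (h + h') \<in> degree_below n d"
        using degree_below_add[OF h(3,4)] by (simp add: homog_part_add algebra_simps)
      then show "homog_part d (f + g) \<in> I_B n \<and>
          (\<exists>h\<in>J_B n. homog_part d (f + g) - h \<in> degree_below n d)"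
        using add J_B_add[OF h(1,2)] by (auto simp: homog_part_add intro: I_B_add)
    qed
  next
    case (monom c m f)
    show ?case
    proof
      fix d
      have eq: "homog_part d (pconst c * pmono m * f) =
          (if mon_degree m \<le> d then pconst c * pmono m * homog_part (d - mon_degree m) f else 0)"
        by (simp add: mult.assoc homog_part_pconst_mult homog_part_pmono_mult)
      have ring: "pconst c * pmono m \<in> carrier (poly_ring n)" using monom(1) by (intro poly_ring_closed) auto
      show "homog_part d (pconst c * pmono m * f) \<in> I_B n \<and>
          (\<exists>h\<in>J_B n. homog_part d (pconst c * pmono m * f) - h \<in> degree_below n d)"
      proof (cases "mon_degree m \<le> d")
        case True
        obtain h where h: "h \<in> J_B n" "homog_part (d - mon_degree m) f - h \<in> degree_below n (d - mon_degree m)"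
          using monom by blast
        have "homog_part d (pconst c * pmono m * f) - pconst c * pmono m * h \<in> degree_below n d"
          using degree_below_mult[OF monom(1) h(2), of c] True by (simp add: eq right_diff_distrib)
        moreover have "homog_part d (pconst c * pmono m * f) \<in> I_B n"
          using monom ring True by (auto simp: eq intro!: I_B_mult)
        ultimately show ?thesis using J_B_mult[OF ring h(1)] by blast
      next
        case False
        then show ?thesis using I_B_zero J_B_zero zero by (auto simp: eq intro!: bexI[of _ 0])
      qed
    qed
  qed
  then show ?thesis by blast
qed

text \<open>The part of highest permitted degree is reduced modulo \<open>I_B n\<close>, and the
  reduction is imitated by an element \<open>h\<close> of \<open>J_B n\<close>. The error has
  smaller degree and is handled by induction. The degree bound on the support keeps the
  contributions of different degrees apart in later comparisons.\<close>

lemma deformed_normal_form: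
  assumes "f \<in> degree_below n d"
  shows "\<exists>c. f - signed_comb n c \<in> J_B n \<and>
    (\<forall>w. c w \<noteq> 0 \<longrightarrow> mon_degree (signed_exponent n w) < d)"
  using assms
proof (induction d arbitrary: f)
  case 0
  then have "f = 0" by (auto simp: degree_below_def simp flip: keys_eq_empty)
  then show ?case by (intro exI[of _ "\<lambda>_. 0"]) (simp add: signed_comb_def J_B_zero)
next
  case (Suc d)
  then have f: "f \<in> carrier (poly_ring n)" by (simp add: degree_below_def)
  obtain c where c: "homog_part d f - signed_comb n c \<in> I_B n"
    "\<And>w. c w \<noteq> 0 \<Longrightarrow> mon_degree (signed_exponent n w) = d"
    using homogeneous_normal_form[of "homog_part d f" n d] f
    by (auto simp: keys_homog_part homog_part_in_poly_ring)
  \<comment> \<open>Both terms are homogeneous of degree \<open>d\<close>, so the lift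
    \<open>h\<close> applies to the whole difference.\<close>
  have "homog_part d (homog_part d f - signed_comb n c) = homog_part d f - signed_comb n c"
  proof -
    have "(\<lambda>w. if mon_degree (signed_exponent n w) = d then c w else 0) = c" by (intro ext) (metis c(2))
    moreover have "homog_part d (homog_part d f) = homog_part d f" by (rule poly_mapping_eqI) simp
    ultimately show ?thesis unfolding homog_part_diff homog_part_signed_comb by simp
  qed
  then obtain h where h: "h \<in> J_B n" "homog_part d f - signed_comb n c - h \<in> degree_below n d"
    using I_B_homog_part[OF c(1), of d] by auto
  have "f - homog_part d f \<in> degree_below n d"
    using Suc.prems homog_part_in_poly_ring[OF f, of d]
    by (auto simp: degree_below_def in_keys_iff lookup_minus less_Suc_eq intro: poly_ring_closed split: if_splits)
  from degree_below_add[OF this h(2)] have "f - signed_comb n c - h \<in> degree_below n d"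
    by (simp add: algebra_simps)
  then obtain c' where c': "f - signed_comb n c - h - signed_comb n c' \<in> J_B n"
    "\<And>w. c' w \<noteq> 0 \<Longrightarrow> mon_degree (signed_exponent n w) < d"
    using Suc.IH by blast
  have "f - signed_comb n (\<lambda>w. c w + c' w) \<in> J_B n"
    using J_B_add[OF c'(1) h(1)] by (simp add: signed_comb_add algebra_simps)
  moreover have "mon_degree (signed_exponent n w) < Suc d" if "c w + c' w \<noteq> 0" for w
    using that c(2)[of w] c'(2)[of w] by (cases "c w = 0") auto
  ultimately show ?case by blast
qed

section \<open>Functions on the signed permutation matrices\<close>

lemma vanishing_ideal_ideal: "ideal (vanishing_ideal n Z) (poly_ring n)"
  by (rule poly_idealI) (auto simp: vanishing_ideal_def intro: poly_ring_closed)

lemma signed_perm_matricesD: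
  assumes "A \<in> signed_perm_matrices n"
  shows "i \<in> {1..n} \<Longrightarrow> \<exists>!j. j \<in> {1..n} \<and> A (i, j) \<noteq> 0"
    and "j \<in> {1..n} \<Longrightarrow> \<exists>!i. i \<in> {1..n} \<and> A (i, j) \<noteq> 0"
    and "v \<in> grid n \<Longrightarrow> A v = 0 \<or> A v = 1 \<or> A v = -1"
    and "A \<in> extensional (grid n)"
proof -
  note A = assms[unfolded signed_perm_matrices_def mem_Collect_eq]
  note A = A[THEN conjunct1] A[THEN conjunct2, THEN conjunct1]
    A[THEN conjunct2, THEN conjunct2, THEN conjunct1] A[THEN conjunct2, THEN conjunct2, THEN conjunct2]
  show "\<exists>!j. j \<in> {1..n} \<and> A (i, j) \<noteq> 0" if "i \<in> {1..n}" using A(2) that by (rule bspec)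
  show "\<exists>!i. i \<in> {1..n} \<and> A (i, j) \<noteq> 0" if "j \<in> {1..n}" using A(3) that by (rule bspec)
  show "A v = 0 \<or> A v = 1 \<or> A v = -1" if "v \<in> grid n" using A(4) that by metis
  show "A \<in> extensional (grid n)" using A(1) by (simp add: PiE_def)
qed

lemma signed_perm_matrix_values:
  assumes A: "A \<in> signed_perm_matrices n" and ij: "i \<in> {1..n}" "j \<in> {1..n}"
  shows "A (i, j) ^ 3 = A (i, j)"
    and "j' \<in> {1..n} \<Longrightarrow> j \<noteq> j' \<Longrightarrow> A (i, j) * A (i, j') = 0"
    and "i' \<in> {1..n} \<Longrightarrow> i \<noteq> i' \<Longrightarrow> A (i, j) * A (i', j) = 0"
    and "(\<Sum>j=1..n. A (i, j) ^ 2) = 1"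
    and "(\<Sum>i=1..n. A (i, j) ^ 2) = 1"
proof -
  note row = signed_perm_matricesD(1)[OF A ij(1)] and col = signed_perm_matricesD(2)[OF A ij(2)]
  have val: "A (i, j) = 0 \<or> A (i, j) = 1 \<or> A (i, j) = -1" if "i \<in> {1..n}" "j \<in> {1..n}" for i j
    using signed_perm_matricesD(3)[OF A, of "(i, j)"] that by (simp add: grid_def)
  have sq: "A (i, j) ^ 2 = (if A (i, j) = 0 then 0 else 1)" if "i \<in> {1..n}" "j \<in> {1..n}" for i j
    using val[OF that] by auto
  show "A (i, j) ^ 3 = A (i, j)" using val[OF ij] by auto
  show "A (i, j) * A (i, j') = 0" if "j' \<in> {1..n}" "j \<noteq> j'" using row ij that by auto
  show "A (i, j) * A (i', j) = 0" if "i' \<in> {1..n}" "i \<noteq> i'" using col ij that by auto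
  obtain j0 where j0: "j0 \<in> {1..n}" "\<And>k. k \<in> {1..n} \<Longrightarrow> A (i, k) \<noteq> 0 \<longleftrightarrow> k = j0" using row by metis
  have "(\<Sum>k=1..n. A (i, k) ^ 2) = (\<Sum>k=1..n. if k = j0 then 1 else 0)"
    by (intro sum.cong refl) (use sq[OF ij(1)] j0(2) in auto)
  then show "(\<Sum>j=1..n. A (i, j) ^ 2) = 1" using j0(1) by simp
  obtain i0 where i0: "i0 \<in> {1..n}" "\<And>k. k \<in> {1..n} \<Longrightarrow> A (k, j) \<noteq> 0 \<longleftrightarrow> k = i0" using col by metis
  have "(\<Sum>k=1..n. A (k, j) ^ 2) = (\<Sum>k=1..n. if k = i0 then 1 else 0)"
    by (intro sum.cong refl) (use sq[OF _ ij(2)] i0(2) in auto)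
  then show "(\<Sum>i=1..n. A (i, j) ^ 2) = 1" using i0(1) by simp
qed

lemma J_B_vanishes: "J_B n \<subseteq> vanishing_ideal n (signed_perm_matrices n)"
  unfolding J_B_def
proof (rule genideal_poly_minimal[OF vanishing_ideal_ideal])
  let ?G = "{var i j ^ 3 - var i j | i j. i \<in> {1..n} \<and> j \<in> {1..n}} \<union> rook_products n \<union>
    {(\<Sum>j=1..n. var i j ^ 2) - 1 | i. i \<in> {1..n}} \<union> {(\<Sum>i=1..n. var i j ^ 2) - 1 | j. j \<in> {1..n}}"
  have "peval A s = 0" if A: "A \<in> signed_perm_matrices n" and s: "s \<in> ?G" for A s
    using s
  proof (elim UnE)
    assume "s \<in> {var i j ^ 3 - var i j | i j. i \<in> {1..n} \<and> j \<in> {1..n}}"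
    then show ?thesis using signed_perm_matrix_values(1)[OF A] by auto
  next
    assume "s \<in> rook_products n"
    then show ?thesis unfolding rook_products_def
      using signed_perm_matrix_values(2,3)[OF A] by (elim UnE CollectE exE conjE) simp_all
  next
    assume "s \<in> {(\<Sum>j=1..n. var i j ^ 2) - 1 | i. i \<in> {1..n}}"
    then obtain i where "s = (\<Sum>j=1..n. var i j ^ 2) - 1" "i \<in> {1..n}" by blast
    then show ?thesis using signed_perm_matrix_values(4)[OF A, of i i] by simp
  next
    assume "s \<in> {(\<Sum>i=1..n. var i j ^ 2) - 1 | j. j \<in> {1..n}}"
    then obtain j where "s = (\<Sum>i=1..n. var i j ^ 2) - 1" "j \<in> {1..n}" by blast
    then show ?thesis using signed_perm_matrix_values(5)[OF A, of j j] by simp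
  qed
  moreover have "s \<in> carrier (poly_ring n)" if "s \<in> ?G" for s
    using that by (rule subsetD[OF J_B_generators_subset])
  ultimately show "?G \<subseteq> vanishing_ideal n (signed_perm_matrices n)"
    unfolding vanishing_ideal_def by (intro subsetI CollectI conjI ballI)
qed

section \<open>Counting and interpolating on the matrices\<close>

lemma finite_signed_perm_matrices: "finite (signed_perm_matrices n)"
proof (rule finite_subset)
  show "signed_perm_matrices n \<subseteq> grid n \<rightarrow>\<^sub>E {0, 1, -1}"
  proof (intro subsetI PiE_I)
    fix A v assume A: "A \<in> signed_perm_matrices n"
    show "A v \<in> {0, 1, -1}" if "v \<in> grid n" using signed_perm_matricesD(3)[OF A that] by simp
    show "A v = undefined" if "v \<notin> grid n"
      using signed_perm_matricesD(4)[OF A] that by (rule extensional_arb)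
  qed
  show "finite (grid n \<rightarrow>\<^sub>E {0 :: complex, 1, -1})"
    by (intro finite_PiE) (auto simp: grid_def)
qed

text \<open>This is the direction consumed by the dimension count: there are at least as many points
  as monomials. The map sends a signed permutation to its matrix, with the sign read off at the
  column.\<close>

lemma card_signed_perms_le: "card (signed_perms n) \<le> card (signed_perm_matrices n)"
proof (rule card_inj_on_le[OF _ _ finite_signed_perm_matrices])
  define M :: "signed_perm \<Rightarrow> cell \<Rightarrow> complex" where
    "M = (\<lambda>(\<sigma>, \<kappa>). restrict (\<lambda>(i, j). if \<sigma> i = j then (if \<kappa> j = 1 then -1 else 1) else 0) (grid n))"
  have M: "M (\<sigma>, \<kappa>) (i, j) = (if \<sigma> i = j then (if \<kappa> j = 1 then -1 else 1) else 0)"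
    if "i \<in> {1..n}" "j \<in> {1..n}" for \<sigma> \<kappa> i j
    using that by (simp add: M_def grid_def)
  show "inj_on M (signed_perms n)"
  proof (rule inj_onI)
    fix w w' assume w: "w \<in> signed_perms n" "w' \<in> signed_perms n" and eq: "M w = M w'"
    obtain \<sigma> \<kappa> \<sigma>' \<kappa>' where ww: "w = (\<sigma>, \<kappa>)" "w' = (\<sigma>', \<kappa>')" by (cases w; cases w')
    have p: "\<sigma> permutes {1..n}" "\<sigma>' permutes {1..n}"
      and k: "\<kappa> \<in> {1..n} \<rightarrow>\<^sub>E {0, 1}" "\<kappa>' \<in> {1..n} \<rightarrow>\<^sub>E {0, 1}"
      using w by (auto simp: ww signed_perms_def)
    have e: "M (\<sigma>, \<kappa>) v = M (\<sigma>', \<kappa>') v" for v using eq by (simp add: ww)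
    have \<sigma>: "\<sigma> i = \<sigma>' i" for i
    proof (cases "i \<in> {1..n}")
      case True
      then have j: "\<sigma> i \<in> {1..n}" using permutes_in_image[OF p(1)] by blast
      show ?thesis using e[of "(i, \<sigma> i)"] unfolding M[OF True j] by (auto split: if_splits)
    next
      case False
      then show ?thesis using p by (simp add: permutes_not_in)
    qed
    have "\<kappa> j = \<kappa>' j" if j: "j \<in> {1..n}" for j
    proof -
      define i where "i = inv_into UNIV \<sigma> j"
      have i: "\<sigma> i = j" using permutes_surj[OF p(1)] by (simp add: i_def surj_f_inv_f)
      then have "i \<in> {1..n}" using permutes_in_image[OF p(1), of i] j by simp
      then have "(\<kappa> j = 1) = (\<kappa>' j = 1)"
        using e[of "(i, j)"] i \<sigma>[of i] M[of i j] j by (auto split: if_splits)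
      moreover have "\<kappa> j \<in> {0, 1}" "\<kappa>' j \<in> {0, 1}" using k j by blast+
      ultimately show ?thesis by auto
    qed
    then have "\<kappa> = \<kappa>'" using k by (intro extensionalityI[of _ "{1..n}"]) (auto simp: PiE_def)
    with \<sigma> show "w = w'" by (auto simp: ww)
  qed
  show "M ` signed_perms n \<subseteq> signed_perm_matrices n"
  proof
    fix A assume "A \<in> M ` signed_perms n"
    then obtain \<sigma> \<kappa> where A: "A = M (\<sigma>, \<kappa>)" and w: "(\<sigma>, \<kappa>) \<in> signed_perms n" by auto
    have p: "\<sigma> permutes {1..n}" using w by (simp add: signed_perms_def)
    have nz: "A (i, j) \<noteq> 0 \<longleftrightarrow> \<sigma> i = j" if "i \<in> {1..n}" "j \<in> {1..n}" for i j
      unfolding A M[OF that] by simp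
    have img: "\<sigma> i \<in> {1..n} \<longleftrightarrow> i \<in> {1..n}" for i using permutes_in_image[OF p] by blast
    have rows: "\<exists>!j. j \<in> {1..n} \<and> A (i, j) \<noteq> 0" if "i \<in> {1..n}" for i
      using nz[OF that] img[of i] that by blast
    have cols: "\<exists>!i. i \<in> {1..n} \<and> A (i, j) \<noteq> 0" if j: "j \<in> {1..n}" for j
    proof -
      obtain i where "\<sigma> i = j" using permutes_surj[OF p] by (metis surjD)
      moreover have "i' = i" if "\<sigma> i' = \<sigma> i" for i'
        using permutes_inj[OF p] that by (simp add: inj_eq)
      ultimately show ?thesis using nz[OF _ j] img j by metis
    qed
    have vals: "A v = 1 \<or> A v = -1" if "v \<in> grid n" "A v \<noteq> 0" for v
      using that M by (auto simp: A grid_def split: if_splits)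
    have ext: "A \<in> grid n \<rightarrow>\<^sub>E UNIV" by (auto simp: A M_def)
    show "A \<in> signed_perm_matrices n"
      unfolding signed_perm_matrices_def
      by (intro CollectI conjI ballI impI) (fact ext | rule rows cols vals, assumption+)+
  qed
qed

text \<open>For an entry \<open>B v\<close> equal to 1 or -1, the polynomial x (x +
  \<open>B v\<close>) / 2 takes the value 1 at \<open>B v\<close> and 0 at the two other admissible
  values. Agreement with \<open>B\<close> on its nonzero positions suffices, since each row of a
  signed permutation matrix has a single nonzero entry.\<close>

lemma signed_perm_matrix_interpolation:
  assumes B: "B \<in> signed_perm_matrices n"
  shows "\<exists>f\<in>carrier (poly_ring n). \<forall>A\<in>signed_perm_matrices n. peval A f = (if A = B then 1 else 0)"
proof -
  define V where "V = {v \<in> grid n. B v \<noteq> 0}"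
  have finV: "finite V" by (simp add: V_def grid_def)
  define f where "f = (\<Prod>(i, j)\<in>V. pconst (1 / 2) * (var i j * (var i j + pconst (B (i, j)))))"
  have "f \<in> carrier (poly_ring n)"
    unfolding f_def by (intro poly_ring_prod_closed) (auto simp: V_def intro!: poly_ring_carrier_closed)
  moreover have "peval A f = (if A = B then 1 else 0)" if A: "A \<in> signed_perm_matrices n" for A
  proof -
    have val: "C v = 0 \<or> C v = 1 \<or> C v = -1" if "C \<in> signed_perm_matrices n" "v \<in> grid n" for C v
      using that by (rule signed_perm_matricesD(3))
    have "peval A f = (\<Prod>v\<in>V. 1 / 2 * (A v * (A v + B v)))"
      unfolding f_def peval_prod by (intro prod.cong) auto
    also have "\<dots> = (\<Prod>v\<in>V. if A v = B v then 1 else 0)"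
    proof (rule prod.cong[OF refl])
      fix v assume "v \<in> V"
      then have "v \<in> grid n" "B v \<noteq> 0" by (auto simp: V_def)
      then show "1 / 2 * (A v * (A v + B v)) = (if A v = B v then 1 else 0)"
        using val[OF A, of v] val[OF B, of v] by auto
    qed
    also have "\<dots> = (if \<forall>v\<in>V. A v = B v then 1 else 0)"
      using finV by (auto simp: prod_zero_iff)
    also have "(\<forall>v\<in>V. A v = B v) \<longleftrightarrow> A = B"
    proof
      assume eq: "\<forall>v\<in>V. A v = B v"
      have "A (i, j) = B (i, j)" if ij: "i \<in> {1..n}" "j \<in> {1..n}" for i j
      proof (cases "B (i, j) = 0")
        case False
        with eq ij show ?thesis by (simp add: V_def grid_def)
      next
        case True
        obtain j0 where j0: "j0 \<in> {1..n}" "B (i, j0) \<noteq> 0"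
          using signed_perm_matricesD(1)[OF B ij(1)] by blast
        then have "A (i, j0) \<noteq> 0" "j \<noteq> j0" using eq ij True by (auto simp: V_def grid_def)
        moreover have "\<exists>!j. j \<in> {1..n} \<and> A (i, j) \<noteq> 0"
          by (rule signed_perm_matricesD(1)[OF A ij(1)])
        ultimately have "A (i, j) = 0" using j0(1) ij(2) by metis
        with True show ?thesis by simp
      qed
      moreover have "A \<in> extensional (grid n)" "B \<in> extensional (grid n)"
        using A B by (blast intro: signed_perm_matricesD(4))+
      ultimately show "A = B" by (intro extensionalityI[of _ "grid n"]) (auto simp: grid_def)
    qed auto
    finally show ?thesis .
  qed
  ultimately show ?thesis by blast
qed

lemma peval_signed_comb:
  "peval A (signed_comb n c) = (\<Sum>w\<in>signed_perms n. c w * peval A (signed_mon n w))"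
  by (simp add: signed_comb_def)

lemma evaluation_normal_form:
  assumes "f \<in> carrier (poly_ring n)"
  shows "\<exists>c. \<forall>A\<in>signed_perm_matrices n. peval A f = peval A (signed_comb n c)"
proof -
  \<comment> \<open>Inserting 0 keeps \<open>Max\<close> meaningful for the zero polynomial.\<close>
  have "f \<in> degree_below n (Suc (Max (insert 0 (mon_degree ` Poly_Mapping.keys f))))"
    using assms by (auto simp: degree_below_def less_Suc_eq_le)
  then obtain c where "f - signed_comb n c \<in> J_B n" using deformed_normal_form by blast
  then have "f - signed_comb n c \<in> vanishing_ideal n (signed_perm_matrices n)"
    using J_B_vanishes by blast
  then show ?thesis by (intro exI[of _ c]) (simp add: vanishing_ideal_def)
qed

text \<open>The monomials span the functions on the finite set of matrices, which has at least as many
  points as there are monomials.\<close>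

lemma signed_comb_vanishing:
  assumes vanish: "signed_comb n c \<in> vanishing_ideal n (signed_perm_matrices n)"
    and w0: "w0 \<in> signed_perms n"
  shows "c w0 = 0"
proof (rule ccontr)
  assume cw0: "c w0 \<noteq> 0"
  let ?V = "signed_perm_matrices n" and ?W = "signed_perms n"
  interpret fs: vector_space "\<lambda>(a :: complex) (f :: (cell \<Rightarrow> complex) \<Rightarrow> complex) A. a * f A"
    by unfold_locales (auto simp: fun_eq_iff algebra_simps)
  \<comment> \<open>Functions on the points are extended by zero, so that the span can be taken in
    the space of all functions.\<close>
  define E where "E w = (\<lambda>A. if A \<in> ?V then peval A (signed_mon n w) else 0)" for w
  define D where "D B = (\<lambda>A :: cell \<Rightarrow> complex. if A = B then 1 else (0 :: complex))" for B
  have sum_apply: "(\<Sum>x\<in>X. g x) A = (\<Sum>x\<in>X. g x A)" for X :: "signed_perm set" and g A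
    by (induction X rule: infinite_finite_induct) auto
  have sum_apply': "(\<Sum>x\<in>X. g x) A = (\<Sum>x\<in>X. g x A)"
    for X :: "((cell \<Rightarrow> complex) \<Rightarrow> complex) set" and g A
    by (induction X rule: infinite_finite_induct) auto
  let ?S = "fs.span (E ` (?W - {w0}))"
  \<comment> \<open>A nonzero coefficient at \<open>w0\<close> makes its function redundant. The
    delta functions of all points then lie in the span of fewer functions than there are signed
    permutations, although they are independent.\<close>
  have E_span: "E w \<in> ?S" if "w \<in> ?W" for w
  proof (cases "w = w0")
    case False
    with that show ?thesis by (intro fs.span_base) auto
  next
    case True
    have "E w0 A = (\<Sum>w\<in>?W - {w0}. (- c w / c w0) * E w A)" for A
    proof (cases "A \<in> ?V")
      case True
      then have "0 = (\<Sum>w\<in>?W. c w * peval A (signed_mon n w))"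
        using vanish by (simp add: vanishing_ideal_def peval_signed_comb)
      also have "\<dots> = c w0 * peval A (signed_mon n w0) +
          (\<Sum>w\<in>?W - {w0}. c w * peval A (signed_mon n w))"
        using finite_signed_perms w0 by (rule sum.remove)
      finally have "peval A (signed_mon n w0) =
          (- 1 / c w0) * (\<Sum>w\<in>?W - {w0}. c w * peval A (signed_mon n w))"
        using cw0 by (simp add: field_simps eq_neg_iff_add_eq_0)
      then show ?thesis using True by (simp add: E_def sum_distrib_left)
    qed (simp add: E_def)
    then have "E w0 = (\<Sum>w\<in>?W - {w0}. (\<lambda>A. (- c w / c w0) * E w A))"
      by (intro ext) (simp add: sum_apply)
    moreover have "\<dots> \<in> ?S" by (intro fs.span_sum fs.span_scale fs.span_base) auto
    ultimately show ?thesis using True by simp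
  qed
  have D_span: "D B \<in> ?S" if B: "B \<in> ?V" for B
  proof -
    obtain f where f: "f \<in> carrier (poly_ring n)" "\<And>A. A \<in> ?V \<Longrightarrow> peval A f = (if A = B then 1 else 0)"
      using signed_perm_matrix_interpolation[OF B] by blast
    obtain d where d: "\<And>A. A \<in> ?V \<Longrightarrow> peval A f = peval A (signed_comb n d)"
      using evaluation_normal_form[OF f(1)] by blast
    have "D B A = (\<Sum>w\<in>?W. d w * E w A)" for A
    proof (cases "A \<in> ?V")
      case True
      then show ?thesis using f(2)[of A] d[of A] by (simp add: D_def E_def peval_signed_comb)
    next
      case False
      then have "A \<noteq> B" using B by blast
      with False show ?thesis by (simp add: D_def E_def)
    qed
    then have "D B = (\<Sum>w\<in>?W. (\<lambda>A. d w * E w A))"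
      by (intro ext) (simp add: sum_apply)
    moreover have "\<dots> \<in> ?S" by (intro fs.span_sum fs.span_scale E_span)
    ultimately show ?thesis by simp
  qed
  have inj: "inj_on D ?V"
    by (rule inj_onI) (metis D_def zero_neq_one)
  have "\<not> fs.dependent (D ` ?V)"
  proof
    assume "fs.dependent (D ` ?V)"
    then obtain u B where u: "(\<Sum>v\<in>D ` ?V. (\<lambda>A. u v * v A)) = 0" and B: "B \<in> ?V" "u (D B) \<noteq> 0"
      using finite_signed_perm_matrices by (auto simp: fs.dependent_finite)
    have "0 = (\<Sum>v\<in>D ` ?V. (\<lambda>A. u v * v A)) B" using u by simp
    also have "\<dots> = (\<Sum>v\<in>D ` ?V. u v * v B)" by (rule sum_apply')
    also have "\<dots> = (\<Sum>A\<in>?V. u (D A) * D A B)" by (rule sum.reindex_cong[OF inj]) auto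
    also have "\<dots> = (\<Sum>A\<in>?V. if A = B then u (D A) else 0)" by (intro sum.cong) (auto simp: D_def)
    also have "\<dots> = u (D B)" using B finite_signed_perm_matrices by simp
    finally show False using B by simp
  qed
  then have "card (D ` ?V) \<le> card (E ` (?W - {w0}))"
    using fs.independent_span_bound[of "E ` (?W - {w0})" "D ` ?V"] D_span finite_signed_perms by blast
  also have "\<dots> \<le> card (?W - {w0})" using finite_signed_perms by (intro card_image_le) auto
  also have "\<dots> < card ?W" using w0 finite_signed_perms by (intro psubset_card_mono) auto
  finally show False using card_signed_perms_le[of n] card_image[OF inj] by simp
qed

text \<open>Modulo \<open>J_B n\<close>, a vanishing polynomial becomes a combination of the
  monomials that also vanishes on the points, and all its coefficients are then zero.\<close>

lemma J_B_eq_vanishing_ideal: "J_B n = vanishing_ideal n (signed_perm_matrices n)"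
proof (intro equalityI J_B_vanishes subsetI)
  fix f assume f: "f \<in> vanishing_ideal n (signed_perm_matrices n)"
  then have "f \<in> carrier (poly_ring n)" by (simp add: vanishing_ideal_def)
  then have "f \<in> degree_below n (Suc (Max (insert 0 (mon_degree ` Poly_Mapping.keys f))))"
    by (auto simp: degree_below_def less_Suc_eq_le)
  then obtain c where c: "f - signed_comb n c \<in> J_B n" using deformed_normal_form by blast
  have "signed_comb n c \<in> vanishing_ideal n (signed_perm_matrices n)"
    using ideal_diff[OF vanishing_ideal_ideal f, of "f - signed_comb n c"] c J_B_vanishes by auto
  then have "c w = 0" if "w \<in> signed_perms n" for w using that by (rule signed_comb_vanishing)
  then have "signed_comb n c = 0" unfolding signed_comb_def by (intro sum.neutral) simp
  with c show "f \<in> J_B n" by simp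
qed

text \<open>The relation is restricted to the degree of \<open>w\<close> and lifted to
  \<open>J_B n\<close>. The error is reduced to signed monomials of smaller degree, so it cannot
  touch the coefficient of \<open>w\<close> in the resulting relation on the points.\<close>

lemma I_B_independent:
  assumes c: "signed_comb n c \<in> I_B n" and w: "w \<in> signed_perms n"
  shows "c w = 0"
proof -
  define d where "d = mon_degree (signed_exponent n w)"
  define c1 where "c1 w = (if mon_degree (signed_exponent n w) = d then c w else 0)" for w
  obtain h where h: "h \<in> J_B n" "signed_comb n c1 - h \<in> degree_below n d"
    using I_B_homog_part[OF c, of d] unfolding homog_part_signed_comb c1_def[abs_def, symmetric] by blast
  then obtain c2 where c2: "signed_comb n c1 - h - signed_comb n c2 \<in> J_B n"
    "\<And>w. c2 w \<noteq> 0 \<Longrightarrow> mon_degree (signed_exponent n w) < d"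
    using deformed_normal_form by blast
  have "signed_comb n (\<lambda>w. c1 w - c2 w) \<in> J_B n"
    using J_B_add[OF c2(1) h(1)] by (simp add: signed_comb_diff algebra_simps)
  then have "c1 w - c2 w = 0"
    using signed_comb_vanishing[of n "\<lambda>w. c1 w - c2 w" w] w J_B_vanishes by blast
  moreover have "c2 w = 0" using c2(2)[of w] by (auto simp: d_def)
  ultimately show ?thesis by (simp add: c1_def d_def)
qed

section \<open>Comparison with top degree parts\<close>

lemma top_component_deform:
  assumes "s \<noteq> 0" "\<forall>m\<in>Poly_Mapping.keys s. mon_degree m = k" "s - h \<in> degree_below n k"
  shows "h \<noteq> 0" "top_component h = s"
proof -
  have low: "Poly_Mapping.lookup h m = Poly_Mapping.lookup s m" if "mon_degree m \<ge> k" for m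
  proof -
    have "m \<notin> Poly_Mapping.keys (s - h)" using assms(3) that by (auto simp: degree_below_def)
    then show ?thesis by (simp add: in_keys_iff lookup_minus)
  qed
  have sk: "Poly_Mapping.lookup s m = 0" if "mon_degree m \<noteq> k" for m
    using assms(2) that by (auto simp: in_keys_iff)
  obtain m0 where m0: "m0 \<in> Poly_Mapping.keys s" using assms(1) by (metis keys_eq_empty ex_in_conv)
  then have "m0 \<in> Poly_Mapping.keys h" "mon_degree m0 = k" using assms(2) low by (auto simp: in_keys_iff)
  moreover have "mon_degree m \<le> k" if "m \<in> Poly_Mapping.keys h" for m
    using low[of m] sk[of m] that by (fastforce simp: in_keys_iff)
  ultimately have "poly_degree h = k"
    unfolding poly_degree_def by (intro Max_eqI) auto
  then show "top_component h = s"
    unfolding top_component_eq by (intro poly_mapping_eqI) (auto simp: low sk)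
  show "h \<noteq> 0" using \<open>m0 \<in> Poly_Mapping.keys h\<close> by auto
qed

text \<open>Each generator of \<open>I_B n\<close> is the top component of its lift in
  \<open>J_B n\<close>. Conversely, the top component of a vanishing polynomial reduces modulo
  \<open>I_B n\<close> to a combination of its own degree, and the point is to see that this
  combination is zero.\<close>

lemma I_B_eq_gr_ideal: "I_B n = gr_ideal n (vanishing_ideal n (signed_perm_matrices n))"
proof
  let ?I = "vanishing_ideal n (signed_perm_matrices n)"
  have sub: "{top_component f | f. f \<in> ?I \<and> f \<noteq> 0} \<subseteq> carrier (poly_ring n)"
    by (auto simp: vanishing_ideal_def top_component_eq homog_part_in_poly_ring)
  show "I_B n \<subseteq> gr_ideal n ?I"
    unfolding I_B_def gr_ideal_def
  proof (rule genideal_poly_minimal[OF genideal_poly_ideal[OF sub]], rule subsetI)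
    fix s assume "s \<in> {var i j ^ 3 | i j. i \<in> {1..n} \<and> j \<in> {1..n}} \<union> rook_products n \<union>
      {(\<Sum>j=1..n. var i j ^ 2) | i. i \<in> {1..n}} \<union> {(\<Sum>i=1..n. var i j ^ 2) | j. j \<in> {1..n}}"
    from I_B_generator_deform[OF this] obtain h k where h: "h \<in> J_B n" "s \<noteq> 0"
      "\<forall>m\<in>Poly_Mapping.keys s. mon_degree m = k" "s - h \<in> degree_below n k" by blast
    then have "s \<in> {top_component f | f. f \<in> ?I \<and> f \<noteq> 0}"
      using top_component_deform[OF h(2-4)] J_B_vanishes by blast
    then show "s \<in> Idl\<^bsub>poly_ring n\<^esub> {top_component f | f. f \<in> ?I \<and> f \<noteq> 0}"
      by (rule genideal_poly_self[OF sub])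
  qed
  show "gr_ideal n ?I \<subseteq> I_B n"
    unfolding gr_ideal_def
  proof (rule genideal_poly_minimal[OF I_B_ideal], rule subsetI)
    fix t assume "t \<in> {top_component f | f. f \<in> ?I \<and> f \<noteq> 0}"
    then obtain f where t: "t = top_component f" and f: "f \<in> ?I" "f \<noteq> 0" by blast
    define d where "d = poly_degree f"
    have fJ: "f \<in> J_B n" using f J_B_eq_vanishing_ideal by simp
    have fR: "f \<in> carrier (poly_ring n)" using J_B_subset[OF fJ] .
    have t': "t = homog_part d f" by (simp add: t top_component_eq d_def)
    have deg: "mon_degree m \<le> d" if "m \<in> Poly_Mapping.keys f" for m
      using that by (simp add: d_def poly_degree_def)
    obtain c where c: "homog_part d f - signed_comb n c \<in> I_B n"
      "\<And>w. c w \<noteq> 0 \<Longrightarrow> mon_degree (signed_exponent n w) = d"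
      using homogeneous_normal_form[of "homog_part d f" n d] fR
      by (auto simp: keys_homog_part homog_part_in_poly_ring)
    have "homog_part d (homog_part d f - signed_comb n c) = homog_part d f - signed_comb n c"
    proof -
      have "(\<lambda>w. if mon_degree (signed_exponent n w) = d then c w else 0) = c"
        by (intro ext) (metis c(2))
      moreover have "homog_part d (homog_part d f) = homog_part d f" by (rule poly_mapping_eqI) simp
      ultimately show ?thesis unfolding homog_part_diff homog_part_signed_comb by simp
    qed
    then obtain h where h: "h \<in> J_B n" "homog_part d f - signed_comb n c - h \<in> degree_below n d"
      using I_B_homog_part[OF c(1), of d] by auto
    have "f - homog_part d f \<in> degree_below n d"
      using deg homog_part_in_poly_ring[OF fR, of d] fR
      by (force simp: degree_below_def in_keys_iff lookup_minus le_less intro: poly_ring_closed split: if_splits)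
    from degree_below_add[OF this h(2)] have "f - signed_comb n c - h \<in> degree_below n d"
      by (simp add: algebra_simps)
    then obtain c' where c': "f - signed_comb n c - h - signed_comb n c' \<in> J_B n"
      "\<And>w. c' w \<noteq> 0 \<Longrightarrow> mon_degree (signed_exponent n w) < d"
      using deformed_normal_form by blast
    \<comment> \<open>The combination of degree \<open>d\<close> and the one for the lower terms of
      \<open>f\<close> add up to an element of \<open>J_B n\<close>. Their supports lie in different
      degrees, so each vanishes on its own.\<close>
    have "signed_comb n (\<lambda>w. c w + c' w) = f - h - (f - signed_comb n c - h - signed_comb n c')"
      by (simp add: signed_comb_add)
    also have "\<dots> \<in> J_B n" by (intro J_B_diff fJ h(1) c'(1))
    finally have "c w + c' w = 0" if "w \<in> signed_perms n" for w
      using signed_comb_vanishing[of n "\<lambda>w. c w + c' w" w] that J_B_vanishes by blast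
    then have "c w = 0" if "w \<in> signed_perms n" for w
      using that c(2)[of w] c'(2)[of w] by (metis add.right_neutral less_irrefl)
    then have "signed_comb n c = 0" unfolding signed_comb_def by (intro sum.neutral) simp
    then show "t \<in> I_B n" using c(1) t' by simp
  qed
qed

section \<open>The standard monomial basis\<close>

lemma coset_eq_iff:
  assumes I: "ideal I (poly_ring n)"
  shows "I +>\<^bsub>poly_ring n\<^esub> f = I +>\<^bsub>poly_ring n\<^esub> g \<longleftrightarrow> f - g \<in> I"
proof -
  have coset: "I +>\<^bsub>poly_ring n\<^esub> f = {h + f | h. h \<in> I}" for f
    by (auto simp: a_r_coset_def')
  show ?thesis
  proof
    assume "I +>\<^bsub>poly_ring n\<^esub> f = I +>\<^bsub>poly_ring n\<^esub> g"
    moreover have "f \<in> I +>\<^bsub>poly_ring n\<^esub> f"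
      unfolding coset using ideal_zero[OF I] by force
    ultimately obtain h where "h \<in> I" "f = h + g" unfolding coset by blast
    then show "f - g \<in> I" by simp
  next
    assume d: "f - g \<in> I"
    have "\<exists>h'\<in>I. h + f = h' + g \<and> (\<exists>h'\<in>I. h + g = h' + f)" if h: "h \<in> I" for h
    proof (intro bexI conjI)
      show "h + f = (h + (f - g)) + g" "h + g = (h - (f - g)) + f" by simp_all
      show "h + (f - g) \<in> I" "h - (f - g) \<in> I" using ideal_add[OF I h d] ideal_diff[OF I h d] .
    qed
    then show "I +>\<^bsub>poly_ring n\<^esub> f = I +>\<^bsub>poly_ring n\<^esub> g"
      unfolding coset by blast
  qed
qed

text \<open>Bridges polynomial identities and list-based linear algebra in the quotient. The span of
  a list is a chain of line extensions and is identified with the classes of explicit combinations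
  by induction on the list; independence is then built up one element at a time.\<close>

lemma descends_to_basisI:
  assumes I: "ideal I (poly_ring n)" and W: "finite W" and f: "\<And>w. w \<in> W \<Longrightarrow> f w \<in> carrier (poly_ring n)"
    and indep: "\<And>c w. (\<Sum>w\<in>W. pconst (c w) * f w) \<in> I \<Longrightarrow> w \<in> W \<Longrightarrow> c w = 0"
    and span: "\<And>g. g \<in> carrier (poly_ring n) \<Longrightarrow> \<exists>c. g - (\<Sum>w\<in>W. pconst (c w) * f w) \<in> I"
  shows "descends_to_basis n I W f"
proof -
  let ?R = "poly_ring n"
  define Q where "Q = ?R Quot I"
  define cls where "cls g = I +>\<^bsub>?R\<^esub> g" for g
  define K where "K = cls ` range pconst"
  interpret I: ideal I ?R by (rule I)
  interpret Q: ring Q unfolding Q_def by (rule I.quotient_is_ring)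
  have hom: "cls \<in> ring_hom ?R Q" unfolding cls_def[abs_def] Q_def by (rule I.rcos_ring_hom)
  have carrier: "carrier Q = cls ` carrier (poly_ring n)"
    by (auto simp: Q_def FactRing_def A_RCOSETS_def' cls_def)
  have cls_eq: "cls g = cls h \<longleftrightarrow> g - h \<in> I" for g h
    unfolding cls_def by (rule coset_eq_iff[OF I])
  have cls_zero: "cls 0 = \<zero>\<^bsub>Q\<^esub>"
    using coset_eq_iff[OF I] by (auto simp: cls_def Q_def FactRing_def a_r_coset_def')
  have cls_add: "cls (g + h) = cls g \<oplus>\<^bsub>Q\<^esub> cls h" if "g \<in> carrier (poly_ring n)" "h \<in> carrier (poly_ring n)" for g h
    using ring_hom_add[OF hom that] by simp
  have cls_mult: "cls (g * h) = cls g \<otimes>\<^bsub>Q\<^esub> cls h" if "g \<in> carrier (poly_ring n)" "h \<in> carrier (poly_ring n)" for g h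
    using ring_hom_mult[OF hom that] by simp
  have comb: "(\<Sum>w\<in>X. pconst (c w) * f w) \<in> carrier (poly_ring n)" if "X \<subseteq> W" for X c
    using that f by (intro poly_ring_sum_closed poly_ring_carrier_closed pconst_in_poly_ring) auto
  have Span: "Q.Span K (map (\<lambda>w. cls (f w)) ws) = {cls (\<Sum>w\<in>set ws. pconst (c w) * f w) | c. True}"
    if "distinct ws" "set ws \<subseteq> W" for ws
    using that
  proof (induction ws)
    case Nil
    then show ?case by (simp add: cls_zero)
  next
    case (Cons w ws)
    have w: "w \<in> W" "w \<notin> set ws" "set ws \<subseteq> W" using Cons.prems by auto
    \<comment> \<open>Overwriting the coefficient at \<open>w\<close> leaves the sum over
      \<open>ws\<close> unchanged, since \<open>w\<close> does not occur in
      \<open>ws\<close>.\<close>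
    have step: "cls (pconst a) \<otimes>\<^bsub>Q\<^esub> cls (f w) \<oplus>\<^bsub>Q\<^esub> cls (\<Sum>w\<in>set ws. pconst (c w) * f w) =
        cls (\<Sum>v\<in>set (w # ws). pconst ((c(w := a)) v) * f v)" for a c
    proof -
      have "(\<Sum>v\<in>set ws. pconst ((c(w := a)) v) * f v) = (\<Sum>v\<in>set ws. pconst (c v) * f v)"
        by (intro sum.cong) (use w(2) in auto)
      then have "(\<Sum>v\<in>set (w # ws). pconst ((c(w := a)) v) * f v) =
          pconst a * f w + (\<Sum>w\<in>set ws. pconst (c w) * f w)"
        using w(2) by simp
      then show ?thesis
        using comb[OF w(3)] f[OF w(1)] by (simp add: cls_add cls_mult poly_ring_carrier_closed)
    qed
    have "Q.Span K (map (\<lambda>w. cls (f w)) (w # ws)) =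
        Q.line_extension K (cls (f w)) {cls (\<Sum>w\<in>set ws. pconst (c w) * f w) | c. True}"
      using Cons by simp
    also have "\<dots> = {cls (\<Sum>w\<in>set (w # ws). pconst (c w) * f w) | c. True}"
    proof (intro equalityI subsetI)
      fix u assume "u \<in> Q.line_extension K (cls (f w)) {cls (\<Sum>w\<in>set ws. pconst (c w) * f w) | c. True}"
      then obtain a c where
        "u = cls (pconst a) \<otimes>\<^bsub>Q\<^esub> cls (f w) \<oplus>\<^bsub>Q\<^esub> cls (\<Sum>w\<in>set ws. pconst (c w) * f w)"
        unfolding Q.line_extension_mem_iff K_def by blast
      then show "u \<in> {cls (\<Sum>w\<in>set (w # ws). pconst (c w) * f w) | c. True}"
        unfolding step by blast
    next
      fix u assume "u \<in> {cls (\<Sum>w\<in>set (w # ws). pconst (c w) * f w) | c. True}"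
      then obtain c where "u = cls (\<Sum>w\<in>set (w # ws). pconst (c w) * f w)" by blast
      then have "u = cls (pconst (c w)) \<otimes>\<^bsub>Q\<^esub> cls (f w) \<oplus>\<^bsub>Q\<^esub> cls (\<Sum>w\<in>set ws. pconst (c w) * f w)"
        unfolding step by (simp only: fun_upd_triv)
      then show "u \<in> Q.line_extension K (cls (f w)) {cls (\<Sum>w\<in>set ws. pconst (c w) * f w) | c. True}"
        unfolding Q.line_extension_mem_iff K_def by blast
    qed
    finally show ?case .
  qed
  have independent: "Q.independent K (map (\<lambda>w. cls (f w)) ws)" if "distinct ws" "set ws \<subseteq> W" for ws
    using that
  proof (induction ws)
    case Nil
    then show ?case by simp
  next
    case (Cons w ws)
    have w: "w \<in> W" "w \<notin> set ws" "set ws \<subseteq> W" "distinct ws" using Cons.prems by auto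
    have "cls (f w) \<notin> Q.Span K (map (\<lambda>w. cls (f w)) ws)"
    proof
      assume "cls (f w) \<in> Q.Span K (map (\<lambda>w. cls (f w)) ws)"
      then obtain c where c: "f w - (\<Sum>w\<in>set ws. pconst (c w) * f w) \<in> I"
        unfolding Span[OF w(4,3)] by (auto simp: cls_eq)
      \<comment> \<open>The dependence of \<open>f w\<close> on later elements is rewritten as a
        relation over all of \<open>W\<close>: coefficient 1 at \<open>w\<close>, and zero off the
        list.\<close>
      define c' where "c' v = (if v = w then 1 else if v \<in> set ws then - c v else 0)" for v
      have "(\<Sum>v\<in>W. pconst (c' v) * f v) = (\<Sum>v\<in>insert w (set ws). pconst (c' v) * f v)"
        using w W by (intro sum.mono_neutral_right) (auto simp: c'_def)
      also have "\<dots> = f w + (\<Sum>v\<in>set ws. pconst (c' v) * f v)"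
        using w by (simp add: c'_def)
      also have "(\<Sum>v\<in>set ws. pconst (c' v) * f v) = - (\<Sum>v\<in>set ws. pconst (c v) * f v)"
        unfolding sum_negf[symmetric] using w by (intro sum.cong) (auto simp: c'_def)
      finally have "(\<Sum>v\<in>W. pconst (c' v) * f v) \<in> I" using c by simp
      then have "c' w = 0" using w(1) by (rule indep)
      then show False by (simp add: c'_def)
    qed
    then show ?case using Cons w f carrier by (auto intro!: Q.li_Cons)
  qed
  obtain ws where ws: "set ws = W" "distinct ws" using finite_distinct_list[OF W] by blast
  have spans: "Q.Span K (map (\<lambda>w. cls (f w)) ws) = carrier Q"
  proof (intro equalityI subsetI)
    fix u assume "u \<in> Q.Span K (map (\<lambda>w. cls (f w)) ws)"
    then show "u \<in> carrier Q" using Span[of ws] ws comb[of W] carrier by auto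
  next
    fix u assume "u \<in> carrier Q"
    then obtain g where g: "g \<in> carrier (poly_ring n)" "u = cls g" using carrier by blast
    then obtain c where "g - (\<Sum>w\<in>W. pconst (c w) * f w) \<in> I" using span by blast
    then have "u = cls (\<Sum>w\<in>W. pconst (c w) * f w)" using g cls_eq by blast
    then show "u \<in> Q.Span K (map (\<lambda>w. cls (f w)) ws)" using Span[of ws] ws by auto
  qed
  show ?thesis
    unfolding descends_to_basis_def Let_def
    using ws(2,1) independent[OF ws(2), unfolded Q_def K_def cls_def[abs_def]] ws(1)
      spans[unfolded Q_def K_def cls_def[abs_def]]
    by (intro exI[of _ ws] conjI) simp_all
qed

lemma I_B_spanning:
  assumes "g \<in> carrier (poly_ring n)"
  shows "\<exists>c. g - signed_comb n c \<in> I_B n"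
proof -
  have "\<exists>c. pmono m - signed_comb n c \<in> I_B n" if "m \<in> Poly_Mapping.keys g" for m
    using monomial_normal_form[of m n] that assms by (auto simp: mem_poly_ring_iff)
  then obtain C where C: "\<And>m. m \<in> Poly_Mapping.keys g \<Longrightarrow> pmono m - signed_comb n (C m) \<in> I_B n" by metis
  have "g - signed_comb n (\<lambda>w. \<Sum>m\<in>Poly_Mapping.keys g. Poly_Mapping.lookup g m * C m w) =
      (\<Sum>m\<in>Poly_Mapping.keys g. pconst (Poly_Mapping.lookup g m) * (pmono m - signed_comb n (C m)))"
    unfolding signed_comb_sum
    by (subst cpoly_expand[of "Poly_Mapping.keys g" g]) (simp_all add: right_diff_distrib sum_subtractf)
  also have "\<dots> \<in> I_B n" by (intro I_B_sum I_B_mult C pconst_in_poly_ring)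
  finally show ?thesis by blast
qed

section \<open>The initial ideal and its standard monomials\<close>

lemma initial_ideal_generators_subset:
  assumes "I \<subseteq> carrier (poly_ring n)"
  shows "{pmono m | m f. f \<in> I \<and> f \<noteq> 0 \<and> is_leading_mon m f} \<subseteq> carrier (poly_ring n)"
  using assms by (auto simp: is_leading_mon_def mem_poly_ring_iff)

text \<open>The generators are monomials, and divisibility of every occurring monomial by some
  leading monomial survives sums and multiplication by terms.\<close>

lemma initial_ideal_divisor:
  assumes I: "I \<subseteq> carrier (poly_ring n)" and g: "g \<in> initial_ideal n I" and m: "m \<in> Poly_Mapping.keys g"
  shows "\<exists>a l. \<exists>f\<in>I. is_leading_mon l f \<and> m = a + l"
proof -
  have "\<forall>m\<in>Poly_Mapping.keys g. \<exists>a l. \<exists>f\<in>I. is_leading_mon l f \<and> m = a + l"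
    using initial_ideal_generators_subset[OF I] g[unfolded initial_ideal_def]
  proof (induction g rule: genideal_poly_induct)
    case (gen s)
    then obtain m f where s: "s = pmono m" and f: "f \<in> I" "is_leading_mon m f" by blast
    show ?case unfolding s
      by (intro ballI exI[of _ 0] exI[of _ m] bexI[of _ f]) (simp_all add: f)
  next
    case (add f g)
    then show ?case using keys_add[of f g] by blast
  next
    case (monom c m f)
    show ?case
    proof
      fix k assume "k \<in> Poly_Mapping.keys (pconst c * pmono m * f)"
      then have "k \<in> Poly_Mapping.keys (pmono m * f)"
        using keys_pconst_mult[of c "pmono m * f"] by (auto simp: mult.assoc)
      then obtain k' where "k' \<in> Poly_Mapping.keys f" "k = m + k'" unfolding keys_pmono_mult by blast
      then obtain a l f' where "f' \<in> I" "is_leading_mon l f'" "k = (m + a) + l"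
        using monom(3) by (metis add.assoc)
      then show "\<exists>a l. \<exists>f\<in>I. is_leading_mon l f \<and> k = a + l" by blast
    qed
  qed simp
  then show ?thesis using m by blast
qed

text \<open>Otherwise some multiple \<open>h\<close> of an element of \<open>I_B n\<close> would
  have the exponent \<open>m\<close> of \<open>w\<close> as its leading monomial. Reducing the
  smaller monomials of \<open>h\<close> involves only exponents below \<open>m\<close>, so the
  coefficient of \<open>w\<close> stays equal to the nonzero leading coefficient, against
  independence.\<close>

lemma signed_mon_not_initial:
  assumes w: "w \<in> signed_perms n"
  shows "signed_mon n w \<notin> initial_ideal n (I_B n)"
proof
  define m where "m = signed_exponent n w"
  have sw: "signed_mon n w = pmono m" by (simp add: m_def signed_mon_pmono)
  assume "signed_mon n w \<in> initial_ideal n (I_B n)"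
  moreover have "I_B n \<subseteq> carrier (poly_ring n)" using I_B_subset by blast
  ultimately obtain a l f where f: "f \<in> I_B n" "is_leading_mon l f" "m = a + l"
    using initial_ideal_divisor[of "I_B n" n "pmono m" m] by (auto simp: sw)
  define h where "h = pmono a * f"
  have "Poly_Mapping.keys a \<subseteq> grid n"
    using signed_exponent_keys[OF w] f(3) by (simp add: m_def[symmetric] keys_plus_mon)
  then have hI: "h \<in> I_B n" unfolding h_def using f(1) by (intro I_B_mult) auto
  have hm: "Poly_Mapping.lookup h m \<noteq> 0"
    using f(2) by (simp add: h_def f(3) is_leading_mon_def in_keys_iff)
  have low: "toeplitz_less k m" if "k \<in> Poly_Mapping.keys h" "k \<noteq> m" for k
    using that f(2) unfolding h_def f(3) keys_pmono_mult is_leading_mon_def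
    by (auto intro: toeplitz_less_plus)
  \<comment> \<open>The leading monomial is represented by \<open>w\<close> itself instead of being
    passed through the normal form, which fixes its coefficient at \<open>w\<close> as 1.\<close>
  have "\<exists>c. pmono k - signed_comb n c \<in> I_B n \<and> c w = (if k = m then 1 else 0)"
    if k: "k \<in> Poly_Mapping.keys h" for k
  proof (cases "k = m")
    case True
    then show ?thesis
      using signed_comb_single[OF w] I_B_zero
      by (intro exI[of _ "\<lambda>w'. if w' = w then 1 else 0"]) (simp add: sw)
  next
    case False
    have "Poly_Mapping.keys k \<subseteq> grid n" using I_B_subset[OF hI] k by (simp add: mem_poly_ring_iff)
    then obtain c where c: "pmono k - signed_comb n c \<in> I_B n"
      "\<And>w. c w \<noteq> 0 \<Longrightarrow> signed_exponent n w = k \<or> toeplitz_less (signed_exponent n w) k"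
      using monomial_normal_form by blast
    have "c w = 0"
      using c(2)[of w] low[OF k False] False toeplitz_less_trans toeplitz_less_irrefl
      unfolding m_def[symmetric] by blast
    with c(1) False show ?thesis by auto
  qed
  then obtain C where C: "\<And>k. k \<in> Poly_Mapping.keys h \<Longrightarrow> pmono k - signed_comb n (C k) \<in> I_B n"
    "\<And>k. k \<in> Poly_Mapping.keys h \<Longrightarrow> C k w = (if k = m then 1 else 0)" by metis
  define c where "c w' = (\<Sum>k\<in>Poly_Mapping.keys h. Poly_Mapping.lookup h k * C k w')" for w'
  have "h - signed_comb n c = (\<Sum>k\<in>Poly_Mapping.keys h. pconst (Poly_Mapping.lookup h k) * (pmono k - signed_comb n (C k)))"
    unfolding c_def[abs_def] signed_comb_sum
    by (subst cpoly_expand[of "Poly_Mapping.keys h" h]) (simp_all add: right_diff_distrib sum_subtractf)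
  also have "\<dots> \<in> I_B n" by (intro I_B_sum I_B_mult C(1) pconst_in_poly_ring)
  finally have "signed_comb n c \<in> I_B n"
    using I_B_diff[OF hI] by fastforce
  then have "c w = 0" using w by (rule I_B_independent)
  moreover have "c w = (\<Sum>k\<in>Poly_Mapping.keys h. if k = m then Poly_Mapping.lookup h k else 0)"
    unfolding c_def by (intro sum.cong) (simp_all add: C(2))
  ultimately show False using hm by (simp add: in_keys_iff)
qed

text \<open>In the dichotomy a reduction of \<open>m\<close> is an element of \<open>I_B n\<close>
  with leading monomial \<open>m\<close>, so a standard monomial must come from a signed
  permutation.\<close>

lemma standard_monomials_I_B:
  "standard_monomials n (I_B n) = signed_mon n ` signed_perms n"
proof (intro equalityI subsetI)
  fix s assume "s \<in> standard_monomials n (I_B n)"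
  then obtain m where m: "s = pmono m" "Poly_Mapping.keys m \<subseteq> grid n" "pmono m \<notin> initial_ideal n (I_B n)"
    unfolding standard_monomials_def by blast
  have "\<not> (F \<in> I_B n \<and> Poly_Mapping.lookup F m = 1 \<and>
      (\<forall>m'\<in>Poly_Mapping.keys F. m' \<noteq> m \<longrightarrow> toeplitz_less m' m \<and> mon_degree m' = mon_degree m))" for F
  proof
    assume F: "F \<in> I_B n \<and> Poly_Mapping.lookup F m = 1 \<and>
      (\<forall>m'\<in>Poly_Mapping.keys F. m' \<noteq> m \<longrightarrow> toeplitz_less m' m \<and> mon_degree m' = mon_degree m)"
    then have "F \<noteq> 0" "is_leading_mon m F" by (auto simp: is_leading_mon_def in_keys_iff)
    with F have "pmono m \<in> {pmono m | m f. f \<in> I_B n \<and> f \<noteq> 0 \<and> is_leading_mon m f}" by blast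
    moreover have "I_B n \<subseteq> carrier (poly_ring n)" using I_B_subset by blast
    ultimately have "pmono m \<in> initial_ideal n (I_B n)"
      unfolding initial_ideal_def by (intro genideal_poly_self initial_ideal_generators_subset)
    with m(3) show False ..
  qed
  then show "s \<in> signed_mon n ` signed_perms n"
    using signed_mon_dichotomy[OF m(2)] m(1) by (metis imageI)
next
  fix s assume "s \<in> signed_mon n ` signed_perms n"
  then obtain w where "s = signed_mon n w" "w \<in> signed_perms n" by blast
  then show "s \<in> standard_monomials n (I_B n)"
    unfolding standard_monomials_def
    using signed_mon_not_initial signed_exponent_keys signed_mon_pmono by (auto, metis)
qed

theorem theorem3p11:
  fixes n :: nat
  assumes "n \<ge> 1"
  shows "I_B n = gr_ideal n (vanishing_ideal n (signed_perm_matrices n))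
    \<and> J_B n = vanishing_ideal n (signed_perm_matrices n)
    \<and> descends_to_basis n (I_B n) (signed_perms n) (signed_mon n)
    \<and> signed_mon n ` signed_perms n = standard_monomials n (I_B n)"
proof (intro conjI)
  show "descends_to_basis n (I_B n) (signed_perms n) (signed_mon n)"
  proof (rule descends_to_basisI[OF I_B_ideal finite_signed_perms signed_mon_in_poly_ring])
    show "c w = 0" if "(\<Sum>w\<in>signed_perms n. pconst (c w) * signed_mon n w) \<in> I_B n"
      "w \<in> signed_perms n" for c w
      using that I_B_independent unfolding signed_comb_def by blast
    show "\<exists>c. g - (\<Sum>w\<in>signed_perms n. pconst (c w) * signed_mon n w) \<in> I_B n" if "g \<in> carrier (poly_ring n)" for g
      using I_B_spanning[OF that] unfolding signed_comb_def .
  qed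
qed (simp_all only: I_B_eq_gr_ideal[symmetric] J_B_eq_vanishing_ideal standard_monomials_I_B)

end
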